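(* Let $\Gamma$ be a simple gain graph on the vertex set $\{1,2,3\}$ with gain group $\mathbb{Z}$, and let $q\in\mathbb{C}$ be either a transcendental number or a positive real number other than $1$. Then $\mathbf{c}\mathcal{A}(\Gamma)$ is free if and only if $\mathcal{B}(\Gamma)$ is free.
   Context: A simple gain graph $\Gamma$ with vertex set $[\ell]$ and gain group $\mathbb{Z}$ has a finite edge set $E_\Gamma$ of classes $[i,j,g]$, $i\neq j$, $g\in\mathbb{Z}$, where $[i,j,g]=[j,i,-g]$. $\mathcal{A}(\Gamma)=\{\{x_i-x_j=g\}:[i,j,g]\in E_\Gamma\}$ in $\mathbb{Q}^\ell$; its cone $\mathbf{c}\mathcal{A}(\Gamma)$ is the central arrangement in $\mathbb{Q}^{\ell+1}$ (coordinates $x_1,\dots,x_\ell,z$) consisting of $\{z=0\}$ and $\{x_i-x_j=gz\}$ for $[i,j,g]\in E_\Gamma$. $\mathcal{B}(\Gamma)$ is the arrangement in $\mathbb{C}^\ell$ consisting of $\{x_i=0\}$ for $1\le i\le\ell$ and $\{x_i-q^gx_j=0\}$ for $[i,j,g]\in E_\Gamma$. A central arrangement $\mathcal{A}$ in $\mathbb{K}^n$ is free if $D(\mathcal{A})=\{\theta\in\mathrm{Der}(\mathbb{K}[x_1,\dots,x_n]):\theta(\alpha_H)\in\alpha_H\mathbb{K}[x_1,\dots,x_n]\ \forall H\in\mathcal{A}\}$ is a free module ($\alpha_H$ a defining linear form of $H$). *)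

theory Defs
  imports
    Complex_Main
    "HOL-Library.Poly_Mapping"
    "HOL-Library.Function_Algebras"
    "HOL-Library.Numeral_Type"
    "HOL-Computational_Algebra.Polynomial"
    "HOL-Analysis.Finite_Cartesian_Product"
begin

section \<open>Polynomial rings and derivations\<close>

text \<open>Polynomials over \<open>'k\<close> in the indeterminates indexed by \<open>'n\<close>: finitely supported
  functions from exponent vectors to coefficients, with the convolution product.\<close>

type_synonym ('n, 'k) mpol = "('n \<Rightarrow>\<^sub>0 nat) \<Rightarrow>\<^sub>0 'k"

definition Var :: "'n \<Rightarrow> ('n, 'k::comm_ring_1) mpol" where
  "Var i = Poly_Mapping.single (Poly_Mapping.single i 1) 1"

definition Const :: "'k \<Rightarrow> ('n, 'k::comm_ring_1) mpol" where
  "Const c = Poly_Mapping.single 0 c"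

definition derivations :: "(('n, 'k::field) mpol \<Rightarrow> ('n, 'k) mpol) set" where
  "derivations = {\<theta>.
     (\<forall>f g. \<theta> (f + g) = \<theta> f + \<theta> g) \<and>
     (\<forall>c f. \<theta> (Const c * f) = Const c * \<theta> f) \<and>
     (\<forall>f g. \<theta> (f * g) = f * \<theta> g + g * \<theta> f)}"

text \<open>Self-maps of the polynomial ring form a module over it under the pointwise operations;
  the derivations are a submodule.\<close>

definition mscale ::
  "('n, 'k::field) mpol \<Rightarrow> (('n, 'k) mpol \<Rightarrow> ('n, 'k) mpol) \<Rightarrow> (('n, 'k) mpol \<Rightarrow> ('n, 'k) mpol)"
  where "mscale p \<theta> = (\<lambda>f. p * \<theta> f)"

global_interpretation maps: module "mscale :: ('n, 'k::field) mpol \<Rightarrow> _"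
  by standard (auto simp: mscale_def fun_eq_iff algebra_simps)

section \<open>Free central arrangements\<close>

text \<open>A central arrangement in \<open>'k ^ 'n\<close> is given by its finite set of hyperplanes, which are
  sets of points.\<close>

definition linear_form :: "'k ^ 'n \<Rightarrow> ('n::finite, 'k::field) mpol" where
  "linear_form a = (\<Sum>i\<in>UNIV. Const (a $ i) * Var i)"

definition defining_form :: "('n::finite, 'k::field) mpol \<Rightarrow> ('k ^ 'n) set \<Rightarrow> bool" where
  "defining_form \<alpha> H \<longleftrightarrow>
     (\<exists>a. a \<noteq> 0 \<and> \<alpha> = linear_form a \<and> H = {x. (\<Sum>i\<in>UNIV. a $ i * x $ i) = 0})"

definition central_arrangement :: "('k::field ^ 'n::finite) set set \<Rightarrow> bool" where
  "central_arrangement \<A> \<longleftrightarrow> finite \<A> \<and> (\<forall>H\<in>\<A>. \<exists>\<alpha>. defining_form \<alpha> H)"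

text \<open>A defining form is unique up to a nonzero scalar, so quantifying over all of them
  is the same as choosing one for each hyperplane.\<close>

definition log_derivations ::
  "('k::field ^ 'n::finite) set set \<Rightarrow> (('n, 'k) mpol \<Rightarrow> ('n, 'k) mpol) set" where
  "log_derivations \<A> =
     {\<theta> \<in> derivations. \<forall>H\<in>\<A>. \<forall>\<alpha>. defining_form \<alpha> H \<longrightarrow> \<alpha> dvd \<theta> \<alpha>}"

definition free_arrangement :: "('k::field ^ 'n::finite) set set \<Rightarrow> bool" where
  "free_arrangement \<A> \<longleftrightarrow>
     (\<exists>B \<subseteq> log_derivations \<A>. maps.independent B \<and> maps.span B = log_derivations \<A>)"

section \<open>Integral gain graphs and their arrangements\<close>

text \<open>The class \<open>[i, j, g] = [j, i, -g]\<close>.\<close>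

definition gain_edge :: "'v \<Rightarrow> 'v \<Rightarrow> int \<Rightarrow> ('v \<times> 'v \<times> int) set" where
  "gain_edge i j g = {(i, j, g), (j, i, - g)}"

text \<open>A gain graph on the vertex set \<open>'v\<close> is given by its set of edges.\<close>

definition simple_gain_graph :: "('v \<times> 'v \<times> int) set set \<Rightarrow> bool" where
  "simple_gain_graph E \<longleftrightarrow> finite E \<and> E \<subseteq> {gain_edge i j g | i j g. i \<noteq> j}"

text \<open>In the cone, the coordinate \<open>None\<close> is the homogenizing coordinate \<open>z\<close> and
  \<open>Some i\<close> is \<open>x\<^sub>i\<close>.\<close>

definition cone_arrangement :: "('v::finite \<times> 'v \<times> int) set set \<Rightarrow> (rat ^ 'v option) set set" where
  "cone_arrangement E =
     insert {x. x $ None = 0}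
       {{x. x $ Some i - x $ Some j = of_int g * x $ None} | i j g. gain_edge i j g \<in> E}"

definition q_arrangement ::
  "complex \<Rightarrow> ('v::finite \<times> 'v \<times> int) set set \<Rightarrow> (complex ^ 'v) set set" where
  "q_arrangement q E =
     {{x. x $ i = 0} | i. True} \<union>
     {{x. x $ i - q powi g * x $ j = 0} | i j g. gain_edge i j g \<in> E}"

lemma central_cone_arrangement:
  assumes "simple_gain_graph E"
  shows "central_arrangement (cone_arrangement E)"
proof -
  have *: "i \<noteq> j" if "gain_edge i j g \<in> E" for i j g
    using assms that by (fastforce simp: simple_gain_graph_def gain_edge_def doubleton_eq_iff)
  have fin: "finite (\<Union>E)"
    using assms by (auto simp: simple_gain_graph_def gain_edge_def)
  have "{{x::rat^'a option. x $ Some i - x $ Some j = of_int g * x $ None} | i j g. gain_edge i j g \<in> E}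
     \<subseteq> (\<lambda>(i,j,g). {x. x $ Some i - x $ Some j = of_int g * x $ None}) ` \<Union>E"
    by (force simp: gain_edge_def)
  then have "finite (cone_arrangement E)"
    unfolding cone_arrangement_def using fin finite_subset by blast
  moreover have "\<exists>\<alpha>. defining_form \<alpha> {x::rat^'a option. x $ None = 0}"
    unfolding defining_form_def
    by (rule exI, rule exI[of _ "axis None 1"], intro conjI, simp, rule refl)
       (simp add: axis_def if_distrib[of "\<lambda>c. c * _"] cong: if_cong)
  moreover have "\<exists>\<alpha>. defining_form \<alpha> {x::rat^'a option. x $ Some i - x $ Some j = of_int g * x $ None}"
    if "i \<noteq> j" for i j g
  proof -
    let ?a = "(\<chi> k. (if k = Some i then 1 else 0) + (if k = Some j then -1 else 0)
        + (if k = None then - of_int g else 0)) :: rat^'a option"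
    have "?a $ Some i = 1" using that by simp
    then have "?a \<noteq> 0" by (metis zero_index zero_neq_one)
    moreover have "(\<Sum>k\<in>UNIV. ?a $ k * x $ k) = x $ Some i - x $ Some j - of_int g * x $ None" for x
      by (simp add: distrib_right sum.distrib if_distrib[of "\<lambda>c. c * _"] cong: if_cong)
    ultimately show ?thesis
      unfolding defining_form_def by (intro exI[of _ "linear_form ?a"] exI[of _ ?a]) auto
  qed
  ultimately show ?thesis
    using * unfolding central_arrangement_def cone_arrangement_def by blast
qed

lemma central_q_arrangement:
  assumes "simple_gain_graph E"
  shows "central_arrangement (q_arrangement q E)"
proof -
  have *: "i \<noteq> j" if "gain_edge i j g \<in> E" for i j g
    using assms that by (fastforce simp: simple_gain_graph_def gain_edge_def doubleton_eq_iff)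
  have fin: "finite (\<Union>E)"
    using assms by (auto simp: simple_gain_graph_def gain_edge_def)
  have "{{x::complex^'a. x $ i - q powi g * x $ j = 0} | i j g. gain_edge i j g \<in> E}
     \<subseteq> (\<lambda>(i,j,g). {x. x $ i - q powi g * x $ j = 0}) ` \<Union>E"
    by (force simp: gain_edge_def)
  moreover have "finite {{x::complex^'a. x $ i = 0} | i. True}"
    by (simp add: full_SetCompr_eq)
  ultimately have "finite (q_arrangement q E)"
    unfolding q_arrangement_def using fin finite_subset by blast
  moreover have "\<exists>\<alpha>. defining_form \<alpha> {x::complex^'a. x $ i = 0}" for i
    unfolding defining_form_def
    by (rule exI, rule exI[of _ "axis i 1"], intro conjI, simp, rule refl)
       (simp add: axis_def if_distrib[of "\<lambda>c. c * _"] cong: if_cong)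
  moreover have "\<exists>\<alpha>. defining_form \<alpha> {x::complex^'a. x $ i - q powi g * x $ j = 0}"
    if "i \<noteq> j" for i j g
  proof -
    let ?a = "(\<chi> k. (if k = i then 1 else 0) + (if k = j then - (q powi g) else 0)) :: complex^'a"
    have "?a $ i = 1" using that by simp
    then have "?a \<noteq> 0" by (metis zero_index zero_neq_one)
    moreover have "(\<Sum>k\<in>UNIV. ?a $ k * x $ k) = x $ i - q powi g * x $ j" for x
      by (simp add: distrib_right sum.distrib if_distrib[of "\<lambda>c. c * _"] cong: if_cong)
    ultimately show ?thesis
      unfolding defining_form_def by (intro exI[of _ "linear_form ?a"] exI[of _ ?a]) auto
  qed
  ultimately show ?thesis
    using * unfolding central_arrangement_def q_arrangement_def by blast
qed

lemma subspace_log_derivations: "maps.subspace (log_derivations \<A>)"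
  by (auto simp: maps.subspace_def log_derivations_def derivations_def mscale_def algebra_simps)

end

theory Submission
  imports Defs "HOL-Library.Option_ord" "HOL-Library.Product_Plus"
begin

text \<open>Both arrangements have rank three and are governed by the same triangles of the gain graph: the
  restriction of \<open>B(\<Gamma>)\<close> to the hyperplane of an edge has exactly one point more than the restriction
  of \<open>cA(\<Gamma>)\<close>, because \<open>q\<^sup>n = 1\<close> only for \<open>n = 0\<close>. If the rank three arrangement is free with
  exponents \<open>(1, d\<^sub>1, d\<^sub>2)\<close> and \<open>r + 1\<close> points lie on a line, then \<open>r \<le> min d\<^sub>1 d\<^sub>2\<close> or
  \<open>r \<in> {d\<^sub>1, d\<^sub>2}\<close>. Choosing a line of extreme gain makes \<open>r\<close> so large that \<open>r \<in> {d\<^sub>1, d\<^sub>2}\<close>; the line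
  may then be deleted, and by the addition theorem it may be added again in either arrangement.
  Hence freeness of each of them is equivalent to the same combinatorial condition on \<open>\<Gamma>\<close>.\<close>

section \<open>Polynomials: substitution and homogeneous components\<close>

text \<open>A free arrangement of rank three need not be inductively free in general. Here the gains
  are integers, hence ordered, and some edge of extreme gain lies in so few triangles that its
  \<open>r\<close> satisfies \<open>D1 + D2 \<le> 2 * r + 1\<close>. This excludes that
  \<open>r\<close> is smaller than both exponents, so a free arrangement can be dismantled edge by
  edge. The counting needs degrees, but freeness speaks of an arbitrary basis of derivations,
  possibly inhomogeneous. The bridge is Saito's determinant: for suitable three members of such a
  basis it is the product of the linear forms times a polynomial with nonzero constant term, and its
  component of lowest degree already yields a homogeneous basis containing the Euler vector. The
  cone has rank three but lives in dimension four. Derivations are therefore recorded by their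
  values on three linear forms, and the direction common to all hyperplanes enters only in the
  comparison with the module definition. Thus one abstract model, with a shift \<open>m\<close> of
  the exponents (0 for the cone, 1 for the other arrangement), serves both sides.\<close>

lemma lookup_sum_single:
  assumes "finite A"
  shows "Poly_Mapping.lookup (\<Sum>k\<in>A. Poly_Mapping.single k (a k)) j = (if j \<in> A then a j else 0)"
  using assms by (simp add: lookup_sum lookup_single when_def)

lemma poly_mapping_sum_single:
  "f = (\<Sum>k\<in>Poly_Mapping.keys f. Poly_Mapping.single k (Poly_Mapping.lookup f k))"
  by (rule poly_mapping_eqI) (simp add: lookup_sum_single in_keys_iff)

lemma poly_mapping_add_induct [case_names single add]:
  assumes single: "\<And>k a. P (Poly_Mapping.single k a)"
    and add: "\<And>f g. P f \<Longrightarrow> P g \<Longrightarrow> P (f + g)"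
  shows "P (f :: 'a \<Rightarrow>\<^sub>0 'b::comm_monoid_add)"
proof -
  have "P (\<Sum>k\<in>A. Poly_Mapping.single k (Poly_Mapping.lookup f k))" if "finite A" for A
    using that
  proof induction
    case empty
    show ?case using single[of undefined 0] by simp
  next
    case (insert x F)
    then show ?case using single add by simp
  qed
  then show ?thesis using poly_mapping_sum_single[of f] finite_keys by metis
qed

lemma Const_add: "Const (a + b) = Const a + Const b"
  by (simp add: Const_def single_add)
lemma Const_mult: "Const (a * b) = Const a * Const b"
  by (simp add: Const_def mult_single)
lemma Const_0 [simp]: "Const 0 = 0"
  by (simp add: Const_def)
lemma Const_1 [simp]: "Const 1 = 1"
  by (simp add: Const_def)
lemma Const_uminus: "Const (- a) = - Const a"
  by (simp add: Const_def single_uminus)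
lemma Const_diff: "Const (a - b) = Const a - Const b"
  by (simp add: Const_def single_diff)
lemma Const_eq_iff [simp]: "Const a = Const b \<longleftrightarrow> a = b"
  by (simp add: Const_def inj_eq)
lemma Const_eq_0_iff [simp]: "Const a = 0 \<longleftrightarrow> a = 0"
  using Const_eq_iff[of a 0] by (simp del: Const_eq_iff)

lemmas Const_simps = Const_add Const_mult Const_uminus Const_diff

lemma dvd_Const_mult_cancel:
  assumes "f dvd Const c * (g :: ('n, 'k::field) mpol)" "c \<noteq> 0"
  shows "f dvd g"
proof -
  have "f dvd Const (1 / c) * (Const c * g)" using assms(1) by (rule dvd_mult)
  moreover have "Const (1 / c) * (Const c * g) = g"
    using assms(2) by (simp add: mult.assoc[symmetric] flip: Const_mult)
  ultimately show ?thesis by simp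
qed

lemma single_eq_Const_mult: "Poly_Mapping.single k a = Const a * Poly_Mapping.single k 1"
  by (simp add: Const_def mult_single)

lemma single_one_eq_prod:
  fixes e :: "'n::finite \<Rightarrow>\<^sub>0 nat"
  shows "Poly_Mapping.single e 1 = (\<Prod>i\<in>UNIV. Var i ^ Poly_Mapping.lookup e i :: ('n, 'k::comm_ring_1) mpol)"
proof -
  have pow: "Var i ^ m = (Poly_Mapping.single (Poly_Mapping.single i m) 1 :: ('n,'k) mpol)" for i m
    by (induction m) (simp_all add: Var_def mult_single flip: single_add)
  have pr: "(\<Prod>i\<in>A. Poly_Mapping.single (g i) 1) = (Poly_Mapping.single (\<Sum>i\<in>A. g i) 1 :: ('n,'k) mpol)"
    if "finite A" for A :: "'n set" and g
    using that by induction (simp_all add: mult_single)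
  have "(\<Sum>i\<in>UNIV. Poly_Mapping.single i (Poly_Mapping.lookup e i)) = e"
    by (rule poly_mapping_eqI) (simp add: lookup_sum_single)
  then show ?thesis by (simp add: pow pr)
qed

text \<open>Constants and variables generate the polynomial ring, so identities between
  homomorphisms or between derivations need to be checked on these generators only.\<close>

lemma mpol_induct [case_names Const Var add mult]:
  fixes f :: "('n::finite, 'k::comm_ring_1) mpol"
  assumes "\<And>c. P (Const c)" and Var: "\<And>i. P (Var i)"
    and "\<And>f g. P f \<Longrightarrow> P g \<Longrightarrow> P (f + g)" and m: "\<And>f g. P f \<Longrightarrow> P g \<Longrightarrow> P (f * g)"
  shows "P f"
proof (induction f rule: poly_mapping_add_induct)
  case (single k a)
  have one: "P 1" using assms(1)[of 1] by simp
  have pw: "P (Var i ^ j)" for i j by (induction j) (use one Var m in auto)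
  have "P (\<Prod>i\<in>A. Var i ^ Poly_Mapping.lookup k i)" if "finite A" for A
    using that by induction (use one m pw in auto)
  then show ?case using m assms(1) by (subst single_eq_Const_mult) (simp add: single_one_eq_prod)
qed (use assms in auto)

section \<open>Ring homomorphisms and substitution\<close>

definition ring_hom_fun :: "('a::comm_ring_1 \<Rightarrow> 'b::comm_ring_1) \<Rightarrow> bool" where
  "ring_hom_fun h \<longleftrightarrow> h 1 = 1 \<and> (\<forall>x y. h (x + y) = h x + h y) \<and> (\<forall>x y. h (x * y) = h x * h y)"

lemma
  assumes "ring_hom_fun h"
  shows ring_hom_fun_1: "h 1 = 1" and ring_hom_fun_add: "h (x + y) = h x + h y"
    and ring_hom_fun_mult: "h (x * y) = h x * h y" and ring_hom_fun_0: "h 0 = 0"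
    and ring_hom_fun_minus: "h (- x) = - h x" and ring_hom_fun_diff: "h (x - y) = h x - h y"
proof -
  show h: "h 1 = 1" "h (x + y) = h x + h y" "h (x * y) = h x * h y" for x y
    using assms by (auto simp: ring_hom_fun_def)
  show z: "h 0 = 0" using h(2)[of 0 0] by simp
  show u: "h (- x) = - h x" for x using h(2)[of "- x" x] z by (simp add: eq_neg_iff_add_eq_0)
  show "h (x - y) = h x - h y" using h(2)[of x "- y"] u by simp
qed

lemmas ring_hom_fun_simps = ring_hom_fun_1 ring_hom_fun_add ring_hom_fun_mult ring_hom_fun_0
  ring_hom_fun_minus ring_hom_fun_diff

lemma ring_hom_fun_prod: "ring_hom_fun h \<Longrightarrow> h (\<Prod>i\<in>A. f i) = (\<Prod>i\<in>A. h (f i))"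
  by (induction A rule: infinite_finite_induct) (auto simp: ring_hom_fun_simps)

lemma ring_hom_fun_sum: "ring_hom_fun h \<Longrightarrow> h (\<Sum>i\<in>A. f i) = (\<Sum>i\<in>A. h (f i))"
  by (induction A rule: infinite_finite_induct) (auto simp: ring_hom_fun_simps)

lemma ring_hom_fun_dvd: "ring_hom_fun h \<Longrightarrow> x dvd y \<Longrightarrow> h x dvd h y"
  by (auto elim!: dvdE simp: ring_hom_fun_simps)

lemma ring_hom_fun_Const: "ring_hom_fun Const"
  by (simp add: ring_hom_fun_def Const_simps)

text \<open>The coefficient map is a parameter because three targets occur: the polynomial ring
  itself (restriction to a hyperplane), the field (evaluation at the origin) and univariate
  polynomials over the polynomial ring (first order expansion).\<close>

definition subst :: "('k \<Rightarrow> 'r) \<Rightarrow> ('n \<Rightarrow> 'r) \<Rightarrow> ('n::finite, 'k::comm_ring_1) mpol \<Rightarrow> 'r::comm_ring_1" where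
  "subst c s f = (\<Sum>e\<in>Poly_Mapping.keys f. c (Poly_Mapping.lookup f e) * (\<Prod>i\<in>UNIV. s i ^ Poly_Mapping.lookup e i))"

lemma subst_single:
  assumes "c 0 = 0"
  shows "subst c s (Poly_Mapping.single e a) = c a * (\<Prod>i\<in>UNIV. s i ^ Poly_Mapping.lookup e i)"
  using assms by (simp add: subst_def)

lemma subst_add:
  assumes "ring_hom_fun c"
  shows "subst c s (f + g) = subst c s f + subst c s g"
  unfolding subst_def
  by (rule setsum_keys_plus_distrib) (use assms in \<open>auto simp: ring_hom_fun_simps algebra_simps\<close>)

lemma subst_mult:
  assumes "ring_hom_fun c"
  shows "subst c s (f * g) = subst c s f * subst c s g"
proof (induction f rule: poly_mapping_add_induct)
  case (single k a)
  show ?case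
  proof (induction g rule: poly_mapping_add_induct)
    case (single l b)
    show ?case using assms
      by (simp add: mult_single subst_single ring_hom_fun_simps lookup_add power_add prod.distrib algebra_simps)
  next
    case (add f g)
    then show ?case using assms by (simp add: subst_add distrib_left)
  qed
next
  case (add f g)
  then show ?case using assms by (simp add: subst_add distrib_right)
qed

lemma subst_Const:
  assumes "ring_hom_fun c"
  shows "subst c s (Const a) = c a"
  using assms by (simp add: Const_def subst_single ring_hom_fun_simps)

lemma subst_Var:
  assumes "ring_hom_fun c"
  shows "subst c s (Var i) = s i"
proof -
  have "(\<Prod>j\<in>UNIV. s j ^ Poly_Mapping.lookup (Poly_Mapping.single i (1::nat)) j) = (\<Prod>j\<in>UNIV. if j = i then s j else 1)"
    by (rule prod.cong) (auto simp: lookup_single when_def)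
  then show ?thesis using assms by (simp add: Var_def subst_single ring_hom_fun_simps)
qed

lemma ring_hom_fun_subst:
  assumes "ring_hom_fun c"
  shows "ring_hom_fun (subst c s)"
  using assms subst_Const[OF assms, of s 1] by (simp add: ring_hom_fun_def subst_add subst_mult)

section \<open>Total degree and homogeneous components\<close>

definition total_deg :: "('n::finite \<Rightarrow>\<^sub>0 nat) \<Rightarrow> nat" where
  "total_deg e = (\<Sum>i\<in>UNIV. Poly_Mapping.lookup e i)"

lemma total_deg_add: "total_deg (a + b) = total_deg a + total_deg b"
  by (simp add: total_deg_def lookup_add sum.distrib)

lemma total_deg_0 [simp]: "total_deg 0 = 0"
  by (simp add: total_deg_def)

lemma total_deg_single [simp]: "total_deg (Poly_Mapping.single i m) = m"
  by (simp add: total_deg_def lookup_single when_def)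

lemma total_deg_eq_0: "total_deg e = 0 \<longleftrightarrow> e = 0"
  by (auto simp: total_deg_def intro: poly_mapping_eqI)

lemma total_deg_eq_1:
  assumes "total_deg e = 1"
  shows "\<exists>i. e = Poly_Mapping.single i 1"
proof -
  obtain i where i: "Poly_Mapping.lookup e i = 1" "\<And>j. j \<noteq> i \<Longrightarrow> Poly_Mapping.lookup e j = 0"
    using assms unfolding total_deg_def by (subst (asm) sum_eq_1_iff) auto
  then show ?thesis
    by (intro exI[of _ i] poly_mapping_eqI) (auto simp: lookup_single when_def)
qed

text \<open>Zero is homogeneous of every degree. Sums and differences thus need no case distinction,
  at the price of an alternative such as \<open>g = 0\<close> whenever a degree is read off.\<close>

definition homog :: "nat \<Rightarrow> ('n::finite, 'k::comm_ring_1) mpol \<Rightarrow> bool" where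
  "homog d f \<longleftrightarrow> (\<forall>e. Poly_Mapping.lookup f e \<noteq> 0 \<longrightarrow> total_deg e = d)"

definition hcomp :: "nat \<Rightarrow> ('n::finite, 'k::comm_ring_1) mpol \<Rightarrow> ('n, 'k) mpol" where
  "hcomp d f = (\<Sum>e\<in>{e\<in>Poly_Mapping.keys f. total_deg e = d}. Poly_Mapping.single e (Poly_Mapping.lookup f e))"

lemma lookup_hcomp:
  "Poly_Mapping.lookup (hcomp d f) e = (if total_deg e = d then Poly_Mapping.lookup f e else 0)"
  by (simp add: hcomp_def lookup_sum_single in_keys_iff)

lemma homog_hcomp [simp]: "homog d (hcomp d f)"
  by (simp add: homog_def lookup_hcomp)

lemma homog_0 [simp]: "homog d 0"
  by (simp add: homog_def)

lemma homog_add: "homog d f \<Longrightarrow> homog d g \<Longrightarrow> homog d (f + g)"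
  unfolding homog_def lookup_add by (metis add.right_neutral)

lemma homog_uminus: "homog d f \<Longrightarrow> homog d (- f)"
  by (simp add: homog_def)

lemma homog_diff: "homog d f \<Longrightarrow> homog d g \<Longrightarrow> homog d (f - g)"
  using homog_add[of d f "- g"] homog_uminus by auto

lemma homog_sum: "(\<And>i. i \<in> A \<Longrightarrow> homog d (f i)) \<Longrightarrow> homog d (\<Sum>i\<in>A. f i)"
  by (induction A rule: infinite_finite_induct) (auto intro: homog_add)

lemma homog_mult:
  assumes "homog a f" "homog b g"
  shows "homog (a + b) (f * g)"
  unfolding homog_def
proof (intro allI impI)
  fix e assume "Poly_Mapping.lookup (f * g) e \<noteq> 0"
  then have "e \<in> Poly_Mapping.keys (f * g)" by (simp add: in_keys_iff)
  then obtain x y where "e = x + y" "x \<in> Poly_Mapping.keys f" "y \<in> Poly_Mapping.keys g"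
    using keys_mult[of f g] by blast
  then show "total_deg e = a + b" using assms by (simp add: homog_def in_keys_iff total_deg_add)
qed

lemma homog_Const [simp]: "homog 0 (Const c)"
  by (simp add: homog_def Const_def lookup_single when_def)

lemma homog_1 [simp]: "homog 0 1"
  using homog_Const[of 1] by simp

lemma homog_Var [simp]: "homog 1 (Var i)"
  by (simp add: homog_def Var_def lookup_single when_def)

lemma homog_Const_mult: "homog d f \<Longrightarrow> homog d (Const c * f)"
  using homog_mult[of 0 "Const c" d f] by simp

lemma homog_prod: "(\<And>i. i \<in> A \<Longrightarrow> homog (d i) (f i)) \<Longrightarrow> homog (\<Sum>i\<in>A. d i) (\<Prod>i\<in>A. f i)"
  by (induction A rule: infinite_finite_induct) (auto intro: homog_mult)

lemma homog_power: "homog d f \<Longrightarrow> homog (m * d) (f ^ m)"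
  by (induction m) (auto intro: homog_mult)

lemma homog_unique: "homog a f \<Longrightarrow> homog b f \<Longrightarrow> f \<noteq> 0 \<Longrightarrow> a = b"
  unfolding homog_def by (metis poly_mapping_eqI lookup_zero)

lemma homog_0_Const: "homog 0 f \<Longrightarrow> f = Const (Poly_Mapping.lookup f 0)"
  by (rule poly_mapping_eqI) (auto simp: homog_def Const_def lookup_single when_def total_deg_eq_0)

lemma homog_1_sum_Var:
  fixes p :: "('n::finite, 'k::comm_ring_1) mpol"
  assumes "homog 1 p"
  shows "p = (\<Sum>i\<in>UNIV. Const (Poly_Mapping.lookup p (Poly_Mapping.single i 1)) * Var i)"
proof (rule poly_mapping_eqI)
  fix e
  have *: "Const c * Var i = (Poly_Mapping.single (Poly_Mapping.single i 1) c :: ('n,'k) mpol)" for c and i :: 'n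
    by (simp add: Const_def Var_def mult_single)
  show "Poly_Mapping.lookup p e = Poly_Mapping.lookup (\<Sum>i\<in>UNIV. Const (Poly_Mapping.lookup p (Poly_Mapping.single i 1)) * Var i) e"
  proof (cases "total_deg e = 1")
    case True
    then obtain j where j: "e = Poly_Mapping.single j 1" using total_deg_eq_1 by blast
    have "inj (\<lambda>i::'n. Poly_Mapping.single i (1::nat))"
      by (metis (mono_tags) injI lookup_single_eq lookup_single_not_eq one_neq_zero)
    then have "Poly_Mapping.single i (1::nat) = Poly_Mapping.single j 1 \<longleftrightarrow> i = j" for i
      by (rule inj_eq)
    then show ?thesis unfolding * j by (simp add: lookup_sum lookup_single when_def)
  next
    case False
    then have "Poly_Mapping.single i 1 \<noteq> e" for i using total_deg_single[of i 1] by auto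
    then show ?thesis unfolding * using False assms
      by (auto simp: lookup_sum lookup_single when_def homog_def)
  qed
qed

lemma hcomp_add: "hcomp d (f + g) = hcomp d f + hcomp d g"
  by (rule poly_mapping_eqI) (simp add: lookup_hcomp lookup_add)

lemma hcomp_0 [simp]: "hcomp d 0 = 0"
  by (rule poly_mapping_eqI) (simp add: lookup_hcomp)

lemma hcomp_sum: "hcomp d (\<Sum>i\<in>A. f i) = (\<Sum>i\<in>A. hcomp d (f i))"
  by (induction A rule: infinite_finite_induct) (auto simp: hcomp_add)

lemma hcomp_homog: "homog m f \<Longrightarrow> hcomp d f = (if d = m then f else 0)"
  by (rule poly_mapping_eqI) (auto simp: lookup_hcomp homog_def)

lemma sum_hcomp:
  assumes "\<And>e. Poly_Mapping.lookup f e \<noteq> 0 \<Longrightarrow> total_deg e \<le> m"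
  shows "(\<Sum>d\<le>m. hcomp d f) = f"
  by (rule poly_mapping_eqI) (use assms in \<open>auto simp: lookup_sum lookup_hcomp\<close>)

lemma ex_deg_bound: "\<exists>m. \<forall>e. Poly_Mapping.lookup f e \<noteq> 0 \<longrightarrow> total_deg e \<le> m"
proof -
  have "finite (total_deg ` Poly_Mapping.keys f)" by simp
  then obtain m where "\<forall>x\<in>total_deg ` Poly_Mapping.keys f. x \<le> m" using finite_nat_set_iff_bounded_le by blast
  then show ?thesis by (intro exI[of _ m]) (simp add: in_keys_iff)
qed

lemma ex_sum_hcomp: "\<exists>m. \<forall>k\<ge>m. (\<Sum>d\<le>k. hcomp d f) = f"
proof -
  obtain m where m: "\<And>e. Poly_Mapping.lookup f e \<noteq> 0 \<Longrightarrow> total_deg e \<le> m" using ex_deg_bound by blast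
  have "(\<Sum>d\<le>k. hcomp d f) = f" if "k \<ge> m" for k
    by (rule sum_hcomp) (use m that in force)
  then show ?thesis by blast
qed

lemma hcomp_mult:
  assumes "homog m f"
  shows "hcomp (m + d) (f * g) = f * hcomp d g"
proof -
  obtain k where k: "\<And>j. j \<ge> k \<Longrightarrow> (\<Sum>d\<le>j. hcomp d g) = g" using ex_sum_hcomp by blast
  let ?k = "max k d"
  have "hcomp (m + d) (f * (\<Sum>i\<le>?k. hcomp i g)) = (\<Sum>i\<le>?k. hcomp (m + d) (f * hcomp i g))"
    by (simp add: sum_distrib_left hcomp_sum)
  also have "\<dots> = (\<Sum>i\<le>?k. if i = d then f * hcomp d g else 0)"
    by (rule sum.cong) (auto simp: hcomp_homog[OF homog_mult[OF assms homog_hcomp]])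
  also have "\<dots> = f * hcomp d g" by simp
  finally show ?thesis using k[of ?k] by simp
qed

lemma hcomp_mult_less:
  assumes "homog m f" "d < m"
  shows "hcomp d (f * g) = 0"
proof -
  obtain k where k: "\<And>j. j \<ge> k \<Longrightarrow> (\<Sum>d\<le>j. hcomp d g) = g" using ex_sum_hcomp by blast
  have "hcomp d (f * (\<Sum>i\<le>k. hcomp i g)) = (\<Sum>i\<le>k. hcomp d (f * hcomp i g))"
    by (simp add: sum_distrib_left hcomp_sum)
  also have "\<dots> = 0"
    using assms(2) by (intro sum.neutral) (auto simp: hcomp_homog[OF homog_mult[OF assms(1) homog_hcomp]])
  finally show ?thesis using k[of k] by simp
qed

text \<open>Already the component of \<open>g\<close> in degree \<open>d - m\<close>, times
  \<open>f\<close>, equals \<open>f * g\<close>, and \<open>f\<close> cancels. The order on the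
  index type makes the polynomial ring an integral domain; the sort constraint recurs for this
  reason.\<close>

lemma homog_mult_cancel:
  fixes f g :: "('n::{finite,linorder}, 'k::field) mpol"
  assumes "homog m f" "f \<noteq> 0" "homog d (f * g)"
  shows "g = 0 \<or> m \<le> d \<and> homog (d - m) g"
proof (cases "g = 0")
  case False
  then have fg: "f * g \<noteq> 0" using assms(2) by simp
  have h: "hcomp d (f * g) = f * g" using assms(3) by (simp add: hcomp_homog)
  then have md: "m \<le> d" using hcomp_mult_less[OF assms(1), of d g] fg by (metis not_le)
  then have "f * hcomp (d - m) g = f * g" using hcomp_mult[OF assms(1), of "d - m" g] h by (metis le_add_diff_inverse)
  then have "hcomp (d - m) g = g" using assms(2) mult_left_cancel[of f "hcomp (d - m) g" g] by blast
  then show ?thesis using md homog_hcomp by metis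
qed simp

text \<open>This comparison of degrees drives the counting: a determinant or a value that is
  divisible by too many linear forms must vanish.\<close>

lemma homog_dvd_eq_0:
  fixes f g :: "('n::{finite,linorder}, 'k::field) mpol"
  assumes "homog m f" "homog d g" "f dvd g" "d < m"
  shows "g = 0"
proof -
  obtain h where "g = f * h" using assms(3) by (rule dvdE)
  then show ?thesis using homog_mult_cancel[of m f d h] assms by (cases "f = 0") auto
qed

lemma homog_dvdE:
  fixes f g :: "('n::{finite,linorder}, 'k::field) mpol"
  assumes "homog m f" "homog d g" "f dvd g" "m \<le> d"
  obtains h where "g = f * h" "homog (d - m) h"
proof (cases "g = 0")
  case True
  then show ?thesis using that[of 0] by simp
next
  case False
  obtain h where h: "g = f * h" using assms(3) by (rule dvdE)
  then show ?thesis using that[of h] homog_mult_cancel[OF assms(1), of d h] assms(2) False by auto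
qed

lemma homog_dvd_Const:
  fixes f g :: "('n::{finite,linorder}, 'k::field) mpol"
  assumes "homog m f" "homog m g" "f dvd g"
  obtains c where "g = Const c * f"
proof -
  obtain h where "g = f * h" "homog (m - m) h" using homog_dvdE[OF assms] by auto
  then show ?thesis using that homog_0_Const[of h] by (metis diff_self_eq_0 mult.commute)
qed

lemma not_homog_dvd_one:
  fixes f :: "('n::{finite,linorder}, 'k::field) mpol"
  shows "homog (Suc m) f \<Longrightarrow> \<not> f dvd 1"
  using homog_dvd_eq_0[of "Suc m" f 0 1] by auto

section \<open>Reduction modulo a linear form\<close>

lemma homog_subst:
  fixes s :: "'n::finite \<Rightarrow> ('m::finite, 'k::comm_ring_1) mpol"
  assumes "\<And>i. homog 1 (s i)" "homog d f"
  shows "homog d (subst Const s f)"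
  unfolding subst_def
proof (rule homog_sum)
  fix e assume "e \<in> Poly_Mapping.keys f"
  then have d: "total_deg e = d" using assms(2) by (simp add: homog_def in_keys_iff)
  have "homog (\<Sum>i\<in>UNIV. Poly_Mapping.lookup e i * 1) (\<Prod>i\<in>UNIV. s i ^ Poly_Mapping.lookup e i)"
    by (rule homog_prod, rule homog_power) (rule assms)
  then show "homog d (Const (Poly_Mapping.lookup f e) * (\<Prod>i\<in>UNIV. s i ^ Poly_Mapping.lookup e i))"
    using d by (intro homog_Const_mult) (simp add: total_deg_def)
qed

text \<open>The equation \<open>p = 0\<close> is solved for a variable occurring in \<open>p\<close>
  and the solution is substituted. So \<open>\<rho>\<close> is a retraction onto the polynomials in
  the other variables with kernel generated by \<open>p\<close>: the coordinate ring of the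
  hyperplane is realised inside the original ring, without a quotient type.\<close>

lemma ex_linear_reduction:
  fixes p :: "('n::{finite,linorder}, 'k::field) mpol"
  assumes p: "homog 1 p" "p \<noteq> 0"
  shows "\<exists>\<rho>. ring_hom_fun \<rho> \<and> (\<forall>c. \<rho> (Const c) = Const c) \<and> (\<forall>f. \<rho> f = 0 \<longleftrightarrow> p dvd f) \<and>
    (\<forall>f. p dvd f - \<rho> f) \<and> (\<forall>f. \<rho> (\<rho> f) = \<rho> f) \<and> (\<forall>d f. homog d f \<longrightarrow> homog d (\<rho> f))"
proof -
  define a where "a i = Poly_Mapping.lookup p (Poly_Mapping.single i 1)" for i
  have pe: "p = (\<Sum>i\<in>UNIV. Const (a i) * Var i)" using homog_1_sum_Var[OF p(1)] by (simp add: a_def)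
  obtain k where k: "a k \<noteq> 0" using p(2) pe by (metis (no_types, lifting) Const_0 mult_zero_left sum.neutral)
  define s where "s i = (if i = k then Var k - Const (1 / a k) * p else Var i)" for i
  define \<rho> where "\<rho> = subst Const s"
  have hom: "ring_hom_fun \<rho>" unfolding \<rho>_def by (rule ring_hom_fun_subst[OF ring_hom_fun_Const])
  have rc: "\<rho> (Const c) = Const c" for c by (simp add: \<rho>_def subst_Const[OF ring_hom_fun_Const])
  have rv: "\<rho> (Var i) = s i" for i by (simp add: \<rho>_def subst_Var[OF ring_hom_fun_Const])
  have "\<rho> p = (\<Sum>i\<in>UNIV. Const (a i) * s i)"
    by (subst pe) (simp add: ring_hom_fun_sum[OF hom] ring_hom_fun_simps[OF hom] rc rv)
  also have "\<dots> = (\<Sum>i\<in>UNIV. Const (a i) * Var i - (if i = k then Const (a k) * Const (1 / a k) * p else 0))"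
    by (rule sum.cong) (auto simp: s_def algebra_simps)
  also have "\<dots> = 0" using k by (simp add: sum_subtractf pe[symmetric] flip: Const_mult)
  finally have rp: "\<rho> p = 0" .
  have diff: "p dvd f - \<rho> f" for f
  proof (induction f rule: mpol_induct)
    case (Const c) show ?case by (simp add: rc)
  next
    case (Var i) show ?case by (simp add: rv s_def)
  next
    case (add f g)
    have "f + g - \<rho> (f + g) = (f - \<rho> f) + (g - \<rho> g)" by (simp add: ring_hom_fun_simps[OF hom])
    then show ?case using add by (metis dvd_add)
  next
    case (mult f g)
    have "f * g - \<rho> (f * g) = (f - \<rho> f) * g + \<rho> f * (g - \<rho> g)"
      by (simp add: ring_hom_fun_simps[OF hom] algebra_simps)
    then show ?case using mult by (metis dvd_add dvd_mult dvd_mult2)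
  qed
  have zero: "\<rho> f = 0" if "p dvd f" for f
    using ring_hom_fun_dvd[OF hom that] rp by simp
  have idem: "\<rho> (\<rho> f) = \<rho> f" for f
    using zero[OF diff[of f]] by (simp add: ring_hom_fun_simps[OF hom])
  have hg: "homog d (\<rho> f)" if "homog d f" for d f
    unfolding \<rho>_def by (rule homog_subst[OF _ that]) (auto simp: s_def intro!: homog_diff homog_Const_mult p simp del: One_nat_def)
  have iff: "\<rho> f = 0 \<longleftrightarrow> p dvd f" for f
  proof
    assume "\<rho> f = 0"
    then show "p dvd f" using diff[of f] by simp
  qed (rule zero)
  show ?thesis
    by (rule exI[of _ \<rho>]) (intro conjI allI impI hom rc iff diff idem hg)
qed

text \<open>The kernel of the reduction modulo \<open>p\<close> consists of the multiples of
  \<open>p\<close>, and the reduction takes values in an integral domain.\<close>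

lemma prime_elem_linear:
  fixes p :: "('n::{finite,linorder}, 'k::field) mpol"
  assumes p: "homog 1 p" "p \<noteq> 0"
  shows "prime_elem p"
proof -
  obtain \<rho> :: "('n, 'k) mpol \<Rightarrow> ('n, 'k) mpol"
    where "ring_hom_fun \<rho>" and "\<forall>f. \<rho> f = 0 \<longleftrightarrow> p dvd f"
    using ex_linear_reduction[OF p] by blast
  then have r: "ring_hom_fun \<rho>" "\<And>f. \<rho> f = 0 \<longleftrightarrow> p dvd f" by auto
  show ?thesis
  proof (rule prime_elemI)
    show "\<not> p dvd 1" using not_homog_dvd_one[of 0 p] p(1) by simp
    show "p dvd a \<or> p dvd b" if "p dvd a * b" for a b
      using that by (simp add: r(2)[symmetric] ring_hom_fun_simps[OF r(1)])
  qed (rule p)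
qed

text \<open>Multiplication by \<open>h\<close> is injective modulo \<open>g\<close>. This substitute
  for coprimality needs no gcd, passes to products, and for a prime \<open>g\<close> amounts to
  \<open>g\<close> not dividing \<open>h\<close>.\<close>

definition rel_prime :: "'a::comm_semiring_1 \<Rightarrow> 'a \<Rightarrow> bool" where
  "rel_prime g h \<longleftrightarrow> (\<forall>x. g dvd h * x \<longrightarrow> g dvd x)"

lemma rel_prime_mult_right: "rel_prime g h \<Longrightarrow> rel_prime g k \<Longrightarrow> rel_prime g (h * k)"
  unfolding rel_prime_def mult.assoc by blast

lemma rel_prime_one_right: "rel_prime g 1"
  by (simp add: rel_prime_def)

lemma rel_prime_prod_right: "(\<And>i. i \<in> A \<Longrightarrow> rel_prime g (f i)) \<Longrightarrow> rel_prime g (\<Prod>i\<in>A. f i)"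
  by (induction A rule: infinite_finite_induct) (auto intro: rel_prime_mult_right rel_prime_one_right)

lemma rel_prime_mult_left:
  fixes g h :: "'a::idom"
  assumes "rel_prime g k" "rel_prime h k" "g \<noteq> 0"
  shows "rel_prime (g * h) k"
  unfolding rel_prime_def
proof (intro allI impI)
  fix x assume x: "g * h dvd k * x"
  then have "g dvd x" using assms(1) dvd_mult_left unfolding rel_prime_def by blast
  then obtain y where y: "x = g * y" by (rule dvdE)
  then have "g * h dvd g * (k * y)" using x by (simp add: algebra_simps)
  then have "h dvd k * y" using assms(3) by simp
  then have "h dvd y" using assms(2) unfolding rel_prime_def by blast
  then show "g * h dvd x" unfolding y by (rule mult_dvd_mono[OF dvd_refl])
qed

lemma rel_prime_prod_left:
  fixes f :: "'b \<Rightarrow> 'a::idom"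
  assumes "\<And>i. i \<in> A \<Longrightarrow> rel_prime (f i) k" "\<And>i. i \<in> A \<Longrightarrow> f i \<noteq> 0"
  shows "rel_prime (\<Prod>i\<in>A. f i) k"
  using assms
proof (induction A rule: infinite_finite_induct)
  case (insert x F)
  have "rel_prime (f x * prod f F) k" by (rule rel_prime_mult_left) (use insert in auto)
  then show ?case by (simp only: prod.insert[OF insert.hyps])
qed (simp_all add: rel_prime_def)

lemma prod_dvd_of_rel_prime:
  assumes "finite A" "\<And>i. i \<in> A \<Longrightarrow> g i dvd f"
    "\<And>i j. i \<in> A \<Longrightarrow> j \<in> A \<Longrightarrow> i \<noteq> j \<Longrightarrow> rel_prime (g i) (g j)"
  shows "(\<Prod>i\<in>A. g i) dvd (f::'a::comm_semiring_1)"
  using assms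
proof (induction A rule: finite_induct)
  case (insert x F)
  then have "(\<Prod>i\<in>F. g i) dvd f" by simp
  then obtain y where y: "f = (\<Prod>i\<in>F. g i) * y" by (rule dvdE)
  have "rel_prime (g x) (\<Prod>i\<in>F. g i)" by (rule rel_prime_prod_right) (use insert in auto)
  moreover have "g x dvd f" using insert.prems(1) by simp
  ultimately have "g x dvd y" unfolding y rel_prime_def by blast
  then have "g x * (\<Prod>i\<in>F. g i) dvd y * (\<Prod>i\<in>F. g i)" by (rule mult_dvd_mono) simp
  then show ?case unfolding y prod.insert[OF insert.hyps] by (simp only: mult.commute)
qed simp

lemma rel_prime_prime_elem: "prime_elem p \<Longrightarrow> \<not> p dvd h \<Longrightarrow> rel_prime p h"
  by (simp add: rel_prime_def prime_elem_dvd_mult_iff)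

text \<open>The primes are removed one at a time: if \<open>p x * s = h * z\<close> and
  \<open>p x\<close> does not divide \<open>h\<close>, then it divides \<open>z\<close> and cancels
  on both sides.\<close>

lemma is_unit_of_dvd_prod_primes:
  fixes h :: "'a::idom"
  assumes "finite A" "\<And>i. i \<in> A \<Longrightarrow> prime_elem (p i)" "\<And>i. i \<in> A \<Longrightarrow> \<not> p i dvd h"
    "h dvd c * (\<Prod>i\<in>A. p i ^ m i)"
  shows "h dvd c"
  using assms
proof (induction A rule: finite_induct)
  case (insert x F)
  have *: "h dvd p x ^ n * r \<Longrightarrow> h dvd r" for n r
  proof (induction n)
    case (Suc n)
    then obtain z where z: "p x ^ Suc n * r = h * z" unfolding dvd_def by blast
    then have z: "p x * (p x ^ n * r) = h * z" by (simp add: mult.assoc)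
    then have "p x dvd h * z" by (metis dvd_triv_left)
    then have "p x dvd z" using insert.prems(1,2)[of x] by (simp add: prime_elem_dvd_mult_iff)
    then obtain w where "z = p x * w" by (rule dvdE)
    then have "p x * (p x ^ n * r) = p x * (h * w)" using z by (simp add: algebra_simps)
    moreover have "p x \<noteq> 0" using insert.prems(1)[of x] by auto
    ultimately have "p x ^ n * r = h * w" by simp
    then show ?case using Suc.IH by (metis dvd_triv_left)
  qed simp
  have "c * (\<Prod>i\<in>insert x F. p i ^ m i) = p x ^ m x * (c * (\<Prod>i\<in>F. p i ^ m i))"
    using insert.hyps by (simp add: mult.left_commute)
  then have "h dvd p x ^ m x * (c * (\<Prod>i\<in>F. p i ^ m i))" using insert.prems(3) by (simp only:)
  then have "h dvd c * (\<Prod>i\<in>F. p i ^ m i)" by (rule *)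
  then show ?case by (rule insert.IH[rotated 2]) (simp_all add: insert.prems(1,2))
qed simp

section \<open>Triples\<close>

text \<open>There are two uses. For coefficient vectors of linear forms a zero determinant means
  that the lines of the projective plane are concurrent; for vectors of polynomials it is Saito's
  determinant. Likewise, a nonzero \<open>cross\<close> of two coefficient vectors means that the
  lines are distinct.\<close>

fun det3 :: "'a \<times> 'a \<times> 'a \<Rightarrow> 'a \<times> 'a \<times> 'a \<Rightarrow> 'a \<times> 'a \<times> 'a \<Rightarrow> 'a::comm_ring_1" where
  "det3 (u1, u2, u3) (v1, v2, v3) (w1, w2, w3) =
     u1 * (v2 * w3 - v3 * w2) + u2 * (v3 * w1 - v1 * w3) + u3 * (v1 * w2 - v2 * w1)"

fun cross :: "'a \<times> 'a \<times> 'a \<Rightarrow> 'a \<times> 'a \<times> 'a \<Rightarrow> 'a::comm_ring_1 \<times> 'a \<times> 'a" where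
  "cross (u1, u2, u3) (v1, v2, v3) = (u2 * v3 - u3 * v2, u3 * v1 - u1 * v3, u1 * v2 - u2 * v1)"

fun smul :: "'a \<Rightarrow> 'a \<times> 'a \<times> 'a \<Rightarrow> 'a::comm_ring_1 \<times> 'a \<times> 'a" where
  "smul c (u1, u2, u3) = (c * u1, c * u2, c * u3)"

fun map3 :: "('a \<Rightarrow> 'b) \<Rightarrow> 'a \<times> 'a \<times> 'a \<Rightarrow> 'b \<times> 'b \<times> 'b" where
  "map3 h (u1, u2, u3) = (h u1, h u2, h u3)"

fun all3 :: "('a \<Rightarrow> bool) \<Rightarrow> 'a \<times> 'a \<times> 'a \<Rightarrow> bool" where
  "all3 P (u1, u2, u3) \<longleftrightarrow> P u1 \<and> P u2 \<and> P u3"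

fun dotC :: "'k \<times> 'k \<times> 'k \<Rightarrow> ('n, 'k) mpol \<times> ('n, 'k) mpol \<times> ('n, 'k) mpol \<Rightarrow> ('n, 'k::comm_ring_1) mpol" where
  "dotC (a1, a2, a3) (u1, u2, u3) = Const a1 * u1 + Const a2 * u2 + Const a3 * u3"

lemma dotC_add: "dotC a (u + v) = dotC a u + dotC a v"
  by (cases a; cases u; cases v) (simp add: algebra_simps)
lemma dotC_diff: "dotC a (u - v) = dotC a u - dotC a v"
  by (cases a; cases u; cases v) (simp add: algebra_simps)
lemma dotC_smul: "dotC a (smul f u) = f * dotC a u"
  by (cases a; cases u) (simp add: algebra_simps)
lemma dotC_0 [simp]: "dotC a 0 = 0"
  by (cases a) (simp add: zero_prod_def)
lemma dotC_zero_left [simp]: "dotC 0 u = 0"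
  by (cases u) (simp add: zero_prod_def)
lemma dotC_comb: "dotC (smul s a + smul t b) u = Const s * dotC a u + Const t * dotC b u"
  by (cases a; cases b; cases u) (simp add: algebra_simps Const_simps)
lemma dotC_diff_left: "dotC (a - b) u = dotC a u - dotC b u"
  by (cases a; cases b; cases u) (simp add: algebra_simps Const_simps)
lemma dotC_smul_left: "dotC (smul s a) u = Const s * dotC a u"
  by (cases a; cases u) (simp add: algebra_simps Const_simps)

lemma dotC_map3:
  assumes "ring_hom_fun h" "\<And>c. h (Const c) = Const c"
  shows "dotC a (map3 h u) = h (dotC a u)"
  using assms by (cases a; cases u) (simp add: ring_hom_fun_simps)

lemma det3_swap: "det3 u w v = - det3 u v w" "det3 v u w = - det3 u v w"
  by (cases u; cases v; cases w; simp add: algebra_simps)+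

lemma det3_repeat [simp]: "det3 u u w = 0" "det3 u w u = 0" "det3 w u u = 0"
  by (cases u; cases w; simp add: algebra_simps)+

lemma det3_add: "det3 u v (w + x) = det3 u v w + det3 u v x" "det3 u (v + x) w = det3 u v w + det3 u x w"
    "det3 (u + x) v w = det3 u v w + det3 x v w"
  by (cases u; cases v; cases w; cases x; simp add: algebra_simps)+

lemma det3_diff: "det3 u v (w - x) = det3 u v w - det3 u v x" "det3 u (v - x) w = det3 u v w - det3 u x w"
    "det3 (u - x) v w = det3 u v w - det3 x v w"
  by (cases u; cases v; cases w; cases x; simp add: algebra_simps)+

lemma det3_smul: "det3 u v (smul f w) = f * det3 u v w" "det3 u (smul f v) w = f * det3 u v w"
    "det3 (smul f u) v w = f * det3 u v w"
  by (cases u; cases v; cases w; simp add: algebra_simps)+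

lemma det3_zero [simp]: "det3 0 v w = 0" "det3 u 0 w = 0" "det3 u v 0 = 0"
  by (cases u; cases v; cases w; simp add: zero_prod_def)+

text \<open>Cramer's rule with the denominator cleared, valid over any commutative ring. Read as a
  linear relation among four vectors, it also serves for bases with four elements.\<close>

lemma det3_Cramer:
  "smul (det3 u v w) x = smul (det3 x v w) u + smul (det3 u x w) v + smul (det3 u v x) w"
  by (cases u; cases v; cases w; cases x) (simp add: algebra_simps)

text \<open>A transposed Cramer rule, one line per coordinate of \<open>a\<close>. Whatever divides
  the three values under \<open>dotC a\<close> divides the determinant, because a nonzero
  \<open>a\<close> has an invertible coordinate.\<close>

lemma dotC_det3:
  fixes u :: "('n::finite, 'k::comm_ring_1) mpol \<times> ('n, 'k) mpol \<times> ('n, 'k) mpol"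
  shows
  "dotC a u * fst (cross v w) + dotC a v * fst (cross w u) + dotC a w * fst (cross u v) = Const (fst a) * det3 u v w"
  "dotC a u * fst (snd (cross v w)) + dotC a v * fst (snd (cross w u)) + dotC a w * fst (snd (cross u v)) = Const (fst (snd a)) * det3 u v w"
  "dotC a u * snd (snd (cross v w)) + dotC a v * snd (snd (cross w u)) + dotC a w * snd (snd (cross u v)) = Const (snd (snd a)) * det3 u v w"
  by (cases a; cases u; cases v; cases w; simp add: algebra_simps)+

lemma smul_simps: "smul (f + g) u = smul f u + smul g u" "smul (f * g) u = smul f (smul g u)"
    "smul f (u + v) = smul f u + smul f v" "smul f (u - v) = smul f u - smul f v" "smul 1 u = u"
    "smul f 0 = 0" "smul 0 u = 0"
  by (cases u; cases v; simp add: algebra_simps zero_prod_def)+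

lemma smul_cancel: "smul f u = smul f v \<Longrightarrow> f \<noteq> (0::'a::idom) \<Longrightarrow> u = v"
  by (cases u; cases v) auto

lemma dvd_smulE:
  assumes "all3 (\<lambda>x. f dvd x) u"
  obtains v where "u = smul f v"
proof (cases u)
  case (fields a b c)
  then obtain a' b' c' where "a = f * a'" "b = f * b'" "c = f * c'"
    using assms by (auto elim!: dvdE)
  then show ?thesis using fields that[of "(a', b', c')"] by simp
qed

lemma all3_mono: "all3 P u \<Longrightarrow> (\<And>x. P x \<Longrightarrow> Q x) \<Longrightarrow> all3 Q u"
  by (cases u) auto

text \<open>By the Binet-Cauchy identity the difference of the two sides is the inner product of
  \<open>cross b c\<close> with \<open>cross p q\<close>.\<close>

lemma cross_eq_0_dvd: "cross p q = 0 \<Longrightarrow> dotC b p * dotC c q = dotC c p * dotC b q"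
proof (cases p; cases q; cases b; cases c)
  fix p1 p2 p3 q1 q2 q3 b1 b2 b3 c1 c2 c3
  assume "cross p q = 0" and e: "p = (p1, p2, p3)" "q = (q1, q2, q3)" "b = (b1, b2, b3)" "c = (c1, c2, c3)"
  then have z: "p2 * q3 - p3 * q2 = 0" "p3 * q1 - p1 * q3 = 0" "p1 * q2 - p2 * q1 = 0" by (simp_all add: zero_prod_def)
  have "dotC b p * dotC c q - dotC c p * dotC b q =
      (Const b2 * Const c3 - Const b3 * Const c2) * (p2 * q3 - p3 * q2)
    + (Const b3 * Const c1 - Const b1 * Const c3) * (p3 * q1 - p1 * q3)
    + (Const b1 * Const c2 - Const b2 * Const c1) * (p1 * q2 - p2 * q1)"
    unfolding e by (simp add: algebra_simps)
  then show ?thesis unfolding z by simp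
qed

lemma triple_span:
  fixes a b r :: "'k::field \<times> 'k \<times> 'k"
  assumes "cross a b \<noteq> 0" "det3 a b r = 0"
  obtains x y where "r = smul x a + smul y b"
proof -
  obtain a1 a2 a3 b1 b2 b3 r1 r2 r3 where e: "a = (a1, a2, a3)" "b = (b1, b2, b3)" "r = (r1, r2, r3)"
    by (metis prod_cases3)
  have d: "a1 * (b2 * r3 - b3 * r2) + a2 * (b3 * r1 - b1 * r3) + a3 * (b1 * r2 - b2 * r1) = 0"
    using assms(2) unfolding e det3.simps .
  define p1 p2 p3 where p: "p1 = a2 * b3 - a3 * b2" "p2 = a3 * b1 - a1 * b3" "p3 = a1 * b2 - a2 * b1"
  have "p1 \<noteq> 0 \<or> p2 \<noteq> 0 \<or> p3 \<noteq> 0" using assms(1) by (auto simp: e p zero_prod_def)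
  moreover have "\<exists>x y. r = smul x a + smul y b" if "s \<noteq> 0"
    "s * r1 = x * a1 + y * b1" "s * r2 = x * a2 + y * b2" "s * r3 = x * a3 + y * b3" for s x y
    using that by (intro exI[of _ "x / s"] exI[of _ "y / s"]) (simp add: e field_simps)
  \<comment> \<open>The coefficients are matching coordinates of \<open>cross r b\<close> and
    \<open>cross a r\<close>; the vanishing determinant makes the same two coefficients work in all
    three rows.\<close>
  moreover have "p3 * r1 = (r1 * b2 - r2 * b1) * a1 + (a1 * r2 - a2 * r1) * b1"
    "p3 * r2 = (r1 * b2 - r2 * b1) * a2 + (a1 * r2 - a2 * r1) * b2"
    "p3 * r3 = (r1 * b2 - r2 * b1) * a3 + (a1 * r2 - a2 * r1) * b3"
    "p1 * r1 = (r2 * b3 - r3 * b2) * a1 + (a2 * r3 - a3 * r2) * b1"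
    "p1 * r2 = (r2 * b3 - r3 * b2) * a2 + (a2 * r3 - a3 * r2) * b2"
    "p1 * r3 = (r2 * b3 - r3 * b2) * a3 + (a2 * r3 - a3 * r2) * b3"
    "p2 * r1 = (r3 * b1 - r1 * b3) * a1 + (a3 * r1 - a1 * r3) * b1"
    "p2 * r2 = (r3 * b1 - r1 * b3) * a2 + (a3 * r1 - a1 * r3) * b2"
    "p2 * r3 = (r3 * b1 - r1 * b3) * a3 + (a3 * r1 - a1 * r3) * b3"
    using d unfolding p by (algebra | simp add: algebra_simps)+
  ultimately show ?thesis using that by metis
qed

lemma cross_eq_0_sym: "cross a b = 0 \<longleftrightarrow> cross b a = 0"
  by (cases a; cases b) (auto simp: zero_prod_def algebra_simps)

lemma ex_det3_neq_0:
  fixes a :: "'k::field \<times> 'k \<times> 'k"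
  assumes "a \<noteq> 0"
  shows "\<exists>b c. det3 a b c \<noteq> 0"
proof (cases a)
  case (fields a1 a2 a3)
  have "det3 a (0,1,0) (0,0,1) = a1" "det3 a (0,0,1) (1,0,0) = a2" "det3 a (1,0,0) (0,1,0) = a3"
    by (simp_all add: fields)
  moreover have "a1 \<noteq> 0 \<or> a2 \<noteq> 0 \<or> a3 \<noteq> 0" using assms by (auto simp: fields zero_prod_def)
  ultimately show ?thesis by metis
qed

lemma det3_neq_0_cross: "det3 a b c \<noteq> 0 \<Longrightarrow> cross a b \<noteq> 0" "det3 a b c \<noteq> 0 \<Longrightarrow> cross a c \<noteq> 0"
proof -
  show 1: "cross a b \<noteq> 0" if "det3 a b c \<noteq> 0" for b c
  proof
    assume "cross a b = 0"
    moreover have "det3 a b c = fst c * fst (cross a b) + fst (snd c) * fst (snd (cross a b)) + snd (snd c) * snd (snd (cross a b))"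
      by (cases a; cases b; cases c) (simp add: algebra_simps)
    ultimately show False using that by simp
  qed
  show "det3 a b c \<noteq> 0 \<Longrightarrow> cross a c \<noteq> 0" using 1[of c b] det3_swap(1)[of a c b] by simp
qed

lemma dotC_det3_zero:
  fixes u :: "('n::{finite,linorder}, 'k::field) mpol \<times> ('n, 'k) mpol \<times> ('n, 'k) mpol"
  assumes "det3 a b c \<noteq> 0" "dotC a u = 0" "dotC b u = 0" "dotC c u = 0"
  shows "u = 0"
proof -
  obtain a1 a2 a3 b1 b2 b3 c1 c2 c3 u1 u2 u3
    where e: "a = (a1, a2, a3)" "b = (b1, b2, b3)" "c = (c1, c2, c3)" "u = (u1, u2, u3)"
    by (metis prod_cases3)
  have "Const (det3 a b c) \<noteq> (0 :: ('n,'k) mpol)" using assms(1) by simp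
  moreover have "Const (det3 a b c) * u1 = 0" "Const (det3 a b c) * u2 = 0" "Const (det3 a b c) * u3 = 0"
    using assms(2-4) unfolding e dotC.simps det3.simps Const_simps by algebra+
  ultimately show ?thesis by (simp add: e zero_prod_def)
qed

abbreviation homog3 where "homog3 d \<equiv> all3 (homog d)"

lemma homog_dotC: "homog3 d u \<Longrightarrow> homog d (dotC a u)"
  by (cases a; cases u) (auto intro!: homog_add homog_Const_mult)

lemma homog3_smul: "homog d f \<Longrightarrow> homog3 e u \<Longrightarrow> homog3 (d + e) (smul f u)"
  by (cases u) (auto intro!: homog_mult)

lemma homog3_diff: "homog3 d u \<Longrightarrow> homog3 d v \<Longrightarrow> homog3 d (u - v)"
  by (cases u; cases v) (auto intro!: homog_diff)

lemma homog3_0 [simp]: "homog3 d 0"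
  by (simp add: zero_prod_def)

lemma homog3_cross: "homog3 d u \<Longrightarrow> homog3 e v \<Longrightarrow> homog3 (d + e) (cross u v)"
  by (cases u; cases v) (auto intro!: homog_diff homog_mult)

lemma homog_det3:
  assumes "homog3 d u" "homog3 e v" "homog3 f w"
  shows "homog (d + e + f) (det3 u v w)"
proof -
  obtain u1 u2 u3 v1 v2 v3 w1 w2 w3 where e: "u = (u1, u2, u3)" "v = (v1, v2, v3)" "w = (w1, w2, w3)"
    by (metis prod_cases3)
  show ?thesis using assms unfolding e det3.simps add.assoc
    by (auto intro!: homog_add homog_mult homog_diff)
qed

lemma homog3_smul_cancel:
  fixes f :: "('n::{finite,linorder}, 'k::field) mpol"
  assumes "homog m f" "f \<noteq> 0" "homog3 d (smul f u)"
  shows "u = 0 \<or> m \<le> d \<and> homog3 (d - m) u"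
  using assms homog_mult_cancel[OF assms(1,2)]
  by (cases u) (fastforce simp: zero_prod_def)

section \<open>Logarithmic vectors\<close>

text \<open>Three independent linear forms \<open>y\<close> turn a vector \<open>a\<close> over the field into the linear form
  \<open>dotC a y\<close>. Derivations are recorded by their values on \<open>y\<close>.\<close>

locale linear_coordinates =
  fixes y :: "('n::{finite,linorder}, 'k::field) mpol \<times> ('n, 'k) mpol \<times> ('n, 'k) mpol"
  assumes homog_y: "homog3 1 y" and dotC_y_eq_0: "dotC a y = 0 \<Longrightarrow> a = 0"
begin

abbreviation form where "form a \<equiv> dotC a y"

definition logs :: "('k \<times> 'k \<times> 'k) set \<Rightarrow> (('n, 'k) mpol \<times> ('n, 'k) mpol \<times> ('n, 'k) mpol) set" where
  "logs L = {v. \<forall>a\<in>L. form a dvd dotC a v}"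

text \<open>Each hyperplane is represented by exactly one normal vector, so that
  \<open>card L\<close> counts hyperplanes and \<open>forms L\<close> is their squarefree defining
  polynomial.\<close>

definition arr :: "('k \<times> 'k \<times> 'k) set \<Rightarrow> bool" where
  "arr L \<longleftrightarrow> finite L \<and> 0 \<notin> L \<and> (\<forall>a\<in>L. \<forall>b\<in>L. a \<noteq> b \<longrightarrow> cross a b \<noteq> 0)"

abbreviation forms :: "('k \<times> 'k \<times> 'k) set \<Rightarrow> ('n, 'k) mpol" where
  "forms L \<equiv> \<Prod>a\<in>L. form a"

text \<open>Saito's criterion serves as the definition: \<open>y\<close>, \<open>u\<close>, \<open>v\<close> form a homogeneous basis of \<open>logs L\<close>,
  with exponents \<open>1\<close>, \<open>d1\<close>, \<open>d2\<close>.\<close>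

definition exps_witness where
  "exps_witness L d1 d2 u v \<longleftrightarrow> u \<in> logs L \<and> v \<in> logs L \<and> homog3 d1 u \<and> homog3 d2 v \<and>
     (\<exists>c. c \<noteq> 0 \<and> det3 y u v = Const c * forms L)"

definition exps :: "('k \<times> 'k \<times> 'k) set \<Rightarrow> nat \<Rightarrow> nat \<Rightarrow> bool" where
  "exps L d1 d2 \<longleftrightarrow> (\<exists>u v. exps_witness L d1 d2 u v)"

lemma homog_form: "homog 1 (form a)"
  by (rule homog_dotC[OF homog_y])

lemma form_neq_0: "a \<noteq> 0 \<Longrightarrow> form a \<noteq> 0"
  using dotC_y_eq_0 by blast

lemma prime_form: "a \<noteq> 0 \<Longrightarrow> prime_elem (form a)"
  using prime_elem_linear[OF homog_form form_neq_0] by blast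

lemma form_dvd_form:
  assumes "form a dvd form b"
  obtains c where "b = smul c a"
proof -
  obtain c where "form b = Const c * form a"
    using homog_dvd_Const[OF homog_form homog_form assms] by blast
  then have "form (b - smul c a) = 0" by (simp add: dotC_diff_left dotC_smul_left)
  then show ?thesis using that dotC_y_eq_0 by (metis eq_iff_diff_eq_0)
qed

lemma cross_smul: "cross a (smul c a) = 0" "cross (smul c a) a = 0"
  by (cases a; simp add: zero_prod_def algebra_simps)+

lemma rel_prime_forms:
  assumes "cross a b \<noteq> 0"
  shows "rel_prime (form a) (form b)"
proof -
  have "a \<noteq> 0" using assms by (cases b) (auto simp: zero_prod_def)
  moreover have "\<not> form a dvd form b" using assms cross_smul form_dvd_form by metis
  ultimately show ?thesis using prime_form rel_prime_prime_elem by blast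
qed

lemma arr_subset: "arr L \<Longrightarrow> L' \<subseteq> L \<Longrightarrow> arr L'"
  unfolding arr_def by (meson finite_subset subset_iff)

lemma logs_mono: "L' \<subseteq> L \<Longrightarrow> logs L \<subseteq> logs L'"
  unfolding logs_def by blast

lemma homog_forms: "finite L \<Longrightarrow> homog (card L) (forms L)"
  using homog_prod[of L "\<lambda>_. 1" form] homog_form by simp

lemma forms_neq_0: "arr L \<Longrightarrow> forms L \<noteq> 0"
  unfolding arr_def using form_neq_0 by (simp add: prod_zero_iff) metis

text \<open>\<open>y\<close> holds the values of the Euler derivation, which maps every linear form
  in these coordinates to itself; this is the source of the exponent 1.\<close>

lemma y_in_logs: "y \<in> logs L"
  by (simp add: logs_def)

lemma logs_diff: "u \<in> logs L \<Longrightarrow> v \<in> logs L \<Longrightarrow> u - v \<in> logs L"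
  by (simp add: logs_def dotC_diff)

lemma logs_smul: "u \<in> logs L \<Longrightarrow> smul f u \<in> logs L"
  by (simp add: logs_def dotC_smul)

lemma logs_insert: "v \<in> logs (insert a L) \<longleftrightarrow> v \<in> logs L \<and> form a dvd dotC a v"
  by (auto simp: logs_def)

lemma form_dvd_det3:
  assumes "a \<noteq> 0" "u \<in> logs {a}" "v \<in> logs {a}" "w \<in> logs {a}"
  shows "form a dvd det3 u v w"
proof -
  have d: "form a dvd dotC a u" "form a dvd dotC a v" "form a dvd dotC a w"
    using assms by (simp_all add: logs_def)
  have "fst a \<noteq> 0 \<or> fst (snd a) \<noteq> 0 \<or> snd (snd a) \<noteq> 0"
    using assms(1) by (cases a) (auto simp: zero_prod_def)
  moreover have "form a dvd Const (fst a) * det3 u v w" "form a dvd Const (fst (snd a)) * det3 u v w"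
      "form a dvd Const (snd (snd a)) * det3 u v w"
    unfolding dotC_det3[symmetric] by (intro dvd_add dvd_mult2 d)+
  ultimately show ?thesis using dvd_Const_mult_cancel by blast
qed

text \<open>Each form divides the determinant and distinct forms are coprime. This half of Saito's
  criterion applies to all logarithmic vectors, generating or not.\<close>

lemma forms_dvd_det3:
  assumes "arr L" "u \<in> logs L" "v \<in> logs L" "w \<in> logs L"
  shows "forms L dvd det3 u v w"
proof (rule prod_dvd_of_rel_prime)
  show "finite L" using assms(1) by (simp add: arr_def)
  fix a assume a: "a \<in> L"
  show "form a dvd det3 u v w"
    using assms(1) a logs_mono[of "{a}" L] by (intro form_dvd_det3) (use assms in \<open>auto simp: arr_def\<close>)
  fix b assume "b \<in> L" "a \<noteq> b"
  then show "rel_prime (form a) (form b)" using assms(1) a by (intro rel_prime_forms) (simp add: arr_def)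
qed

lemma exps_sum:
  assumes "arr L" "exps L d1 d2"
  shows "d1 + d2 + 1 = card L"
proof -
  obtain u v c where uv: "homog3 d1 u" "homog3 d2 v" "c \<noteq> 0" "det3 y u v = Const c * forms L"
    using assms(2) unfolding exps_def exps_witness_def by blast
  have "homog (1 + d1 + d2) (det3 y u v)" by (rule homog_det3[OF homog_y uv(1,2)])
  moreover have "homog (card L) (det3 y u v)"
    unfolding uv(4) using assms(1) by (intro homog_Const_mult homog_forms) (simp add: arr_def)
  moreover have "det3 y u v \<noteq> 0" using uv forms_neq_0[OF assms(1)] by simp
  ultimately show ?thesis using homog_unique by fastforce
qed

lemma exps_witness_swap: "exps_witness L d1 d2 u v \<Longrightarrow> exps_witness L d2 d1 v u"
  unfolding exps_witness_def using det3_swap(1)[of y v u] Const_uminus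
  by (metis minus_mult_left neg_equal_0_iff_equal)

lemma exps_swap: "exps L d1 d2 \<Longrightarrow> exps L d2 d1"
  unfolding exps_def using exps_witness_swap by blast

text \<open>If \<open>s\<close> were below both exponents, the determinants of \<open>y\<close>,
  \<open>w\<close> and either basis vector would have degree less than \<open>card L\<close>. As
  multiples of \<open>forms L\<close> they would vanish, and \<open>w\<close> would be proportional
  to \<open>y\<close>.\<close>

lemma exps_le:
  assumes L: "arr L" and e: "exps L d1 d2" and w: "w \<in> logs L" "homog3 s w" "cross y w \<noteq> 0"
  shows "d1 \<le> s \<or> d2 \<le> s"
proof (rule ccontr)
  assume "\<not> ?thesis"
  then have lt: "s < d1" "s < d2" by auto
  obtain u v c where uv: "u \<in> logs L" "v \<in> logs L" "homog3 d1 u" "homog3 d2 v" "c \<noteq> 0"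
      "det3 y u v = Const c * forms L"
    using e unfolding exps_def exps_witness_def by blast
  have hL: "homog (card L) (forms L)" using L homog_forms by (simp add: arr_def)
  have card: "d1 + d2 + 1 = card L" by (rule exps_sum[OF L e])
  have z: "det3 y w u = 0" "det3 y w v = 0"
    using homog_dvd_eq_0[OF hL homog_det3[OF homog_y w(2) uv(3)] forms_dvd_det3[OF L y_in_logs w(1) uv(1)]]
      homog_dvd_eq_0[OF hL homog_det3[OF homog_y w(2) uv(4)] forms_dvd_det3[OF L y_in_logs w(1) uv(2)]]
      card lt by auto
  have "smul (det3 y u v) (cross y w) = 0"
  proof -
    have "smul (det3 y u v) (cross y w) = smul (det3 y w u) (cross v y) + smul (det3 y w v) (cross y u)"
      by (cases y; cases u; cases v; cases w) (simp add: algebra_simps)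
    then show ?thesis using z by (simp add: smul_simps)
  qed
  then have "det3 y u v = 0" using w(3) by (cases "cross y w") (auto simp: zero_prod_def)
  then show False using uv forms_neq_0[OF L] by simp
qed

text \<open>By \<open>exps_le\<close> each exponent of one pair is at least some exponent of the
  other, in both directions, and the two pairs have the same sum.\<close>

lemma exps_unique:
  assumes L: "arr L" and "exps L d1 d2" "exps L e1 e2"
  shows "(d1 = e1 \<and> d2 = e2) \<or> (d1 = e2 \<and> d2 = e1)"
proof -
  have *: "(e1 \<le> d1 \<or> e2 \<le> d1) \<and> (e1 \<le> d2 \<or> e2 \<le> d2)" if de: "exps L d1 d2" "exps L e1 e2" for d1 d2 e1 e2
  proof -
    obtain u v c where uv: "u \<in> logs L" "v \<in> logs L" "homog3 d1 u" "homog3 d2 v" "c \<noteq> 0"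
      "det3 y u v = Const c * forms L"
      using de(1) unfolding exps_def exps_witness_def by blast
    have nz: "det3 y u v \<noteq> 0" using uv forms_neq_0[OF L] by simp
    show ?thesis
      using exps_le[OF L de(2) uv(1,3) det3_neq_0_cross(1)[OF nz]]
        exps_le[OF L de(2) uv(2,4) det3_neq_0_cross(2)[OF nz]] by blast
  qed
  show ?thesis using *[OF assms(2,3)] *[OF assms(3,2)] exps_sum[OF L assms(2)] exps_sum[OF L assms(3)] by auto
qed

text \<open>The other half of Saito's criterion: the Cramer coefficients of \<open>w\<close> are
  determinants of logarithmic vectors, so \<open>forms L\<close> divides all of them and
  cancels.\<close>

lemma exps_generate:
  assumes L: "arr L" and e: "exps_witness L d1 d2 u v" and w: "w \<in> logs L"
  obtains f g h where "w = smul f y + smul g u + smul h v"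
proof -
  obtain c where uv: "u \<in> logs L" "v \<in> logs L" "c \<noteq> 0" "det3 y u v = Const c * forms L"
    using e unfolding exps_witness_def by blast
  obtain f g h where fgh: "det3 w u v = forms L * f" "det3 y w v = forms L * g" "det3 y u w = forms L * h"
    using forms_dvd_det3[OF L w uv(1,2)] forms_dvd_det3[OF L y_in_logs w uv(2)]
      forms_dvd_det3[OF L y_in_logs uv(1) w] by (auto elim!: dvdE)
  have "smul (forms L) (smul (Const c) w) = smul (forms L) (smul f y + smul g u + smul h v)"
    using det3_Cramer[of y u v w] unfolding fgh uv(4) by (simp add: smul_simps mult.commute flip: smul_simps(2))
  then have "smul (Const c) w = smul f y + smul g u + smul h v"
    using smul_cancel forms_neq_0[OF L] by blast
  then have "smul (Const (1/c)) (smul (Const c) w) = smul (Const (1/c)) (smul f y + smul g u + smul h v)" by simp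
  moreover have "smul (Const (1/c)) (smul (Const c) w) = w"
    using uv(3) by (cases w) (simp add: mult.assoc[symmetric] flip: Const_mult)
  ultimately have "w = smul (Const (1/c) * f) y + smul (Const (1/c) * g) u + smul (Const (1/c) * h) v"
    by (simp add: smul_simps)
  then show ?thesis by (rule that)
qed

end

section \<open>Restriction to a line of the arrangement\<close>

lemma smul_left_cancel: "smul f u = smul g u \<Longrightarrow> u \<noteq> 0 \<Longrightarrow> f = (g::'a::idom)"
  by (cases u) (auto simp: zero_prod_def)

text \<open>Both vectors are orthogonal to \<open>a\<close>, so their cross product points along
  \<open>a\<close>. As \<open>a\<close> is constant, dividing by a nonzero coordinate of it stays
  polynomial.\<close>

lemma cross_parallel:
  fixes p q :: "('n::{finite,linorder}, 'k::field) mpol \<times> ('n, 'k) mpol \<times> ('n, 'k) mpol"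
  assumes "a \<noteq> 0" "dotC a p = 0" "dotC a q = 0"
  shows "\<exists>m. cross p q = smul m (map3 Const a)"
proof -
  obtain a1 a2 a3 p1 p2 p3 q1 q2 q3
    where e: "a = (a1, a2, a3)" "p = (p1, p2, p3)" "q = (q1, q2, q3)"
    by (metis prod_cases3)
  define x1 x2 x3 where x: "x1 = p2 * q3 - p3 * q2" "x2 = p3 * q1 - p1 * q3" "x3 = p1 * q2 - p2 * q1"
  have p: "Const a1 * p1 + Const a2 * p2 + Const a3 * p3 = 0" and q: "Const a1 * q1 + Const a2 * q2 + Const a3 * q3 = 0"
    using assms(2,3) by (simp_all add: e)
  have "Const a1 * x2 - Const a2 * x1 = p3 * (Const a1 * q1 + Const a2 * q2 + Const a3 * q3) - q3 * (Const a1 * p1 + Const a2 * p2 + Const a3 * p3)"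
    "Const a2 * x3 - Const a3 * x2 = p1 * (Const a1 * q1 + Const a2 * q2 + Const a3 * q3) - q1 * (Const a1 * p1 + Const a2 * p2 + Const a3 * p3)"
    "Const a3 * x1 - Const a1 * x3 = p2 * (Const a1 * q1 + Const a2 * q2 + Const a3 * q3) - q2 * (Const a1 * p1 + Const a2 * p2 + Const a3 * p3)"
    unfolding x by (simp_all add: algebra_simps)
  then have eq: "Const a1 * x2 = Const a2 * x1" "Const a2 * x3 = Const a3 * x2" "Const a3 * x1 = Const a1 * x3"
    unfolding p q by simp_all
  have inv: "Const (1 / c) * Const c = (1 :: ('n, 'k) mpol)" if "c \<noteq> 0" for c
    using that by (simp flip: Const_mult)
  have quot: "v = i * u * B" if "i * A = 1" "A * v = B * u" for i A B u v :: "('n, 'k) mpol"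
  proof -
    have "i * A * v = i * u * B" using that(2) by (simp add: mult_ac)
    then show ?thesis using that(1) by simp
  qed
  have xe: "cross p q = (x1, x2, x3)" by (simp add: e x)
  consider "a1 \<noteq> 0" | "a2 \<noteq> 0" | "a3 \<noteq> 0" using assms(1) by (auto simp: e zero_prod_def)
  then show ?thesis
  proof cases
    case 1
    have "x1 = Const (1/a1) * x1 * Const a1" "x2 = Const (1/a1) * x1 * Const a2" "x3 = Const (1/a1) * x1 * Const a3"
      using quot[OF inv[OF 1]] eq by auto
    then show ?thesis unfolding xe unfolding e map3.simps smul.simps prod.inject by blast
  next
    case 2
    have "x1 = Const (1/a2) * x2 * Const a1" "x2 = Const (1/a2) * x2 * Const a2" "x3 = Const (1/a2) * x2 * Const a3"
      using quot[OF inv[OF 2]] eq by auto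
    then show ?thesis unfolding xe unfolding e map3.simps smul.simps prod.inject by blast
  next
    case 3
    have "x1 = Const (1/a3) * x3 * Const a1" "x2 = Const (1/a3) * x3 * Const a2" "x3 = Const (1/a3) * x3 * Const a3"
      using quot[OF inv[OF 3]] eq by auto
    then show ?thesis unfolding xe unfolding e map3.simps smul.simps prod.inject by blast
  qed
qed

text \<open>The line \<open>a\<close> is added to \<open>L\<close>; the map \<open>\<rho>\<close> restricts polynomials to it, and \<open>R\<close> contains
  one line of \<open>L\<close> through each intersection point on it.\<close>

locale restriction = linear_coordinates +
  fixes a :: "'b \<times> 'b \<times> 'b" and L R :: "('b \<times> 'b \<times> 'b) set" and \<rho> :: "('a, 'b) mpol \<Rightarrow> ('a, 'b) mpol"
  assumes a_notin: "a \<notin> L" and arr_insert: "arr (insert a L)"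
    and R_subset: "R \<subseteq> L" and R_cover: "b \<in> L \<Longrightarrow> \<exists>r\<in>R. det3 a b r = 0"
    and R_sep: "r \<in> R \<Longrightarrow> s \<in> R \<Longrightarrow> r \<noteq> s \<Longrightarrow> det3 a r s \<noteq> 0"
    and rho_hom: "ring_hom_fun \<rho>" and rho_Const: "\<rho> (Const c) = Const c"
    and rho_eq_0: "\<rho> f = 0 \<longleftrightarrow> form a dvd f" and rho_idem: "\<rho> (\<rho> f) = \<rho> f"
    and rho_homog: "homog d f \<Longrightarrow> homog d (\<rho> f)"
begin

lemma arr_L: "arr L"
  using arr_subset[OF arr_insert] by blast

lemma finite_L: "finite L"
  using arr_L by (simp add: arr_def)

lemma finite_R: "finite R"
  using R_subset finite_L by (rule finite_subset)

lemma a_neq_0: "a \<noteq> 0"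
  using arr_insert by (auto simp: arr_def)

lemma cross_a: "b \<in> L \<Longrightarrow> cross a b \<noteq> 0"
  using arr_insert a_notin by (auto simp: arr_def)

lemma rho_simps: "\<rho> (f + g) = \<rho> f + \<rho> g" "\<rho> (f - g) = \<rho> f - \<rho> g" "\<rho> (f * g) = \<rho> f * \<rho> g" "\<rho> 0 = 0"
  using ring_hom_fun_simps[OF rho_hom] by auto

lemma rho_prod: "\<rho> (\<Prod>i\<in>A. f i) = (\<Prod>i\<in>A. \<rho> (f i))"
  by (rule ring_hom_fun_prod[OF rho_hom])

lemma dotC_rho: "dotC b (map3 \<rho> u) = \<rho> (dotC b u)"
  by (rule dotC_map3[OF rho_hom rho_Const])

lemma rho_form_a: "\<rho> (form a) = 0"
  by (simp add: rho_eq_0)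

lemma rho_form_neq_0: "cross a b \<noteq> 0 \<Longrightarrow> \<rho> (form b) \<noteq> 0"
  using rho_eq_0 form_dvd_form cross_smul(1) by metis

lemma homog_rho_form: "homog 1 (\<rho> (form b))"
  by (rule rho_homog[OF homog_form])

lemma rel_prime_rho_form:
  assumes "det3 a b c \<noteq> 0"
  shows "rel_prime (\<rho> (form b)) (\<rho> (form c))"
proof (rule rel_prime_prime_elem)
  have nz: "\<rho> (form b) \<noteq> 0" using rho_form_neq_0 det3_neq_0_cross(1)[OF assms] by blast
  then show "prime_elem (\<rho> (form b))" by (rule prime_elem_linear[OF homog_rho_form])
  show "\<not> \<rho> (form b) dvd \<rho> (form c)"
  proof
    assume "\<rho> (form b) dvd \<rho> (form c)"
    then obtain k where "\<rho> (form c) = Const k * \<rho> (form b)"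
      using homog_dvd_Const[OF homog_rho_form homog_rho_form] by blast
    then have "\<rho> (form (c - smul k b)) = 0"
      by (simp add: dotC_diff_left dotC_smul_left rho_simps rho_Const)
    then obtain l where "c - smul k b = smul l a" using rho_eq_0 form_dvd_form by blast
    then have "c = smul l a + smul k b" by (simp add: algebra_simps)
    then show False using assms by (simp add: det3_add det3_smul)
  qed
qed

text \<open>\<open>PR\<close> has one factor for each intersection point on the line.
  \<open>PB\<close> collects the repetitions: up to scalars, every further line through a point
  contributes the form of that point once more.\<close>

abbreviation "PR \<equiv> \<Prod>r\<in>R. \<rho> (form r)"
abbreviation "PB \<equiv> \<Prod>b\<in>L - R. \<rho> (form b)"

lemma homog_PR: "homog (card R) PR"
  using homog_prod[of R "\<lambda>_. 1" "\<lambda>b. \<rho> (form b)"] homog_rho_form by simp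

lemma homog_PB: "homog (card L - card R) PB"
  using homog_prod[of "L - R" "\<lambda>_. 1" "\<lambda>b. \<rho> (form b)"] homog_rho_form
  by (simp add: card_Diff_subset[OF finite_R R_subset])

lemma PR_neq_0: "PR \<noteq> 0"
  unfolding prod_zero_iff[OF finite_R] using rho_form_neq_0 cross_a R_subset by blast

lemma PB_neq_0: "PB \<noteq> 0"
  using rho_form_neq_0 cross_a finite_L by (subst prod_zero_iff) auto

lemma rho_PR: "\<rho> PR = PR" and rho_PB: "\<rho> PB = PB"
  by (simp_all add: rho_prod rho_idem)

text \<open>The restrictions of \<open>y\<close> and \<open>u\<close> are orthogonal to
  \<open>a\<close>, so \<open>m\<close> plays the role of the 2 by 2 Saito determinant of the points
  on the line, and it contains the form of each of these points.\<close>

lemma restricted_cross: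
  assumes u: "u \<in> logs (insert a L)"
  shows "\<exists>m. cross (map3 \<rho> y) (map3 \<rho> u) = smul m (map3 Const a) \<and> \<rho> m = m \<and> PR dvd m \<and>
    (\<forall>d. homog3 d u \<longrightarrow> homog (Suc d) m)"
proof -
  have "dotC a (map3 \<rho> y) = 0" "dotC a (map3 \<rho> u) = 0"
    using u by (simp_all add: dotC_rho rho_form_a rho_eq_0 logs_insert)
  then obtain m where m: "cross (map3 \<rho> y) (map3 \<rho> u) = smul m (map3 Const a)"
    using cross_parallel[OF a_neq_0] by blast
  have ca: "map3 Const a \<noteq> (0 :: ('a, 'b) mpol \<times> ('a, 'b) mpol \<times> ('a, 'b) mpol)"
    using a_neq_0 by (cases a) (auto simp: zero_prod_def)
  have mi: "map3 \<rho> (map3 \<rho> v) = map3 \<rho> v" for v by (cases v) (simp add: rho_idem)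
  have mc: "map3 \<rho> (cross v w) = cross (map3 \<rho> v) (map3 \<rho> w)" for v w
    by (cases v; cases w) (simp add: rho_simps)
  have ms: "map3 \<rho> (smul m (map3 Const a)) = smul (\<rho> m) (map3 Const a)"
    by (cases a) (simp add: rho_simps rho_Const)
  have "smul (\<rho> m) (map3 Const a) = smul m (map3 Const a)"
    using arg_cong[OF m, of "map3 \<rho>"] unfolding mc mi ms unfolding m by (rule sym)
  then have 1: "\<rho> m = m" using ca by (rule smul_left_cancel)
  have hm: "homog (Suc d) m" if "homog3 d u" for d
  proof -
    have mh: "homog3 e (map3 \<rho> v)" if "homog3 e v" for e v using that by (cases v) (simp add: rho_homog)
    have *: "homog3 (Suc d) (smul m (map3 Const a))"
      using homog3_cross[OF mh[OF homog_y] mh[OF that]] by (simp add: m)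
    have **: "homog (Suc d) m" if "homog (Suc d) (m * Const c)" "c \<noteq> 0" for c
      using homog_mult_cancel[of 0 "Const c" "Suc d" m] that by (auto simp: mult.commute)
    show ?thesis using * ** a_neq_0 by (cases a) (auto simp: zero_prod_def)
  qed
  have dv: "\<rho> (form b) dvd m" if b: "b \<in> L" for b
  proof -
    have "form b dvd dotC b u" using u b by (simp add: logs_def)
    then have "\<rho> (form b) dvd \<rho> (dotC b u)" by (rule ring_hom_fun_dvd[OF rho_hom])
    then have d: "\<rho> (form b) dvd dotC b (map3 \<rho> u)" "\<rho> (form b) dvd dotC b (map3 \<rho> y)" by (simp_all add: dotC_rho)
    \<comment> \<open>The double cross product. With the restrictions of \<open>y\<close> and
      \<open>u\<close> inserted, both inner products with \<open>b\<close> are divisible by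
      \<open>\<rho> (form b)\<close>, while the left side is \<open>m\<close> times the nonzero
      constant vector \<open>cross b a\<close>.\<close>
    have id: "cross (map3 Const b) (cross v w) = smul (dotC b w) v - smul (dotC b v) w" for v w :: "('a, 'b) mpol \<times> ('a, 'b) mpol \<times> ('a, 'b) mpol"
      by (cases b; cases v; cases w) (simp add: algebra_simps)
    have "all3 (\<lambda>x. \<rho> (form b) dvd x) (smul (dotC b (map3 \<rho> u)) v - smul (dotC b (map3 \<rho> y)) w)" for v w
      by (cases v; cases w) (simp add: d dvd_diff)
    then have "all3 (\<lambda>x. \<rho> (form b) dvd x) (cross (map3 Const b) (smul m (map3 Const a)))"
      unfolding m[symmetric] id by blast
    moreover have "cross (map3 Const b) (smul m (map3 Const a)) = smul m (map3 Const (cross b a))"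
      by (cases a; cases b) (simp add: algebra_simps Const_simps)
    ultimately have al: "all3 (\<lambda>x. \<rho> (form b) dvd x) (smul m (map3 Const (cross b a)))" by simp
    have "cross b a \<noteq> 0" using cross_a[OF b] cross_eq_0_sym by blast
    with al show ?thesis
      by (cases "cross b a") (auto simp: zero_prod_def mult.commute[of m] dest: dvd_Const_mult_cancel)
  qed
  have "PR dvd m"
  proof (rule prod_dvd_of_rel_prime[OF finite_R])
    show "\<rho> (form r) dvd m" if "r \<in> R" for r using dv that R_subset by blast
  qed (intro rel_prime_rho_form R_sep)
  then show ?thesis using m 1 hm by blast
qed

lemma in_class_span:
  assumes "b \<in> L" "r \<in> L" "det3 a b r = 0"
  obtains s t where "b = smul s a + smul t r" "t \<noteq> 0"
proof -
  have "det3 a r b = 0" using assms(3) det3_swap(1)[of a b r] by simp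
  then obtain s t where st: "b = smul s a + smul t r" using triple_span[OF cross_a[OF assms(2)]] by blast
  moreover have "t \<noteq> 0"
  proof
    assume "t = 0"
    then have "b = smul s a" using st by (simp add: smul_simps)
    then show False using cross_a[OF assms(1)] cross_smul(1) by metis
  qed
  ultimately show ?thesis by (rule that)
qed

lemma det3_class:
  assumes "r \<in> R" "s \<in> R" "r \<noteq> s" "b \<in> L" "c \<in> L" "det3 a b r = 0" "det3 a c s = 0"
  shows "det3 a b c \<noteq> 0"
proof -
  obtain x t x' t' where e: "b = smul x a + smul t r" "t \<noteq> 0" "c = smul x' a + smul t' s" "t' \<noteq> 0"
    using in_class_span assms R_subset by (metis subsetD)
  then show ?thesis using R_sep[OF assms(1-3)] by (simp add: det3_add det3_smul)
qed

text \<open>Through an intersection point with \<open>k\<close> lines of \<open>L\<close>, the restricted form occurs in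
  \<open>\<rho> (dotC a u)\<close> with multiplicity at least \<open>k - 1\<close>.\<close>

lemma PB_dvd:
  assumes u: "u \<in> logs L"
  shows "PB dvd \<rho> (dotC a u)"
proof -
  define C where "C r = {b \<in> L - R. det3 a b r = 0}" for r
  have un: "L - R = (\<Union>r\<in>R. C r)" using R_cover by (auto simp: C_def)
  have fC: "finite (C r)" for r using finite_L by (simp add: C_def)
  have "PB = (\<Prod>r\<in>R. \<Prod>b\<in>C r. \<rho> (form b))"
    unfolding un
  proof (rule prod.UNION_disjoint[OF finite_R])
    show "\<forall>r\<in>R. finite (C r)" using fC by blast
    show "\<forall>r\<in>R. \<forall>s\<in>R. r \<noteq> s \<longrightarrow> C r \<inter> C s = {}"
    proof (intro ballI impI)
      fix r s assume "r \<in> R" "s \<in> R" "r \<noteq> s"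
      then have "det3 a b b \<noteq> 0" if "b \<in> C r" "b \<in> C s" for b
        using det3_class[of r s b b] that by (simp add: C_def)
      then show "C r \<inter> C s = {}" by auto
    qed
  qed
  also have "\<dots> dvd \<rho> (dotC a u)"
  proof (rule prod_dvd_of_rel_prime[OF finite_R])
    fix r assume r: "r \<in> R"
    then have rL: "r \<in> L" using R_subset by blast
    \<comment> \<open>Up to scalars and with \<open>b\<close> in place of \<open>r\<close>,
      \<open>X\<close> is the same for every line \<open>b\<close> of the pencil spanned by
      \<open>a\<close> and \<open>r\<close>, so all lines of \<open>L\<close> through the point
      divide it. On the line \<open>a\<close> its second term dies; cancelling one factor
      \<open>\<rho> (form r)\<close> explains the multiplicity \<open>k - 1\<close>.\<close>
    define X where "X = form r * dotC a u - form a * dotC r u"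
    have "(\<Prod>b\<in>insert r (C r). form b) dvd X"
    proof (rule prod_dvd_of_rel_prime)
      show "finite (insert r (C r))" using fC by simp
      fix b assume b: "b \<in> insert r (C r)"
      then have bL: "b \<in> L" and d: "det3 a b r = 0" using rL by (auto simp: C_def)
      obtain s t where st: "b = smul s a + smul t r" "t \<noteq> 0" using in_class_span[OF bL rL d] by blast
      have "Const t * X = form b * dotC a u - form a * dotC b u"
        unfolding X_def st(1) dotC_comb by (simp add: algebra_simps)
      moreover have "form b dvd dotC b u" using u bL by (simp add: logs_def)
      ultimately have "form b dvd Const t * X" by (metis dvd_diff dvd_triv_left dvd_mult)
      then show "form b dvd X" using st(2) by (rule dvd_Const_mult_cancel)
      fix c assume c: "c \<in> insert r (C r)" "b \<noteq> c"
      then have "c \<in> L" using rL by (auto simp: C_def)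
      then show "rel_prime (form b) (form c)"
        using arr_L bL c(2) by (intro rel_prime_forms) (simp add: arr_def)
    qed
    then have "\<rho> (\<Prod>b\<in>insert r (C r). form b) dvd \<rho> X" by (rule ring_hom_fun_dvd[OF rho_hom])
    moreover have "r \<notin> C r" using r by (simp add: C_def)
    ultimately have "\<rho> (form r) * (\<Prod>b\<in>C r. \<rho> (form b)) dvd \<rho> (form r) * \<rho> (dotC a u)"
      using fC[of r] by (simp add: rho_prod X_def rho_simps rho_form_a)
    then show "(\<Prod>b\<in>C r. \<rho> (form b)) dvd \<rho> (dotC a u)"
      using rho_form_neq_0[OF cross_a[OF rL]] by simp
    fix s assume s: "s \<in> R" "r \<noteq> s"
    show "rel_prime (\<Prod>b\<in>C r. \<rho> (form b)) (\<Prod>b\<in>C s. \<rho> (form b))"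
    proof (intro rel_prime_prod_left rel_prime_prod_right rel_prime_rho_form)
      fix b c assume "b \<in> C r" "c \<in> C s"
      then show "det3 a b c \<noteq> 0" using det3_class[OF r s(1) s(2)] by (simp add: C_def)
    next
      fix b assume "b \<in> C r"
      then show "\<rho> (form b) \<noteq> 0" using rho_form_neq_0 cross_a by (simp add: C_def)
    qed
  qed
  finally show ?thesis .
qed

end

section \<open>Deletion and addition of a line\<close>

context restriction
begin

text \<open>When \<open>a\<close> is completed to a basis by \<open>b\<close> and \<open>c\<close>,
  the restricted forms of \<open>b\<close> and \<open>c\<close> are coprime, so proportionality to
  the restricted \<open>y\<close> leaves no denominator.\<close>

lemma multiple_of_rho_y:
  assumes "dotC a q = 0" "cross (map3 \<rho> y) q = 0" "map3 \<rho> q = q"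
  shows "\<exists>f. \<rho> f = f \<and> q = smul f (map3 \<rho> y)"
proof -
  obtain b c where bc: "det3 a b c \<noteq> 0" using ex_det3_neq_0[OF a_neq_0] by blast
  have e: "\<rho> (form b) * dotC c q = \<rho> (form c) * dotC b q"
    using cross_eq_0_dvd[OF assms(2), of b c] by (simp add: dotC_rho)
  then have "\<rho> (form b) dvd \<rho> (form c) * dotC b q" by (metis dvd_triv_left)
  then have "\<rho> (form b) dvd dotC b q"
    using rel_prime_rho_form[OF bc] unfolding rel_prime_def by blast
  then obtain f where f: "dotC b q = \<rho> (form b) * f" by (rule dvdE)
  have nz: "\<rho> (form b) \<noteq> 0" using rho_form_neq_0 det3_neq_0_cross(1)[OF bc] by blast
  have "\<rho> (form b) * dotC c q = \<rho> (form b) * (\<rho> (form c) * f)" using e f by (simp add: mult_ac)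
  then have g: "dotC c q = \<rho> (form c) * f" using nz by simp
  have rq: "\<rho> (dotC b q) = dotC b q" using dotC_rho[of b q] assms(3) by simp
  have "\<rho> (form b) * \<rho> f = \<rho> (form b) * f"
    using rq unfolding f by (simp add: rho_simps rho_idem)
  then have rf: "\<rho> f = f" using nz by simp
  have "q - smul f (map3 \<rho> y) = 0"
    by (rule dotC_det3_zero[OF bc]) (simp_all add: dotC_diff dotC_smul dotC_rho f g assms(1) rho_form_a mult.commute)
  then show ?thesis using rf by auto
qed

text \<open>A vector whose restriction is proportional to that of \<open>y\<close> can be corrected
  by a multiple of \<open>y\<close> so that it vanishes on the line. Division by
  \<open>form a\<close> then removes \<open>a\<close> from the determinant and lowers one
  exponent.\<close>

lemma delete_vector:
  assumes w: "exps_witness (insert a L) d1 d2 u v"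
    and z: "cross (map3 \<rho> y) (map3 \<rho> v) = 0"
  obtains f \<psi> where "v = smul f y + smul (form a) \<psi>" "1 \<le> d2" "exps_witness L d1 (d2 - 1) u \<psi>"
proof -
  obtain c where uv: "u \<in> logs (insert a L)" "v \<in> logs (insert a L)" "homog3 d1 u" "homog3 d2 v"
    "c \<noteq> 0" "det3 y u v = Const c * forms (insert a L)"
    using w unfolding exps_witness_def by blast
  have fa: "form a \<noteq> 0" by (rule form_neq_0[OF a_neq_0])
  have nz: "det3 y u v \<noteq> 0" using uv(5,6) forms_neq_0[OF arr_insert] by simp
  have "dotC a (map3 \<rho> v) = 0" using uv(2) by (simp add: dotC_rho rho_eq_0 logs_insert)
  moreover have "map3 \<rho> (map3 \<rho> v) = map3 \<rho> v" by (cases v) (simp add: rho_idem)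
  ultimately obtain f0 where f0: "\<rho> f0 = f0" "map3 \<rho> v = smul f0 (map3 \<rho> y)"
    using multiple_of_rho_y z by blast
  \<comment> \<open>The multiplier must be homogeneous for the quotient to be so. A nonzero
    \<open>f0\<close> has degree \<open>d2 - 1\<close> automatically; if it is zero, no degree can
    be read off and the multiplier 0 is taken.\<close>
  have "\<exists>f. homog3 d2 (smul f y) \<and> map3 \<rho> v = smul (\<rho> f) (map3 \<rho> y)"
  proof (cases "f0 = 0")
    case True
    then show ?thesis using f0 by (intro exI[of _ 0]) (simp add: smul_simps rho_simps)
  next
    case False
    obtain b b' where "det3 a b b' \<noteq> 0" using ex_det3_neq_0[OF a_neq_0] by blast
    then have nzb: "\<rho> (form b) \<noteq> 0" using rho_form_neq_0 det3_neq_0_cross(1) by blast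
    have "dotC b (map3 \<rho> v) = dotC b (smul f0 (map3 \<rho> y))" using f0 by simp
    then have "\<rho> (dotC b v) = \<rho> (form b) * f0" by (simp add: dotC_rho dotC_smul mult.commute)
    then have "homog d2 (\<rho> (form b) * f0)" using rho_homog[OF homog_dotC[OF uv(4)]] by metis
    then have "1 \<le> d2 \<and> homog (d2 - 1) f0"
      using homog_mult_cancel[OF homog_rho_form nzb] False by blast
    then have "homog3 (d2 - 1 + 1) (smul f0 y)" "1 \<le> d2" using homog3_smul[OF _ homog_y] by blast+
    then show ?thesis using f0 by (intro exI[of _ f0]) simp
  qed
  then obtain f where f: "homog3 d2 (smul f y)" "map3 \<rho> v = smul (\<rho> f) (map3 \<rho> y)" by blast
  have "all3 (\<lambda>x. \<rho> x = 0) (v - smul f y)"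
    using f(2) by (cases v; cases y) (simp add: rho_simps)
  then have "all3 (\<lambda>x. form a dvd x) (v - smul f y)" by (rule all3_mono) (simp add: rho_eq_0)
  then obtain \<psi> where psi: "v - smul f y = smul (form a) \<psi>" by (rule dvd_smulE)
  then have v: "v = smul f y + smul (form a) \<psi>" by (simp add: algebra_simps)
  have det: "det3 y u v = form a * det3 y u \<psi>"
    unfolding v by (simp add: det3_add det3_smul)
  have "\<psi> \<noteq> 0" using nz det by auto
  moreover have "homog3 d2 (smul (form a) \<psi>)" unfolding psi[symmetric] by (rule homog3_diff[OF uv(4) f(1)])
  ultimately have h: "1 \<le> d2" "homog3 (d2 - 1) \<psi>" using homog3_smul_cancel[OF homog_form fa] by blast+
  have "\<psi> \<in> logs L"
    unfolding logs_def
  proof (intro CollectI ballI)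
    fix b assume b: "b \<in> L"
    have "form a * dotC b \<psi> = dotC b v - f * form b" unfolding v by (simp add: dotC_add dotC_smul)
    moreover have "form b dvd dotC b v" using uv(2) b by (simp add: logs_def)
    ultimately have "form b dvd form a * dotC b \<psi>" by (metis dvd_diff dvd_triv_right)
    moreover have "cross b a \<noteq> 0" using cross_a[OF b] cross_eq_0_sym by blast
    ultimately show "form b dvd dotC b \<psi>" using rel_prime_forms unfolding rel_prime_def by blast
  qed
  moreover have "u \<in> logs L" using uv(1) by (simp add: logs_insert)
  moreover have "det3 y u \<psi> = Const c * forms L"
  proof -
    have "form a * det3 y u \<psi> = form a * (Const c * forms L)"
      unfolding det[symmetric] uv(6) using a_notin finite_L by (simp add: mult_ac)
    then show ?thesis using fa by simp
  qed
  ultimately have "exps_witness L d1 (d2 - 1) u \<psi>"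
    unfolding exps_witness_def using uv(3,5) h(2) by blast
  then show ?thesis using that v h(1) by blast
qed

text \<open>The count is squeezed from two sides. \<open>PR\<close> divides the nonzero restricted
  determinant of \<open>u\<close>, of degree \<open>d1 + 1\<close>, so \<open>r \<le> d1\<close>;
  \<open>PB\<close> divides the nonzero restricted value of \<open>\<psi>\<close> at
  \<open>a\<close>, of degree \<open>d2 - 1\<close>, so \<open>d1 \<le> r\<close>.\<close>

lemma delete_vector_card:
  assumes w: "exps_witness (insert a L) d1 d2 u v" and r: "card R = Suc r"
    and z: "cross (map3 \<rho> y) (map3 \<rho> v) = 0"
  shows "d1 = r \<and> 1 \<le> d2 \<and> exps L d1 (d2 - 1)"
proof -
  obtain f \<psi> where v: "v = smul f y + smul (form a) \<psi>" "1 \<le> d2" and w': "exps_witness L d1 (d2 - 1) u \<psi>"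
    using delete_vector[OF w z] by blast
  obtain c where c: "c \<noteq> 0" "det3 y u \<psi> = Const c * forms L" "\<psi> \<in> logs L" "homog3 (d2 - 1) \<psi>"
    using w' unfolding exps_witness_def by blast
  have uL: "u \<in> logs (insert a L)" "homog3 d1 u" using w by (simp_all add: exps_witness_def)
  have ex: "exps L d1 (d2 - 1)" using w' unfolding exps_def by blast
  have sum: "d1 + d2 = card L" using exps_sum[OF arr_L ex] v(2) by simp
  have ndvd: "\<not> form a dvd Const c * forms L"
  proof
    assume "form a dvd Const c * forms L"
    then have "form a dvd forms L" using c(1) by (rule dvd_Const_mult_cancel)
    moreover have "rel_prime (form a) (forms L)" by (intro rel_prime_prod_right rel_prime_forms cross_a)
    ultimately have "form a dvd 1" unfolding rel_prime_def by (metis mult.right_neutral)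
    then show False using prime_form[OF a_neq_0] by (simp add: prime_elem_def)
  qed
  have "\<rho> (dotC a \<psi>) \<noteq> 0"
  proof
    assume "\<rho> (dotC a \<psi>) = 0"
    then have "\<psi> \<in> logs (insert a L)" using c(3) by (simp add: logs_insert rho_eq_0)
    then have "forms (insert a L) dvd det3 y u \<psi>" using forms_dvd_det3[OF arr_insert y_in_logs uL(1)] by blast
    then have "form a dvd Const c * forms L" unfolding c(2) prod.insert[OF finite_L a_notin] by (rule dvd_mult_left)
    then show False using ndvd by blast
  qed
  moreover have "homog (d2 - 1) (\<rho> (dotC a \<psi>))" by (intro rho_homog homog_dotC c)
  ultimately have "card L - card R \<le> d2 - 1"
    using homog_dvd_eq_0[OF homog_PB _ PB_dvd[OF c(3)]] by (meson not_le)
  then have 1: "d1 \<le> r" using sum r v(2) by simp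
  \<comment> \<open>Otherwise \<open>u\<close> too would be divisible by \<open>form a\<close> up to
    a multiple of \<open>y\<close>, and \<open>form a\<close> would divide the determinant for
    \<open>L\<close>, which does not contain \<open>a\<close>.\<close>
  have "cross (map3 \<rho> y) (map3 \<rho> u) \<noteq> 0"
  proof
    assume "cross (map3 \<rho> y) (map3 \<rho> u) = 0"
    then obtain g \<phi> where "u = smul g y + smul (form a) \<phi>"
      using delete_vector[OF exps_witness_swap[OF w]] by blast
    then have "det3 y u \<psi> = form a * det3 y \<phi> \<psi>" by (simp add: det3_add det3_smul)
    then show False using ndvd c(2) by (metis dvd_triv_left)
  qed
  moreover obtain m where m: "cross (map3 \<rho> y) (map3 \<rho> u) = smul m (map3 Const a)" "PR dvd m" "homog (Suc d1) m"
    using restricted_cross[OF uL(1)] uL(2) by blast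
  ultimately have "m \<noteq> 0" by (auto simp: smul_simps)
  then have "card R \<le> Suc d1" using homog_dvd_eq_0[OF homog_PR m(3,2)] by (meson not_le)
  then show ?thesis using 1 r v(2) ex by simp
qed

text \<open>If neither restricted determinant vanishes, divisibility by \<open>PR\<close> bounds
  \<open>r\<close> by both exponents. For \<open>r = d1\<close> the determinant of \<open>u\<close>
  is \<open>PR\<close> up to a scalar, and subtracting a multiple of \<open>u\<close> from
  \<open>v\<close> leads back to \<open>delete_vector_card\<close>.\<close>

lemma deletion:
  assumes e: "exps (insert a L) d1 d2" and r: "card R = Suc r"
  shows "(r \<le> d1 \<and> r \<le> d2 \<or> r = d1 \<or> r = d2) \<and> (r = d1 \<longrightarrow> 1 \<le> d2 \<and> exps L d1 (d2 - 1))"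
proof -
  obtain u v where w: "exps_witness (insert a L) d1 d2 u v" using e unfolding exps_def by blast
  then have uv: "u \<in> logs (insert a L)" "v \<in> logs (insert a L)" "homog3 d1 u" "homog3 d2 v"
    by (simp_all add: exps_witness_def)
  obtain m1 where m1: "cross (map3 \<rho> y) (map3 \<rho> u) = smul m1 (map3 Const a)" "\<rho> m1 = m1" "PR dvd m1" "homog (Suc d1) m1"
    using restricted_cross[OF uv(1)] uv(3) by blast
  obtain m2 where m2: "cross (map3 \<rho> y) (map3 \<rho> v) = smul m2 (map3 Const a)" "\<rho> m2 = m2" "PR dvd m2" "homog (Suc d2) m2"
    using restricted_cross[OF uv(2)] uv(4) by blast
  consider "m2 = 0" | "m1 = 0" | "m1 \<noteq> 0" "m2 \<noteq> 0" by blast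
  then show ?thesis
  proof cases
    case 1
    then have "cross (map3 \<rho> y) (map3 \<rho> v) = 0" using m2(1) by (simp add: smul_simps)
    then show ?thesis using delete_vector_card[OF w r] by auto
  next
    case 2
    then have "cross (map3 \<rho> y) (map3 \<rho> u) = 0" using m1(1) by (simp add: smul_simps)
    then have "d2 = r \<and> 1 \<le> d1 \<and> exps L d2 (d1 - 1)"
      by (rule delete_vector_card[OF exps_witness_swap[OF w] r])
    then show ?thesis by auto
  next
    case 3
    have le: "r \<le> d1" "r \<le> d2"
      using homog_dvd_eq_0[OF homog_PR m1(4,3)] homog_dvd_eq_0[OF homog_PR m2(4,3)] 3 r
      by linarith+
    moreover have "1 \<le> d2 \<and> exps L d1 (d2 - 1)" if "r = d1"
    proof -
      have "homog (card R) m1" using m1(4) r that by simp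
      then obtain k where k: "m1 = Const k * PR" using homog_dvd_Const[OF homog_PR _ m1(3)] by blast
      have "k \<noteq> 0" using k 3 by auto
      have "card R \<le> Suc d2" using le r by simp
      then obtain g where g: "m2 = PR * g" "homog (Suc d2 - card R) g"
        using homog_dvdE[OF homog_PR m2(4,3)] by blast
      have "PR * \<rho> g = PR * g" using m2(2) unfolding g(1) rho_simps rho_PR .
      then have rg: "\<rho> g = g" using PR_neq_0 by simp
      \<comment> \<open>\<open>h\<close> is the quotient of \<open>m2\<close> by \<open>m1\<close>.
        Subtracting \<open>h\<close> times \<open>u\<close> from \<open>v\<close> keeps the degree
        and the Saito determinant, but annihilates the restricted determinant.\<close>
      define h where "h = Const (1 / k) * g"
      have rh: "\<rho> h = h" by (simp add: h_def rho_simps rho_Const rg)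
      have "homog (d2 - d1) h" unfolding h_def using g(2) r that by (intro homog_Const_mult) simp
      then have hh: "homog3 d2 (smul h u)" using homog3_smul[OF _ uv(3)] le that by fastforce
      define v' where "v' = v - smul h u"
      have "v' \<in> logs (insert a L)" unfolding v'_def by (intro logs_diff logs_smul uv)
      moreover have "homog3 d2 v'" unfolding v'_def by (intro homog3_diff uv hh)
      moreover have "det3 y u v' = det3 y u v" unfolding v'_def by (simp add: det3_diff det3_smul)
      ultimately have w': "exps_witness (insert a L) d1 d2 u v'" using w by (simp add: exps_witness_def)
      have "map3 \<rho> v' = map3 \<rho> v - smul h (map3 \<rho> u)"
        unfolding v'_def by (cases u; cases v) (simp add: rho_simps rh)
      moreover have "cross p (q - smul h s) = cross p q - smul h (cross p s)" for p q s
        by (cases p; cases q; cases s) (simp add: algebra_simps)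
      ultimately have "cross (map3 \<rho> y) (map3 \<rho> v') = smul m2 (map3 Const a) - smul h (smul m1 (map3 Const a))"
        using m1(1) m2(1) by simp
      also have "\<dots> = 0"
      proof -
        have "Const k * h = g" using \<open>k \<noteq> 0\<close> by (simp add: h_def mult.assoc[symmetric] flip: Const_mult)
        then have "h * m1 = m2" unfolding k g(1) by (simp add: mult_ac)
        then show ?thesis by (simp flip: smul_simps(2))
      qed
      finally show ?thesis using delete_vector_card[OF w' r] by blast
    qed
    ultimately show ?thesis by blast
  qed
qed

text \<open>\<open>PB\<close> divides the restricted values of \<open>u\<close> and \<open>v\<close>
  at \<open>a\<close>, and the hypothesis on \<open>card R\<close> makes its degree
  \<open>d2\<close>. So the value of \<open>v\<close> is a scalar times \<open>PB\<close>; if the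
  scalar is nonzero, a multiple of \<open>v\<close> corrects \<open>u\<close> to be logarithmic
  along \<open>a\<close>, and \<open>v\<close> is multiplied by \<open>form a\<close>.\<close>

lemma addition:
  assumes e: "exps L d1 d2" and r: "card R = Suc d1"
  shows "exps (insert a L) d1 (Suc d2)"
proof -
  obtain u v c where w: "u \<in> logs L" "v \<in> logs L" "homog3 d1 u" "homog3 d2 v" "c \<noteq> 0" "det3 y u v = Const c * forms L"
    using e unfolding exps_def exps_witness_def by blast
  have "d1 + d2 + 1 = card L" by (rule exps_sum[OF arr_L e])
  then have cPB: "homog d2 PB" using homog_PB r by (simp flip: \<open>d1 + d2 + 1 = card L\<close>)
  have ins: "forms (insert a L) = form a * forms L" using a_notin finite_L by simp
  have sa: "smul (form a) x \<in> logs (insert a L)" if "x \<in> logs L" for x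
    using that by (simp add: logs_insert logs_smul dotC_smul)
  have ha: "homog3 (Suc d) (smul (form a) x)" if "homog3 d x" for d x
    using homog3_smul[OF homog_form that] by simp
  obtain k where k: "\<rho> (dotC a v) = Const k * PB"
    using homog_dvd_Const[OF cPB rho_homog[OF homog_dotC[OF w(4)]] PB_dvd[OF w(2)]] by blast
  obtain h where h: "\<rho> (dotC a u) = PB * h" using PB_dvd[OF w(1)] by (rule dvdE)
  show ?thesis
  proof (cases "k = 0")
    case False
    have "homog d1 (PB * h)" using rho_homog[OF homog_dotC[OF w(3)], of a] h by simp
    then have hh: "h = 0 \<or> d2 \<le> d1 \<and> homog (d1 - d2) h"
      by (rule homog_mult_cancel[OF cPB PB_neq_0])
    have "PB * \<rho> h = PB * h"
      using rho_idem[of "dotC a u"] unfolding h rho_simps rho_PB .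
    then have rh: "\<rho> h = h" using PB_neq_0 by simp
    define g where "g = Const (1 / k) * h"
    have "homog3 d1 (smul g v)"
    proof (cases "h = 0")
      case True
      then show ?thesis by (simp add: g_def smul_simps)
    next
      case False
      then have "d2 \<le> d1" "homog (d1 - d2) g" using hh by (auto simp: g_def homog_Const_mult)
      then have "homog3 (d1 - d2 + d2) (smul g v)" "d2 \<le> d1" using homog3_smul w(4) by blast+
      then show ?thesis by simp
    qed
    then have hu: "homog3 d1 (u - smul g v)" by (rule homog3_diff[OF w(3)])
    have "Const k * g = h" using False by (simp add: g_def mult.assoc[symmetric] flip: Const_mult)
    moreover have "\<rho> (dotC a (u - smul g v)) = PB * h - PB * (Const k * g)"
      unfolding dotC_diff dotC_smul rho_simps h k by (simp add: g_def rho_simps rho_Const rh mult_ac)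
    ultimately have "\<rho> (dotC a (u - smul g v)) = 0" by simp
    then have ul: "u - smul g v \<in> logs (insert a L)"
      using w(1,2) by (simp add: logs_insert logs_diff logs_smul rho_eq_0)
    have "det3 y (u - smul g v) (smul (form a) v) = Const c * forms (insert a L)"
      by (simp add: det3_diff det3_smul w(6) ins mult_ac)
    then show ?thesis unfolding exps_def exps_witness_def
      using ul sa[OF w(2)] hu ha[OF w(4)] w(5) by blast
  next
    case True
    then have vl: "v \<in> logs (insert a L)" using k w(2) by (simp add: logs_insert rho_eq_0)
    have "det3 y v (smul (form a) u) = Const (- c) * forms (insert a L)"
      using det3_swap(1)[of y v u] by (simp add: det3_smul w(6) ins Const_uminus mult_ac)
    then have w': "exps_witness (insert a L) d2 (Suc d1) v (smul (form a) u)"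
      unfolding exps_witness_def using vl sa[OF w(1)] w(4) ha[OF w(3)] w(5) by (metis neg_equal_0_iff_equal)
    \<comment> \<open>Here \<open>v\<close> itself is logarithmic along \<open>a\<close>, with
      exponents \<open>d2\<close> and \<open>d1 + 1\<close>. The second vector restricts to zero, so
      the squeeze forces \<open>d2 = d1\<close>, and these are the claimed exponents.\<close>
    have "map3 \<rho> (smul (form a) u) = 0" by (cases u) (simp add: rho_simps rho_form_a zero_prod_def)
    moreover have "cross p 0 = 0" for p :: "('a, 'b) mpol \<times> ('a, 'b) mpol \<times> ('a, 'b) mpol" by (cases p) (simp add: zero_prod_def)
    ultimately have "d2 = d1" using delete_vector_card[OF w' r] by simp
    then show ?thesis using w' unfolding exps_def by blast
  qed
qed

end

section \<open>Gain graphs on three vertices\<close>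

lemma three_add_3: "(i::3) + 3 = i" "(i::3) + 1 + 1 = i + 2" "(i::3) + 1 + 2 = i" "(i::3) + 2 + 1 = i" "(i::3) + 2 + 2 = i + 1"
proof -
  have 3: "(3::3) = 0" by simp
  show "i + 3 = i" "i + 1 + 2 = i" "i + 2 + 1 = i" "i + 1 + 1 = i + 2" "i + 2 + 2 = i + 1"
    using 3 by (simp_all add: add.assoc)
qed

lemma UNIV_three: "(UNIV::3 set) = {i, i + 1, i + 2}"
proof -
  have "i \<noteq> i + 1" "i \<noteq> i + 2" "i + 1 \<noteq> i + 2" by simp_all
  then have "card {i, i + 1, i + 2} = CARD(3)" by simp
  then show ?thesis by (metis card_subset_eq finite subset_UNIV)
qed

text \<open>\<open>E i\<close> is the set of gains of the edges from \<open>i\<close> to \<open>i + 1\<close>, so that a triangle consists of three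
  edges whose gains add up to zero. Besides the intersection points forced by the coordinate lines,
  \<open>new_points E i e\<close> is the number of intersection points on the line of the edge \<open>(i, e)\<close>.\<close>

definition new_points :: "(3 \<Rightarrow> int set) \<Rightarrow> 3 \<Rightarrow> int \<Rightarrow> nat" where
  "new_points E i e = card (E (i + 1)) + card {h \<in> E (i + 2). - (e + h) \<notin> E (i + 1)}"

text \<open>The common combinatorial condition. The pair consists of the exponents without the shift
  \<open>m\<close> that depends on the arrangement; \<open>add\<close> mirrors the addition theorem,
  which always raises the second exponent, hence the rule \<open>swap\<close>.\<close>

inductive inductively_free :: "(3 \<Rightarrow> int set) \<Rightarrow> nat \<Rightarrow> nat \<Rightarrow> bool" where
  empty: "inductively_free (\<lambda>_. {}) 0 0"
| add: "inductively_free E d1 d2 \<Longrightarrow> e \<notin> E i \<Longrightarrow> new_points E i e = d1 \<Longrightarrow>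
    inductively_free (E(i := insert e (E i))) d1 (Suc d2)"
| swap: "inductively_free E d1 d2 \<Longrightarrow> inductively_free E d2 d1"

definition edge_number :: "(3 \<Rightarrow> int set) \<Rightarrow> nat" where
  "edge_number E = (\<Sum>i\<in>UNIV. card (E i))"

lemma edge_number: "edge_number E = card (E i) + card (E (i + 1)) + card (E (i + 2))"
  unfolding edge_number_def UNIV_three[of i] by simp

lemma edge_number_insert:
  assumes "finite (E i)" "e \<notin> E i"
  shows "edge_number (E(i := insert e (E i))) = Suc (edge_number E)"
  using assms by (simp add: edge_number[of _ i])

lemma new_points_upd: "new_points (E(i := X)) i e = new_points E i e"
  by (simp add: new_points_def)

lemma new_points_eq:
  assumes "\<And>i. finite (E i)"
  shows "new_points E i e + card {h \<in> E (i + 2). - (e + h) \<in> E (i + 1)} = card (E (i + 1)) + card (E (i + 2))"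
proof -
  have "E (i + 2) = {h \<in> E (i + 2). - (e + h) \<in> E (i + 1)} \<union> {h \<in> E (i + 2). - (e + h) \<notin> E (i + 1)}" by auto
  then have "card (E (i + 2)) = card {h \<in> E (i + 2). - (e + h) \<in> E (i + 1)} + card {h \<in> E (i + 2). - (e + h) \<notin> E (i + 1)}"
    using assms[of "i + 2"] by (metis (no_types, lifting) card_Un_disjoint disjoint_iff finite_Un mem_Collect_eq)
  then show ?thesis by (simp add: new_points_def)
qed

text \<open>The largest gain in \<open>E i\<close> and the smallest one in \<open>E (i + 1)\<close> have at most one third edge in
  common, so one of these two edges lies in few triangles.\<close>

lemma ex_edge_many_points:
  assumes fin: "\<And>i. finite (E i)" and ne: "E i \<noteq> {}" "E (i + 1) \<noteq> {}"
  shows "\<exists>j e. e \<in> E j \<and> edge_number E \<le> 2 * new_points E j e + 1"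
proof -
  define e where "e = Max (E i)"
  define f where "f = Min (E (i + 1))"
  have ef: "e \<in> E i" "f \<in> E (i + 1)" using fin ne by (auto simp: e_def f_def)
  define A where "A = {h \<in> E (i + 2). - (e + h) \<in> E (i + 1)}"
  define B where "B = {h \<in> E i. - (f + h) \<in> E (i + 2)}"
  have A: "new_points E i e + card A = card (E (i + 1)) + card (E (i + 2))"
    unfolding A_def using new_points_eq[of E] fin by blast
  have B: "new_points E (i + 1) f + card B = card (E (i + 2)) + card (E i)"
    using new_points_eq[of E "i + 1" f] fin unfolding three_add_3 B_def by blast
  \<comment> \<open>A triangle through \<open>f\<close> is indexed in \<open>B\<close> by its edge
    in \<open>E i\<close>; the map passes to its edge in \<open>E (i + 2)\<close>, where it can be
    compared with \<open>A\<close>.\<close>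
  define C where "C = (\<lambda>h. - (f + h)) ` B"
  have "card C = card B" unfolding C_def by (intro card_image) (auto simp: inj_on_def)
  \<comment> \<open>A common \<open>h\<close> closes a triangle with \<open>e\<close> and a gain at
    least \<open>f\<close>, and one with \<open>f\<close> and a gain at most \<open>e\<close>. Both
    gain sums are zero, so these gains are \<open>f\<close> and \<open>e\<close> themselves.\<close>
  have AC: "A \<inter> C \<subseteq> {- (e + f)}"
  proof
    fix h assume h: "h \<in> A \<inter> C"
    then have "f \<le> - (e + h)" using fin by (auto simp: A_def f_def)
    moreover have "- (f + h) \<le> e" using h fin by (auto simp: C_def B_def e_def)
    ultimately show "h \<in> {- (e + f)}" by simp
  qed
  have sub: "A \<union> C \<subseteq> E (i + 2)" by (auto simp: A_def C_def B_def)
  have fA: "finite A" "finite C" using finite_subset[OF sub fin] by auto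
  have "card A + card C = card (A \<union> C) + card (A \<inter> C)" by (rule card_Un_Int[OF fA])
  also have "\<dots> \<le> card (E (i + 2)) + 1"
    using card_mono[OF fin sub] card_mono[OF _ AC] by simp
  finally have "card A + card B \<le> card (E (i + 2)) + 1" using \<open>card C = card B\<close> by simp
  \<comment> \<open>The two point counts together lose at most \<open>card (E (i + 2)) + 1\<close>,
    so they add up to at least the number of edges minus one.\<close>
  then have "edge_number E \<le> new_points E i e + new_points E (i + 1) f + 1"
    using A B edge_number[of E i] by linarith
  then have "edge_number E \<le> 2 * new_points E i e + 1 \<or> edge_number E \<le> 2 * new_points E (i + 1) f + 1" by linarith
  then show ?thesis using ef by blast
qed

lemma inductively_free_one_family:
  assumes "finite X"
  shows "inductively_free ((\<lambda>_. {})(j := X)) 0 (card X)"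
  using assms
proof induction
  case empty
  have "(\<lambda>_. {})(j := {}) = (\<lambda>_::3. {}::int set)" by auto
  then show ?case using inductively_free.empty by simp
next
  case (insert x F)
  let ?E = "(\<lambda>_. {})(j := F)"
  have np: "new_points ?E j x = 0" by (simp add: new_points_def)
  have "inductively_free (?E(j := insert x (?E j))) 0 (Suc (card F))"
    by (rule inductively_free.add[OF insert.IH _ np]) (simp add: insert)
  moreover have "?E(j := insert x (?E j)) = (\<lambda>_. {})(j := insert x F)" by simp
  moreover have "card (insert x F) = Suc (card F)" using insert by simp
  ultimately show ?case by metis
qed

text \<open>\<open>S\<close> holds the lines present for every graph: the line at infinity, or the
  three coordinate lines. On an edge line they cut out \<open>m + 1\<close> points, for which
  \<open>T i\<close> has one representative each; edge lines of equal type meet in one of these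
  points. Apart from equality of lines, gains matter only through \<open>triangle\<close>.\<close>

locale gain_model = linear_coordinates +
  fixes vec :: "3 \<Rightarrow> int \<Rightarrow> 'b \<times> 'b \<times> 'b" and S :: "('b \<times> 'b \<times> 'b) set"
    and T :: "3 \<Rightarrow> ('b \<times> 'b \<times> 'b) set" and m :: nat
  assumes arr_S: "arr S" and exps_S: "exps S m m"
    and T_subset: "T i \<subseteq> S" and card_T: "card (T i) = Suc m"
    and cross_S: "s \<in> S \<Longrightarrow> cross s (vec i g) \<noteq> 0"
    and cross_vec: "(i, g) \<noteq> (j, h) \<Longrightarrow> cross (vec i g) (vec j h) \<noteq> 0"
    and T_sep: "s \<in> T i \<Longrightarrow> t \<in> T i \<Longrightarrow> s \<noteq> t \<Longrightarrow> det3 (vec i e) s t \<noteq> 0"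
    and T_cover: "s \<in> S \<Longrightarrow> \<exists>t\<in>T i. det3 (vec i e) s t = 0"
    and T_parallel: "\<exists>t\<in>T i. det3 (vec i e) (vec i g) t = 0"
    and T_vec: "t \<in> T i \<Longrightarrow> j \<noteq> i \<Longrightarrow> det3 (vec i e) t (vec j g) \<noteq> 0"
    and vec_sep: "j \<noteq> i \<Longrightarrow> g \<noteq> h \<Longrightarrow> det3 (vec i e) (vec j g) (vec j h) \<noteq> 0"
    and triangle: "det3 (vec i e) (vec (i + 1) g) (vec (i + 2) h) = 0 \<longleftrightarrow> e + g + h = 0"
begin

definition lines :: "(3 \<Rightarrow> int set) \<Rightarrow> ('b \<times> 'b \<times> 'b) set" where
  "lines E = S \<union> (\<Union>i. vec i ` E i)"

lemma vec_eq_iff: "vec i g = vec j h \<longleftrightarrow> i = j \<and> g = h"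
proof -
  have "cross u u = 0" for u :: "'b \<times> 'b \<times> 'b" by (cases u) (simp add: zero_prod_def)
  then show ?thesis using cross_vec by (metis prod.inject)
qed

lemma vec_notin_S: "vec i g \<notin> S"
proof -
  have "cross u u = 0" for u :: "'b \<times> 'b \<times> 'b" by (cases u) (simp add: zero_prod_def)
  then show ?thesis using cross_S by metis
qed

lemma in_lines: "x \<in> lines E \<longleftrightarrow> x \<in> S \<or> (\<exists>j g. x = vec j g \<and> g \<in> E j)"
  unfolding lines_def by blast

lemma lines_insert: "lines (E(i := insert e (E i))) = insert (vec i e) (lines E)"
proof (rule set_eqI)
  fix x
  have h: "g \<in> (E(i := insert e (E i))) j \<longleftrightarrow> j = i \<and> g = e \<or> g \<in> E j" for g j by auto
  show "x \<in> lines (E(i := insert e (E i))) \<longleftrightarrow> x \<in> insert (vec i e) (lines E)"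
    unfolding in_lines insert_iff h by blast
qed

lemma vec_in_lines: "vec i e \<in> lines E \<longleftrightarrow> e \<in> E i"
  unfolding in_lines vec_eq_iff using vec_notin_S by blast

lemma arr_lines:
  assumes "\<forall>i. finite (E i)"
  shows "arr (lines E)"
proof -
  have S: "finite S" "0 \<notin> S" "\<And>a b. a \<in> S \<Longrightarrow> b \<in> S \<Longrightarrow> a \<noteq> b \<Longrightarrow> cross a b \<noteq> 0" using arr_S by (auto simp: arr_def)
  have "vec i g \<noteq> 0" for i g
  proof
    assume 0: "vec i g = 0"
    have "cross (vec i g) (vec i (g + 1)) \<noteq> 0" by (rule cross_vec) simp
    then show False unfolding 0 by (cases "vec i (g + 1)") (simp add: zero_prod_def)
  qed
  moreover have "cross a b \<noteq> 0" if a: "a \<in> lines E" and b: "b \<in> lines E" and ab: "a \<noteq> b" for a b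
  proof -
    have "a \<in> S \<or> (\<exists>i g. a = vec i g)" "b \<in> S \<or> (\<exists>i g. b = vec i g)" using a b by (auto simp: lines_def)
    then show ?thesis
    proof (elim disjE exE)
      assume "a \<in> S" "b \<in> S"
      then show ?thesis using S(3) ab by blast
    next
      fix i g assume "a \<in> S" "b = vec i g"
      then show ?thesis using cross_S by blast
    next
      fix i g assume "a = vec i g" "b \<in> S"
      then show ?thesis using cross_S cross_eq_0_sym by blast
    next
      fix i g j h assume e: "a = vec i g" "b = vec j h"
      then have "(i, g) \<noteq> (j, h)" using ab by auto
      then show ?thesis unfolding e by (rule cross_vec)
    qed
  qed
  moreover have "finite (lines E)" using S(1) assms by (simp add: lines_def)
  moreover have "0 \<notin> lines E" using S(2) calculation(1) by (force simp: lines_def)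
  ultimately show ?thesis unfolding arr_def by blast
qed

lemma card_lines:
  assumes "\<forall>i. finite (E i)"
  shows "card (lines E) = 2 * m + 1 + edge_number E"
proof -
  have S: "finite S" "card S = 2 * m + 1" using arr_S exps_sum[OF arr_S exps_S] by (auto simp: arr_def)
  have "card (\<Union>i. vec i ` E i) = (\<Sum>i\<in>UNIV. card (vec i ` E i))"
    by (rule card_UN_disjoint) (use assms vec_eq_iff in auto)
  also have "\<dots> = edge_number E"
    unfolding edge_number_def by (intro sum.cong refl card_image) (auto simp: inj_on_def vec_eq_iff)
  finally show ?thesis
    unfolding lines_def using S assms vec_notin_S by (subst card_Un_disjoint) auto
qed

text \<open>Outside the points of \<open>T i\<close>, the line meets at most one line of type
  \<open>i + 1\<close> and one of type \<open>i + 2\<close> in a point. The former represents the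
  point if it exists, which explains the asymmetric formula for \<open>new_points\<close>.\<close>

definition reps :: "(3 \<Rightarrow> int set) \<Rightarrow> 3 \<Rightarrow> int \<Rightarrow> ('b \<times> 'b \<times> 'b) set" where
  "reps E i e = T i \<union> vec (i + 1) ` E (i + 1) \<union> vec (i + 2) ` {h \<in> E (i + 2). - (e + h) \<notin> E (i + 1)}"

lemma card_reps:
  assumes "\<forall>i. finite (E i)"
  shows "card (reps E i e) = Suc (m + new_points E i e)"
proof -
  let ?H = "{h \<in> E (i + 2). - (e + h) \<notin> E (i + 1)}"
  have tv: "vec j g \<notin> T i" for j g using vec_notin_S T_subset by blast
  have fin: "finite (T i)" "finite (E (i + 1))" "finite ?H"
    using card_T[of i] assms by (auto intro: card_ge_0_finite)
  have "card (reps E i e) = card (T i \<union> vec (i + 1) ` E (i + 1)) + card (vec (i + 2) ` ?H)"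
    unfolding reps_def using fin by (intro card_Un_disjoint) (auto simp: vec_eq_iff tv)
  also have "card (T i \<union> vec (i + 1) ` E (i + 1)) = card (T i) + card (vec (i + 1) ` E (i + 1))"
    using fin by (intro card_Un_disjoint) (auto simp: tv)
  also have "card (vec (i + 1) ` E (i + 1)) = card (E (i + 1))"
    by (intro card_image) (auto simp: inj_on_def vec_eq_iff)
  also have "card (vec (i + 2) ` ?H) = card ?H"
    by (intro card_image) (auto simp: inj_on_def vec_eq_iff)
  finally show ?thesis by (simp add: card_T new_points_def)
qed

lemma ex_restriction:
  assumes fin: "\<forall>i. finite (E i)" and e: "e \<notin> E i"
  shows "\<exists>\<rho>. restriction y (vec i e) (lines E) (reps E i e) \<rho>"
proof -
  have arr: "arr (insert (vec i e) (lines E))"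
    using arr_lines[of "E(i := insert e (E i))"] fin by (simp add: lines_insert)
  then have "vec i e \<noteq> 0" by (auto simp: arr_def)
  then obtain \<rho> :: "('a, 'b) mpol \<Rightarrow> ('a, 'b) mpol" where \<rho>: "ring_hom_fun \<rho>" "\<forall>c. \<rho> (Const c) = Const c"
    "\<forall>f. \<rho> f = 0 \<longleftrightarrow> form (vec i e) dvd f" "\<forall>f. \<rho> (\<rho> f) = \<rho> f" "\<forall>d f. homog d f \<longrightarrow> homog d (\<rho> f)"
    using ex_linear_reduction[OF homog_form form_neq_0] by blast
  have tri2: "det3 (vec i e) (vec (i + 2) h) (vec (i + 1) g) = 0 \<longleftrightarrow> e + g + h = 0" for g h
    using triangle[of i e g h] det3_swap(1)[of "vec i e" "vec (i + 1) g" "vec (i + 2) h"] by simp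
  have "restriction y (vec i e) (lines E) (reps E i e) \<rho>"
  proof unfold_locales
    show "vec i e \<notin> lines E" using e by (simp add: vec_in_lines)
    show "reps E i e \<subseteq> lines E" using T_subset by (auto simp: reps_def lines_def)
  next
    fix b assume b: "b \<in> lines E"
    then consider "b \<in> S" | j h where "b = vec j h" "h \<in> E j" by (auto simp: lines_def)
    then show "\<exists>r\<in>reps E i e. det3 (vec i e) b r = 0"
    proof cases
      case 1
      then show ?thesis using T_cover unfolding reps_def by blast
    next
      case c: (2 j h)
      have "j \<in> {i, i + 1, i + 2}" using UNIV_three[of i] by blast
      then consider "j = i" | "j = i + 1" | "j = i + 2" "- (e + h) \<notin> E (i + 1)" | "j = i + 2" "- (e + h) \<in> E (i + 1)" by blast
      then show ?thesis
      proof cases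
        case 1
        then show ?thesis using T_parallel c unfolding reps_def by blast
      next
        case 2
        then have "b \<in> reps E i e" using c by (auto simp: reps_def)
        then show ?thesis by (intro bexI[of _ b]) simp_all
      next
        case 3
        then have "b \<in> reps E i e" using c by (auto simp: reps_def)
        then show ?thesis by (intro bexI[of _ b]) simp_all
      next
        case 4
        then have "vec (i + 1) (- (e + h)) \<in> reps E i e" by (auto simp: reps_def)
        moreover have "det3 (vec i e) b (vec (i + 1) (- (e + h))) = 0" using 4 c tri2 by simp
        ultimately show ?thesis by blast
      qed
    qed
  next
    fix r s assume r: "r \<in> reps E i e" and s: "s \<in> reps E i e" and rs: "r \<noteq> s"
    have sw: "det3 (vec i e) p q \<noteq> 0 \<longleftrightarrow> det3 (vec i e) q p \<noteq> 0" for p q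
      using det3_swap(1)[of "vec i e" p q] by simp
    have dis: "i + 1 \<noteq> i" "i + 2 \<noteq> i" by simp_all
    show "det3 (vec i e) r s \<noteq> 0"
      using r s unfolding reps_def
    proof (elim UnE imageE CollectE conjE)
      assume "r \<in> T i" "s \<in> T i"
      then show ?thesis using T_sep rs by blast
    next
      fix g assume "r \<in> T i" "s = vec (i + 1) g"
      then show ?thesis using T_vec dis by blast
    next
      fix g assume "r \<in> T i" "s = vec (i + 2) g"
      then show ?thesis using T_vec dis by blast
    next
      fix g assume "s \<in> T i" "r = vec (i + 1) g"
      then show ?thesis using T_vec dis sw by blast
    next
      fix g assume "s \<in> T i" "r = vec (i + 2) g"
      then show ?thesis using T_vec dis sw by blast
    next
      fix g h assume "r = vec (i + 1) g" "s = vec (i + 1) h"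
      moreover from this have "g \<noteq> h" using rs by blast
      ultimately show ?thesis using vec_sep dis by simp
    next
      fix g h assume "r = vec (i + 2) g" "s = vec (i + 2) h"
      moreover from this have "g \<noteq> h" using rs by blast
      ultimately show ?thesis using vec_sep dis by simp
    next
      fix g h assume g: "r = vec (i + 1) g" "g \<in> E (i + 1)" and h: "s = vec (i + 2) h" "- (e + h) \<notin> E (i + 1)"
      then have "g \<noteq> - (e + h)" by blast
      then show ?thesis unfolding g(1) h(1) triangle by linarith
    next
      fix g h assume g: "s = vec (i + 1) g" "g \<in> E (i + 1)" and h: "r = vec (i + 2) h" "- (e + h) \<notin> E (i + 1)"
      then have "g \<noteq> - (e + h)" by blast
      then show ?thesis unfolding g(1) h(1) tri2 by linarith
    qed
  qed (use \<rho> arr in auto)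
  then show ?thesis by blast
qed

lemma finite_inductively_free: "inductively_free E d1 d2 \<Longrightarrow> finite (E i)"
  by (induction rule: inductively_free.induct) auto

lemma exps_of_inductively_free: "inductively_free E d1 d2 \<Longrightarrow> exps (lines E) (d1 + m) (d2 + m)"
proof (induction rule: inductively_free.induct)
  case empty
  then show ?case using exps_S by (simp add: lines_def)
next
  case (add E d1 d2 e i)
  have fin: "\<forall>i. finite (E i)" using finite_inductively_free[OF add.hyps(1)] by blast
  obtain \<rho> where "restriction y (vec i e) (lines E) (reps E i e) \<rho>"
    using ex_restriction[OF fin add.hyps(2)] by blast
  then have "exps (insert (vec i e) (lines E)) (d1 + m) (Suc (d2 + m))"
    by (rule restriction.addition) (use add card_reps[OF fin] in auto)
  then show ?case unfolding lines_insert add_Suc .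
next
  case (swap E d1 d2)
  then show ?case using exps_swap by blast
qed

text \<open>Edges are removed one by one. When edges of two types exist, the edge with many points
  has \<open>r\<close> equal to an exponent; when only one type is left, the exponents are known and
  \<open>exps_unique\<close> identifies them.\<close>

lemma inductively_free_of_exps:
  assumes "\<forall>i. finite (E i)" "exps (lines E) D1 D2"
  shows "\<exists>d1 d2. D1 = d1 + m \<and> D2 = d2 + m \<and> inductively_free E d1 d2"
  using assms
proof (induction "edge_number E" arbitrary: E D1 D2 rule: less_induct)
  case less
  note fin = less.prems(1)
  show ?case
  proof (cases "\<exists>i. E i \<noteq> {} \<and> E (i + 1) \<noteq> {}")
    case True
    then obtain i e where e: "e \<in> E i" "edge_number E \<le> 2 * new_points E i e + 1"
      using ex_edge_many_points[of E] fin by blast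
    define E' where "E' = E(i := E i - {e})"
    have fin': "\<forall>j. finite (E' j)" using fin by (simp add: E'_def)
    have e': "e \<notin> E' i" by (simp add: E'_def)
    have E: "E = E'(i := insert e (E' i))" using e(1) by (auto simp: E'_def fun_eq_iff)
    have np: "new_points E' i e = new_points E i e" by (simp add: E'_def new_points_upd)
    have en: "edge_number E = Suc (edge_number E')" using edge_number_insert[of E' i e] e' fin' E by simp
    obtain \<rho> where \<rho>: "restriction y (vec i e) (lines E') (reps E' i e) \<rho>"
      using ex_restriction[OF fin' e'] by blast
    define r where "r = m + new_points E i e"
    have cr: "card (reps E' i e) = Suc r" using card_reps[OF fin'] by (simp add: np r_def)
    have l: "lines E = insert (vec i e) (lines E')" by (subst E) (rule lines_insert)
    have del: "(r \<le> D1 \<and> r \<le> D2 \<or> r = D1 \<or> r = D2) \<and> (r = D1 \<longrightarrow> 1 \<le> D2 \<and> exps (lines E') D1 (D2 - 1))"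
      if "exps (lines E) D1 D2" for D1 D2
      using restriction.deletion[OF \<rho> that[unfolded l] cr] .
    have main: "\<exists>d1 d2. D1 = d1 + m \<and> D2 = d2 + m \<and> inductively_free E d1 d2"
      if ex: "exps (lines E) D1 D2" and r: "r = D1" for D1 D2
    proof -
      have "1 \<le> D2" "exps (lines E') D1 (D2 - 1)" using del[OF ex] r by auto
      moreover from this obtain d1 d2 where d: "D1 = d1 + m" "D2 - 1 = d2 + m" "inductively_free E' d1 d2"
        using less.hyps[of E' D1 "D2 - 1"] en fin' by auto
      moreover have "new_points E' i e = d1" using np r d(1) by (simp add: r_def)
      ultimately have "inductively_free E d1 (Suc d2)" "D2 = Suc d2 + m"
        using inductively_free.add[OF d(3) e'] E by auto
      then show ?thesis using d(1) by blast
    qed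
    have "D1 + D2 + 1 = 2 * m + 1 + edge_number E"
      using exps_sum[OF arr_lines[OF fin] less.prems(2)] card_lines[OF fin] by simp
    \<comment> \<open>The sum gives \<open>D1 + D2 \<le> 2 * r + 1\<close>, whereas \<open>r\<close>
      below both exponents would give at least \<open>2 * r + 2\<close>.\<close>
    then have "r = D1 \<or> r = D2" using del[OF less.prems(2)] e(2) unfolding r_def by linarith
    then show ?thesis
    proof
      assume "r = D1"
      then show ?thesis using main less.prems(2) by blast
    next
      assume "r = D2"
      then obtain d1 d2 where "D2 = d1 + m" "D1 = d2 + m" "inductively_free E d1 d2"
        using main[of D2 D1] exps_swap[OF less.prems(2)] by blast
      then show ?thesis using inductively_free.swap by blast
    qed
  next
    case False
    \<comment> \<open>Any two of three cyclically ordered indices are consecutive, so at most one of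
      the three sets is nonempty.\<close>
    have "\<exists>j. E = (\<lambda>_. {})(j := E j)"
    proof (cases "\<exists>j. E j \<noteq> {}")
      case True
      then obtain j where j: "E j \<noteq> {}" by blast
      have "E (j + 1) = {}" using False j by blast
      moreover have "E (j + 2) = {}" using False j three_add_3(4)[of j] by (metis)
      ultimately have "E k = ((\<lambda>_. {})(j := E j)) k" for k using UNIV_three[of j] by (cases "k = j") auto
      then show ?thesis by blast
    next
      case False
      then show ?thesis by (intro exI[of _ 0]) (auto simp: fun_eq_iff)
    qed
    then obtain j where j: "E = (\<lambda>_. {})(j := E j)" by blast
    then have i: "inductively_free E 0 (card (E j))" using inductively_free_one_family[OF fin[rule_format], of j j] by simp
    have "exps (lines E) m (card (E j) + m)" using exps_of_inductively_free[OF i] by simp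
    then have "D1 = m \<and> D2 = card (E j) + m \<or> D1 = card (E j) + m \<and> D2 = m"
      using exps_unique[OF arr_lines[OF fin] less.prems(2)] by blast
    then show ?thesis using i inductively_free.swap[OF i] by auto
  qed
qed

lemma ex_exps_iff:
  assumes "\<forall>i. finite (E i)"
  shows "(\<exists>d1 d2. exps (lines E) d1 d2) \<longleftrightarrow> (\<exists>d1 d2. inductively_free E d1 d2)"
  using inductively_free_of_exps[OF assms] exps_of_inductively_free by blast

end

section \<open>Extracting a homogeneous basis\<close>

text \<open>The constant coefficient is the value at the origin, hence a substitution
  homomorphism.\<close>

lemma lookup_mult_0:
  fixes f g :: "('n::finite, 'k::comm_ring_1) mpol"
  shows "Poly_Mapping.lookup (f * g) 0 = Poly_Mapping.lookup f 0 * Poly_Mapping.lookup g 0"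
proof -
  have hom: "ring_hom_fun (\<lambda>x::'k. x)" by (simp add: ring_hom_fun_def)
  have "subst (\<lambda>x. x) (\<lambda>_. 0) h = Poly_Mapping.lookup h 0" for h :: "('n, 'k) mpol"
  proof (induction h rule: poly_mapping_add_induct)
    case (single k a)
    have "(\<Prod>i\<in>UNIV. (0::'k) ^ Poly_Mapping.lookup k i) = (if k = 0 then 1 else 0)"
    proof (cases "k = 0")
      case False
      then obtain i where "Poly_Mapping.lookup k i \<noteq> 0" by (metis poly_mapping_eqI lookup_zero)
      then have "(0::'k) ^ Poly_Mapping.lookup k i = 0" by (simp add: power_0_left)
      then have "(\<Prod>i\<in>UNIV. (0::'k) ^ Poly_Mapping.lookup k i) = 0" by (intro prod_zero) auto
      then show ?thesis using False by simp
    qed simp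
    then show ?case by (simp add: subst_single lookup_single when_def)
  next
    case (add f g)
    then show ?case by (simp add: subst_add[OF hom] lookup_add)
  qed
  then show ?thesis using subst_mult[OF hom, of "\<lambda>_. 0" f g] by simp
qed

lemma lookup_0_of_dvd_one:
  fixes f :: "('n::finite, 'k::field) mpol"
  assumes "f dvd 1"
  shows "Poly_Mapping.lookup f 0 \<noteq> 0"
proof -
  obtain g where "1 = f * g" using assms by (rule dvdE)
  then have "Poly_Mapping.lookup f 0 * Poly_Mapping.lookup g 0 = 1" by (metis lookup_mult_0 lookup_one_zero)
  then show ?thesis by auto
qed

lemma lookup_0_homog: "homog (Suc d) f \<Longrightarrow> Poly_Mapping.lookup f 0 = 0"
  unfolding homog_def by (metis nat.distinct(1) total_deg_0)

lemma det3_sum: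
  "det3 (\<Sum>i\<in>A. f i) v w = (\<Sum>i\<in>A. det3 (f i) v w)"
  "det3 u (\<Sum>i\<in>A. f i) w = (\<Sum>i\<in>A. det3 u (f i) w)"
  "det3 u v (\<Sum>i\<in>A. f i) = (\<Sum>i\<in>A. det3 u v (f i))"
  by (induction A rule: infinite_finite_induct; simp add: det3_add)+

lemma dvd_det3_sum:
  assumes "\<And>i j k. i \<in> B \<Longrightarrow> j \<in> B \<Longrightarrow> k \<in> B \<Longrightarrow> g dvd det3 (e i) (e j) (e k)"
  shows "g dvd det3 (\<Sum>i\<in>B. smul (p i) (e i)) (\<Sum>i\<in>B. smul (q i) (e i)) (\<Sum>i\<in>B. smul (r i) (e i))"
  unfolding det3_sum det3_smul by (intro dvd_sum dvd_mult assms)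

lemma dotC_hcomp:
  fixes v :: "('n::finite, 'k::comm_ring_1) mpol \<times> ('n, 'k) mpol \<times> ('n, 'k) mpol"
  shows "dotC a (map3 (hcomp d) v) = hcomp d (dotC a v)"
proof -
  have "hcomp d (Const c * f) = Const c * hcomp d f" for c and f :: "('n, 'k) mpol"
    using hcomp_mult[of 0 "Const c" d f] by simp
  then show ?thesis by (cases a; cases v) (simp add: hcomp_add)
qed

lemma ex_sum_hcomp3: "\<exists>m. \<forall>k\<ge>m. v = (\<Sum>d\<le>k. map3 (hcomp d) v)"
proof (cases v)
  case (fields v1 v2 v3)
  obtain m1 m2 m3 where m: "\<And>k. k \<ge> m1 \<Longrightarrow> (\<Sum>d\<le>k. hcomp d v1) = v1" "\<And>k. k \<ge> m2 \<Longrightarrow> (\<Sum>d\<le>k. hcomp d v2) = v2"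
     "\<And>k. k \<ge> m3 \<Longrightarrow> (\<Sum>d\<le>k. hcomp d v3) = v3"
    using ex_sum_hcomp by metis
  have "(\<Sum>d\<in>D. map3 (hcomp d) v) = (\<Sum>d\<in>D. hcomp d v1, \<Sum>d\<in>D. hcomp d v2, \<Sum>d\<in>D. hcomp d v3)" if "finite D" for D
    using that by induction (simp_all add: fields zero_prod_def)
  then have "v = (\<Sum>d\<le>k. map3 (hcomp d) v)" if "k \<ge> max m1 (max m2 m3)" for k
    using m that by (simp add: fields)
  then show ?thesis by blast
qed

context linear_coordinates
begin

lemma hcomp_logs:
  assumes "v \<in> logs L"
  shows "map3 (hcomp d) v \<in> logs L"
  unfolding logs_def
proof (intro CollectI ballI)
  fix a assume "a \<in> L"
  then have "form a dvd dotC a v" using assms by (simp add: logs_def)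
  then obtain h where h: "dotC a v = form a * h" by (rule dvdE)
  show "form a dvd dotC a (map3 (hcomp d) v)"
  proof (cases d)
    case 0
    then show ?thesis using hcomp_mult_less[OF homog_form, of 0 a h] by (simp add: dotC_hcomp h)
  next
    case (Suc d')
    then show ?thesis using hcomp_mult[OF homog_form, of d' a h] by (simp add: dotC_hcomp h)
  qed
qed

text \<open>The component of the determinant in degree \<open>card L\<close> is
  \<open>forms L\<close> times the nonzero constant term of \<open>f\<close>. By multilinearity it
  is a sum of determinants of homogeneous components, one of which survives. Asking only for a
  constant term admits an \<open>f\<close> that is not a unit.\<close>

lemma ex_homog_det3:
  assumes L: "arr L" and u: "u \<in> logs L" and v: "v \<in> logs L" and w: "w \<in> logs L"
    and det: "det3 u v w = forms L * f" "Poly_Mapping.lookup f 0 \<noteq> 0"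
  shows "\<exists>i j k u' v' w'. u' \<in> logs L \<and> v' \<in> logs L \<and> w' \<in> logs L \<and> homog3 i u' \<and> homog3 j v' \<and> homog3 k w' \<and>
    i + j + k = card L \<and> det3 u' v' w' \<noteq> 0"
proof -
  obtain m1 m2 m3 where m: "\<And>k. k \<ge> m1 \<Longrightarrow> u = (\<Sum>d\<le>k. map3 (hcomp d) u)" "\<And>k. k \<ge> m2 \<Longrightarrow> v = (\<Sum>d\<le>k. map3 (hcomp d) v)"
     "\<And>k. k \<ge> m3 \<Longrightarrow> w = (\<Sum>d\<le>k. map3 (hcomp d) w)"
    using ex_sum_hcomp3 by metis
  define D where "D i j k = det3 (map3 (hcomp i) u) (map3 (hcomp j) v) (map3 (hcomp k) w)" for i j k
  have h3: "homog3 d (map3 (hcomp d) x)" for d and x :: "('n, 'k) mpol \<times> ('n, 'k) mpol \<times> ('n, 'k) mpol" by (cases x) simp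
  have "det3 u v w = (\<Sum>i\<le>m1. \<Sum>j\<le>m2. \<Sum>k\<le>m3. D i j k)"
    unfolding D_def det3_sum(3)[symmetric] m(3)[OF order_refl, symmetric] det3_sum(2)[symmetric]
      m(2)[OF order_refl, symmetric] det3_sum(1)[symmetric] m(1)[OF order_refl, symmetric] ..
  then have "hcomp (card L) (det3 u v w) = (\<Sum>i\<le>m1. \<Sum>j\<le>m2. \<Sum>k\<le>m3. hcomp (card L) (D i j k))"
    by (simp add: hcomp_sum)
  moreover have "hcomp (card L) (det3 u v w) = forms L * hcomp 0 f"
    using hcomp_mult[OF homog_forms, of L 0 f] L det(1) by (simp add: arr_def)
  moreover have "hcomp 0 f \<noteq> 0"
    using det(2) lookup_hcomp[of 0 f 0] by auto
  ultimately have "(\<Sum>i\<le>m1. \<Sum>j\<le>m2. \<Sum>k\<le>m3. hcomp (card L) (D i j k)) \<noteq> 0"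
    using forms_neq_0[OF L] by (metis mult_eq_0_iff)
  then obtain i j k where "hcomp (card L) (D i j k) \<noteq> 0"
    by (metis (no_types, lifting) sum.neutral)
  moreover have "homog (i + j + k) (D i j k)" unfolding D_def by (intro homog_det3 h3)
  ultimately have "i + j + k = card L" "D i j k \<noteq> 0" using hcomp_homog by (metis, auto)
  then show ?thesis unfolding D_def using hcomp_logs u v w h3 by blast
qed

text \<open>A homogeneous basis of \<open>logs L\<close> contains a vector that may be exchanged for \<open>y\<close>.\<close>

lemma ex_exps_of_det3:
  assumes L: "arr L" "L \<noteq> {}" and u: "u \<in> logs L" and v: "v \<in> logs L" and w: "w \<in> logs L"
    and det: "det3 u v w = forms L * f" "Poly_Mapping.lookup f 0 \<noteq> 0"
  shows "\<exists>d1 d2. exps L d1 d2"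
proof -
  obtain i j k u' v' w' where uvw: "u' \<in> logs L" "v' \<in> logs L" "w' \<in> logs L" "homog3 i u'" "homog3 j v'" "homog3 k w'"
    "i + j + k = card L" "det3 u' v' w' \<noteq> 0"
    using ex_homog_det3[OF L(1) u v w det] by blast
  have hL: "homog (card L) (forms L)" using L(1) homog_forms by (simp add: arr_def)
  \<comment> \<open>Exchanging a vector of positive degree \<open>i'\<close> for \<open>y\<close>
    gives degree at most \<open>card L\<close>; if the determinant is nonzero, divisibility by
    \<open>forms L\<close> forces equality, and \<open>exps\<close> is witnessed.\<close>
  have ex: "(\<exists>d1 d2. exps L d1 d2) \<or> i' = 0 \<or> det3 y p q = 0"
    if "p \<in> logs L" "q \<in> logs L" "homog3 j' p" "homog3 k' q" "i' + j' + k' = card L" for i' j' k' p q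
  proof (rule ccontr)
    assume n: "\<not> ?thesis"
    have dv: "forms L dvd det3 y p q" using forms_dvd_det3[OF L(1) y_in_logs that(1,2)] .
    have h: "homog (1 + j' + k') (det3 y p q)" by (rule homog_det3[OF homog_y that(3,4)])
    have "\<not> 1 + j' + k' < card L" using homog_dvd_eq_0[OF hL h dv] n by blast
    then have "1 + j' + k' = card L" using n that(5) by linarith
    then obtain c where c: "det3 y p q = Const c * forms L" using homog_dvd_Const[OF hL _ dv] h by auto
    then have "c \<noteq> 0" using n by auto
    then show False using n that c unfolding exps_def exps_witness_def by blast
  qed
  show ?thesis
  proof (rule ccontr)
    assume n: "\<not> ?thesis"
    obtain a where a: "a \<in> L" using L(2) by blast
    have z: "dotC a p = 0" if "p \<in> logs L" "homog3 0 p" for p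
      using homog_dvd_eq_0[OF homog_form homog_dotC[OF that(2)], of a a] that(1) a by (simp add: logs_def)
    have dz: "p * dotC a x = 0" if "p = 0 \<or> i' = 0" "x \<in> logs L" "homog3 i' x" for p x i'
      using that z by (elim disjE) simp_all
    have "det3 y v' w' * dotC a u' = 0"
      using ex[of v' w' j k i] uvw n by (intro dz[of _ i]) blast+
    moreover have "det3 u' y w' * dotC a v' = 0"
      using ex[of u' w' i k j] uvw n det3_swap(2)[of u' y w'] by (intro dz[of _ j]) (auto simp: add_ac)
    moreover have "det3 u' v' y * dotC a w' = 0"
    proof -
      have "det3 u' v' y = det3 y u' v'" by (metis det3_swap minus_minus)
      then show ?thesis using ex[of u' v' i j k] uvw n by (intro dz[of _ k]) (auto simp: add_ac)
    qed
    \<comment> \<open>Cramer's rule for \<open>y\<close>, evaluated at \<open>a\<close>. If no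
      exchange succeeds, every summand vanishes: either its determinant is zero, or its vector has
      degree 0 and \<open>form a\<close> cannot divide its nonzero values.\<close>
    moreover have "det3 u' v' w' * form a = det3 y v' w' * dotC a u' + det3 u' y w' * dotC a v' + det3 u' v' y * dotC a w'"
      using arg_cong[OF det3_Cramer[of u' v' w' y], of "dotC a"] by (simp add: dotC_add dotC_smul)
    ultimately have "det3 u' v' w' * form a = 0" by (simp only: add_0_left)
    moreover have "a \<noteq> 0" using a L(1) unfolding arr_def by metis
    then have "form a \<noteq> 0" by (rule form_neq_0)
    ultimately show False using uvw(8) by simp
  qed
qed

text \<open>The ideal of all determinants of logarithmic vectors contains \<open>forms L * (forms (L - {a}))\<^sup>2\<close>
  for every \<open>a\<close>, and these polynomials have no common factor besides \<open>forms L\<close>.\<close>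

lemma dvd_one_of_dvd_det3:
  assumes L: "arr L" "L \<noteq> {}"
    and dvd: "\<And>u v w. u \<in> logs L \<Longrightarrow> v \<in> logs L \<Longrightarrow> w \<in> logs L \<Longrightarrow> forms L * f dvd det3 u v w"
  shows "f dvd 1"
proof -
  have fin: "finite L" and nz: "\<And>a. a \<in> L \<Longrightarrow> a \<noteq> 0" using L(1) by (auto simp: arr_def)
  have dv: "f dvd (\<Prod>b\<in>L - {a}. form b ^ 2)" if a: "a \<in> L" for a
  proof -
    \<comment> \<open>\<open>cross a b\<close> and \<open>cross a c\<close> span the vectors killed
      by \<open>a\<close>. Multiplied by the forms other than \<open>a\<close> they are logarithmic;
      a third constant vector outside their span needs the full product
      \<open>forms L\<close>.\<close>
    obtain b c where bc: "det3 a b c \<noteq> 0" using ex_det3_neq_0[OF nz[OF a]] by blast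
    obtain a1 a2 a3 where ae: "a = (a1, a2, a3)" by (metis prod_cases3)
    have "a1 \<noteq> 0 \<or> a2 \<noteq> 0 \<or> a3 \<noteq> 0" using nz[OF a] by (auto simp: ae zero_prod_def)
    moreover have "det3 (cross a b) (cross a c) (1, 0, 0) = a1 * det3 a b c"
      "det3 (cross a b) (cross a c) (0, 1, 0) = a2 * det3 a b c"
      "det3 (cross a b) (cross a c) (0, 0, 1) = a3 * det3 a b c"
      unfolding ae by (cases b; cases c; simp add: algebra_simps)+
    ultimately obtain x where x: "det3 (cross a b) (cross a c) x \<noteq> 0" using bc by (metis mult_eq_0_iff)
    define P where "P = forms (L - {a})"
    have Q: "forms L = form a * P" unfolding P_def using fin a by (simp add: prod.remove)
    have cr: "dotC a (map3 Const (cross a d)) = 0" for d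
      by (cases a; cases d) (simp add: Const_simps algebra_simps)
    have 1: "smul P (map3 Const (cross a d)) \<in> logs L" for d
      unfolding logs_def
    proof (intro CollectI ballI)
      fix b assume b: "b \<in> L"
      show "form b dvd dotC b (smul P (map3 Const (cross a d)))"
      proof (cases "b = a")
        case True
        then show ?thesis by (simp add: dotC_smul cr)
      next
        case False
        then have "form b dvd P" unfolding P_def using b fin by (intro dvd_prodI) auto
        then show ?thesis by (simp add: dotC_smul)
      qed
    qed
    have 2: "smul (forms L) (map3 Const x) \<in> logs L"
      unfolding logs_def using fin by (auto simp: dotC_smul intro!: dvd_mult2 dvd_prodI)
    have "det3 (map3 Const p) (map3 Const q) (map3 Const r) = (Const (det3 p q r) :: ('n, 'k) mpol)" for p q r :: "'k \<times> 'k \<times> 'k"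
      by (cases p; cases q; cases r) (simp add: Const_simps)
    then have "forms L * f dvd Const (det3 (cross a b) (cross a c) x) * (forms L * P ^ 2)"
      using dvd[OF 1[of b] 1[of c] 2] by (simp add: det3_smul power2_eq_square mult_ac)
    then have "forms L * f dvd forms L * P ^ 2" using x by (rule dvd_Const_mult_cancel)
    then have "f dvd P ^ 2" using forms_neq_0[OF L(1)] by simp
    then show ?thesis by (simp add: P_def prod_power_distrib)
  qed
  have nd: "\<not> form b dvd f" if b: "b \<in> L" for b
  proof
    assume "form b dvd f"
    from dvd_trans[OF this dv[OF b]] have "form b dvd (\<Prod>c\<in>L - {b}. form c ^ 2) * 1" by simp
    moreover have "rel_prime (form b) (\<Prod>c\<in>L - {b}. form c ^ 2)"
      unfolding power2_eq_square using L(1) b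
      by (intro rel_prime_prod_right rel_prime_mult_right rel_prime_forms) (auto simp: arr_def)
    ultimately have "form b dvd 1" unfolding rel_prime_def by blast
    then show False using prime_form[OF nz[OF b]] by (simp add: prime_elem_def)
  qed
  obtain a where a: "a \<in> L" using L(2) by blast
  have "f dvd 1 * (\<Prod>b\<in>L - {a}. form b ^ 2)" using dv[OF a] by simp
  moreover have "finite (L - {a})" using fin by simp
  ultimately show ?thesis
    by (intro is_unit_of_dvd_prod_primes[of "L - {a}" form f 1 "\<lambda>_. 2"]) (simp_all add: nd nz prime_form)
qed

end

section \<open>Derivations\<close>

lemma derivationD:
  assumes "\<theta> \<in> derivations"
  shows "\<theta> (f + g) = \<theta> f + \<theta> g" "\<theta> (Const c * f) = Const c * \<theta> f" "\<theta> (f * g) = f * \<theta> g + g * \<theta> f"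
    "\<theta> (Const c) = 0"
proof -
  show 1: "\<theta> (f + g) = \<theta> f + \<theta> g" "\<theta> (Const c * f) = Const c * \<theta> f" "\<theta> (f * g) = f * \<theta> g + g * \<theta> f" for f g c
    using assms by (auto simp: derivations_def)
  have "\<theta> 1 = 0" using 1(3)[of 1 1] by simp
  then show "\<theta> (Const c) = 0" using 1(2)[of c 1] by simp
qed

lemma derivation_dotC: "\<theta> \<in> derivations \<Longrightarrow> \<theta> (dotC a u) = dotC a (map3 \<theta> u)"
  by (cases a; cases u) (simp add: derivationD)

lemma derivation_eqI:
  fixes \<theta> \<eta> :: "('n::finite, 'k::field) mpol \<Rightarrow> ('n, 'k) mpol"
  assumes "\<theta> \<in> derivations" "\<eta> \<in> derivations" "\<And>i. \<theta> (Var i) = \<eta> (Var i)"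
  shows "\<theta> = \<eta>"
proof
  fix f
  show "\<theta> f = \<eta> f"
    by (induction f rule: mpol_induct) (simp_all add: derivationD[OF assms(1)] derivationD[OF assms(2)] assms(3))
qed

text \<open>The substitution \<open>x\<^sub>i \<mapsto> x\<^sub>i + v\<^sub>i \<epsilon>\<close> is the derivation with values \<open>v\<^sub>i\<close> to first order in \<open>\<epsilon>\<close>.\<close>

definition vector_derivation :: "('n \<Rightarrow> ('n, 'k) mpol) \<Rightarrow> ('n::finite, 'k::field) mpol \<Rightarrow> ('n, 'k) mpol" where
  "vector_derivation v f = coeff (subst (\<lambda>c. [:Const c:]) (\<lambda>i. [:Var i, v i:]) f) 1"

lemma
  fixes v :: "'n::finite \<Rightarrow> ('n, 'k::field) mpol"
  shows vector_derivation: "vector_derivation v \<in> derivations"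
    and vector_derivation_Var: "vector_derivation v (Var i) = v i"
proof -
  let ?s = "subst (\<lambda>c::'k. [:Const c:]) (\<lambda>i. [:Var i, v i:])"
  have hom: "ring_hom_fun (\<lambda>c::'k. [:Const c :: ('n, 'k) mpol:])"
    by (simp add: ring_hom_fun_def Const_simps one_pCons)
  note s = subst_add[OF hom] subst_mult[OF hom] subst_Const[OF hom] subst_Var[OF hom]
  have 0: "coeff (?s f) 0 = f" for f
    by (induction f rule: mpol_induct) (simp_all add: s coeff_mult)
  have m: "coeff (?s (f * g)) 1 = f * coeff (?s g) 1 + g * coeff (?s f) 1" for f g
    by (simp add: s coeff_mult 0 mult.commute)
  show "vector_derivation v \<in> derivations"
    unfolding derivations_def vector_derivation_def using m by (auto simp: s m coeff_mult)
  show "vector_derivation v (Var i) = v i"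
    unfolding vector_derivation_def by (simp add: s)
qed

lemma derivations_subspace: "maps.subspace derivations"
  by (auto simp: maps.subspace_def derivations_def mscale_def algebra_simps)

lemma linear_form_smul: "linear_form (\<chi> i. c * b $ i) = Const c * linear_form b"
  by (simp add: linear_form_def Const_mult sum_distrib_left mult.assoc)

lemma defining_form_unique:
  fixes \<alpha> \<beta> :: "('n::finite, 'k::field) mpol"
  assumes "defining_form \<alpha> H" "defining_form \<beta> H"
  shows "\<exists>c. c \<noteq> 0 \<and> \<alpha> = Const c * \<beta>"
proof -
  obtain a b where a: "a \<noteq> 0" "\<alpha> = linear_form a" "H = {x. (\<Sum>i\<in>UNIV. a $ i * x $ i) = 0}"
    and b: "b \<noteq> 0" "\<beta> = linear_form b" "H = {x. (\<Sum>i\<in>UNIV. b $ i * x $ i) = 0}"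
    using assms unfolding defining_form_def by blast
  obtain i where i: "b $ i \<noteq> 0" using b(1) by (auto simp: vec_eq_iff)
  \<comment> \<open>The test vector with entries \<open>b $ i\<close> at \<open>j\<close> and
    \<open>- b $ j\<close> at \<open>i\<close> lies on the hyperplane of \<open>b\<close>;
    evaluating \<open>a\<close> on it gives proportionality.\<close>
  have ev: "(\<Sum>l\<in>UNIV. d $ l * (\<chi> l. (if l = j then b $ i else 0) - (if l = i then b $ j else 0)) $ l) = d $ j * b $ i - d $ i * b $ j"
    for d :: "'k ^ 'n" and j
    by (simp add: right_diff_distrib sum_subtractf if_distrib[of "\<lambda>x. _ * x"] cong: if_cong)
  have "a $ j * b $ i = a $ i * b $ j" for j
  proof -
    let ?x = "(\<chi> l. (if l = j then b $ i else 0) - (if l = i then b $ j else 0)) :: 'k ^ 'n"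
    have "?x \<in> H" unfolding b(3) using ev[of b j] by (simp add: mult.commute)
    then show ?thesis unfolding a(3) using ev[of a j] by simp
  qed
  then have "a $ j = a $ i / b $ i * b $ j" for j using i by (simp add: field_simps)
  then have e: "a = (\<chi> j. a $ i / b $ i * b $ j)" unfolding vec_eq_iff vec_lambda_beta by blast
  then have "\<alpha> = Const (a $ i / b $ i) * \<beta>" using linear_form_smul a(2) b(2) by metis
  moreover have "a $ i / b $ i \<noteq> 0"
  proof
    assume "a $ i / b $ i = 0"
    then have "a = 0" using i by (subst e) (auto simp: vec_eq_iff)
    then show False using a(1) by blast
  qed
  ultimately show ?thesis by blast
qed

text \<open>Counting a basis through the trace of multiplication by \<open>Q\<close>: in characteristic 0 no
  determinants are needed.\<close>

lemma card_derivation_basis: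
  fixes D :: "(('n::{finite,linorder}, 'k::field_char_0) mpol \<Rightarrow> ('n, 'k) mpol) set"
  assumes B: "maps.independent B" "maps.span B = D" and der: "D \<subseteq> derivations" and Q: "Q \<noteq> 0"
    and QD: "\<And>\<theta>. \<theta> \<in> derivations \<Longrightarrow> mscale Q \<theta> \<in> D"
  shows "finite B" "card B = CARD('n)"
proof -
  define r where "r = maps.representation B"
  define \<delta> where "\<delta> i = vector_derivation (\<lambda>j. if j = i then 1 else (0 :: ('n, 'k) mpol))" for i
  have \<delta>: "\<delta> i \<in> derivations" "\<delta> i (Var j) = (if j = i then 1 else 0)" for i j
    by (simp_all add: \<delta>_def vector_derivation vector_derivation_Var)
  have ids: "\<theta> = (\<Sum>i\<in>UNIV. mscale (\<theta> (Var i)) (\<delta> i))" if "\<theta> \<in> derivations" for \<theta>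
  proof (rule derivation_eqI[OF that])
    show "(\<Sum>i\<in>UNIV. mscale (\<theta> (Var i)) (\<delta> i)) \<in> derivations"
      by (intro maps.subspace_sum[OF derivations_subspace] maps.subspace_scale[OF derivations_subspace] \<delta>)
    have "(\<Sum>i\<in>A. mscale (\<theta> (Var i)) (\<delta> i)) (Var j) = (\<Sum>i\<in>A. \<theta> (Var i) * \<delta> i (Var j))" if "finite A" for A j
      using that by induction (simp_all add: mscale_def)
    then show "\<theta> (Var j) = (\<Sum>i\<in>UNIV. mscale (\<theta> (Var i)) (\<delta> i)) (Var j)" for j
      by (simp add: \<delta> if_distrib[of "\<lambda>x. _ * x"] cong: if_cong)
  qed
  have sub: "maps.subspace D" using B(2) maps.subspace_span by metis
  have Bder: "b \<in> derivations" if "b \<in> B" for b using that B(2) der maps.span_base by blast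
  \<comment> \<open>The coefficient of \<open>b\<close> in \<open>Q\<close> times \<open>b\<close>,
    computed by expanding \<open>b\<close> in partial derivatives. As \<open>Q\<close> is nonzero,
    \<open>b\<close> occurs in one of finitely many expansions, which makes \<open>B\<close>
    finite.\<close>
  have tr: "Q = (\<Sum>i\<in>UNIV. b (Var i) * r (mscale Q (\<delta> i)) b)" if b: "b \<in> B" for b
  proof -
    have sp: "mscale Q (\<delta> i) \<in> maps.span B" for i using QD \<delta> B(2) by blast
    have "mscale Q b = (\<Sum>i\<in>UNIV. mscale (b (Var i)) (mscale Q (\<delta> i)))"
      using arg_cong[OF ids[OF Bder[OF b]], of "mscale Q"]
      by (simp add: maps.scale_sum_right mult.commute)
    then have "r (mscale Q b) b = r (\<Sum>i\<in>UNIV. mscale (b (Var i)) (mscale Q (\<delta> i))) b" by simp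
    also have "\<dots> = (\<Sum>i\<in>UNIV. r (mscale (b (Var i)) (mscale Q (\<delta> i))) b)"
      unfolding r_def by (subst maps.representation_sum[OF B(1)]) (rule maps.span_scale[OF sp], simp)
    also have "\<dots> = (\<Sum>i\<in>UNIV. b (Var i) * r (mscale Q (\<delta> i)) b)"
      unfolding r_def by (simp only: maps.representation_scale[OF B(1) sp])
    finally show ?thesis
      unfolding r_def maps.representation_scale[OF B(1) maps.span_base[OF b]] maps.representation_basis[OF B(1) b]
      by simp
  qed
  have fr: "finite {b. r x b \<noteq> 0}" for x unfolding r_def by (rule maps.finite_representation)
  have "B \<subseteq> (\<Union>i. {b. r (mscale Q (\<delta> i)) b \<noteq> 0})"
  proof
    fix b assume b: "b \<in> B"
    have "(\<Sum>i\<in>UNIV. b (Var i) * r (mscale Q (\<delta> i)) b) \<noteq> 0" unfolding tr[OF b, symmetric] by (rule Q)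
    then obtain i where "b (Var i) * r (mscale Q (\<delta> i)) b \<noteq> 0" by (rule sum.not_neutral_contains_not_neutral)
    then have "r (mscale Q (\<delta> i)) b \<noteq> 0" by (intro notI) simp
    then show "b \<in> (\<Union>i. {b. r (mscale Q (\<delta> i)) b \<noteq> 0})" by blast
  qed
  then show fin: "finite B" by (rule finite_subset) (simp add: fr)
  have rep: "(\<Sum>b\<in>B. r (mscale Q (\<delta> i)) b * b (Var i)) = Q" for i
  proof -
    have "(\<Sum>b\<in>B. mscale (r (mscale Q (\<delta> i)) b) b) = mscale Q (\<delta> i)"
      unfolding r_def using QD[OF \<delta>(1)[of i]] B(2) by (intro maps.sum_representation_eq[OF B(1)] fin) auto
    then have 1: "(\<Sum>b\<in>B. mscale (r (mscale Q (\<delta> i)) b) b) (Var i) = mscale Q (\<delta> i) (Var i)" by simp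
    have 2: "mscale Q (\<delta> i) (Var i) = Q" by (simp add: mscale_def \<delta>)
    have 3: "(\<Sum>b\<in>A. mscale (f b) b) (Var i) = (\<Sum>b\<in>A. f b * b (Var i))" if "finite A" for A f
      using that by induction (simp_all add: mscale_def)
    show ?thesis using 1 unfolding 2 3[OF fin] .
  qed
  \<comment> \<open>The trace summed in both orders: each basis element contributes
    \<open>Q\<close>, and so does each variable. Characteristic 0 allows the counts to be
    compared.\<close>
  have "of_nat (card B) * Q = (\<Sum>b\<in>B. \<Sum>i\<in>UNIV. b (Var i) * r (mscale Q (\<delta> i)) b)"
    by (simp add: tr[symmetric])
  also have "\<dots> = (\<Sum>i\<in>UNIV. \<Sum>b\<in>B. r (mscale Q (\<delta> i)) b * b (Var i))"
    by (subst sum.swap) (simp add: mult.commute)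
  also have "\<dots> = of_nat CARD('n) * Q" by (simp add: rep)
  finally show "card B = CARD('n)" using Q by simp
qed

section \<open>Free arrangements and homogeneous bases\<close>

lemma map3_mscale: "map3 (mscale f \<theta>) u = smul f (map3 \<theta> u)"
  by (cases u) (simp add: mscale_def)

lemma map3_plus: "map3 (\<theta> + \<eta>) u = map3 \<theta> u + map3 \<eta> u"
  by (cases u) simp

lemma map3_zero: "map3 (0 :: 'c \<Rightarrow> 'd::zero) u = 0"
  by (cases u) (simp add: zero_prod_def)

lemma map3_sum_mscale: "finite B \<Longrightarrow> map3 (\<Sum>b\<in>B. mscale (f b) b) u = (\<Sum>b\<in>B. smul (f b) (map3 b u))"
  by (induction B rule: finite_induct) (simp_all only: sum.empty sum.insert map3_zero map3_plus map3_mscale simp_thms)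

lemma sum_mscale_apply: "finite B \<Longrightarrow> (\<Sum>b\<in>B. mscale (f b) b) x = (\<Sum>b\<in>B. f b * b x)"
  by (induction B rule: finite_induct) (simp_all add: mscale_def)

lemma det3_rotate: "det3 v w u = det3 u v w" "det3 w u v = det3 u v w" "det3 w v u = - det3 u v w"
  by (cases u; cases v; cases w; simp add: algebra_simps)+

lemma dvd_det3_perm:
  assumes "g dvd det3 u v w"
  shows "g dvd det3 u w v \<and> g dvd det3 v u w \<and> g dvd det3 v w u \<and> g dvd det3 w u v \<and> g dvd det3 w v u"
  unfolding det3_swap(1)[of u w v] det3_swap(2)[of v u w] det3_rotate(1)[of v w u] det3_rotate(2)[of w u v] det3_rotate(3)[of w v u]
  using assms by simp

text \<open>In essential coordinates on three-space the derivation \<open>\<kappa>\<close> vanishes; for the cone it spans the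
  derivations along the line in which all hyperplanes meet.\<close>

locale arrangement_coordinates = linear_coordinates y
  for y :: "('n::{finite,linorder}, 'k::field_char_0) mpol \<times> ('n, 'k) mpol \<times> ('n, 'k) mpol" +
  fixes A :: "('k, 'n) vec set set" and L :: "('k \<times> 'k \<times> 'k) set" and \<kappa> :: "('n, 'k) mpol \<Rightarrow> ('n, 'k) mpol"
  assumes arr_L: "arr L" and L_nonempty: "L \<noteq> {}"
    and form_of_hyperplane: "H \<in> A \<Longrightarrow> \<exists>a\<in>L. defining_form (form a) H"
    and hyperplane_of_form: "a \<in> L \<Longrightarrow> \<exists>H\<in>A. defining_form (form a) H"
    and lift: "\<exists>\<theta>\<in>derivations. map3 \<theta> y = v"
    and kappa: "\<kappa> \<in> derivations" "map3 \<kappa> y = 0"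
    and kernel: "\<theta> \<in> derivations \<Longrightarrow> map3 \<theta> y = 0 \<Longrightarrow> \<exists>g. \<theta> = mscale g \<kappa>"
    and dim: "\<kappa> = 0 \<and> CARD('n) = 3 \<or> CARD('n) = 4 \<and> (\<exists>i. Poly_Mapping.lookup (\<kappa> (Var i)) 0 \<noteq> 0)"
begin

lemma log_derivations_iff: "\<theta> \<in> log_derivations A \<longleftrightarrow> \<theta> \<in> derivations \<and> map3 \<theta> y \<in> logs L"
proof
  assume t: "\<theta> \<in> log_derivations A"
  then have d: "\<theta> \<in> derivations" by (simp add: log_derivations_def)
  have "form a dvd dotC a (map3 \<theta> y)" if a: "a \<in> L" for a
  proof -
    obtain H where "H \<in> A" "defining_form (form a) H" using hyperplane_of_form[OF a] by blast
    then have "form a dvd \<theta> (form a)" using t by (auto simp: log_derivations_def)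
    then show ?thesis by (simp add: derivation_dotC[OF d])
  qed
  then show "\<theta> \<in> derivations \<and> map3 \<theta> y \<in> logs L" using d by (simp add: logs_def)
next
  assume t: "\<theta> \<in> derivations \<and> map3 \<theta> y \<in> logs L"
  then have d: "\<theta> \<in> derivations" by blast
  have "\<alpha> dvd \<theta> \<alpha>" if H: "H \<in> A" "defining_form \<alpha> H" for H \<alpha>
  proof -
    obtain a where a: "a \<in> L" "defining_form (form a) H" using form_of_hyperplane[OF H(1)] by blast
    obtain c where c: "\<alpha> = Const c * form a" using defining_form_unique[OF H(2) a(2)] by blast
    have "form a dvd \<theta> (form a)" using t a(1) by (simp add: derivation_dotC[OF d] logs_def)
    then show ?thesis unfolding c derivationD(2)[OF d] by (rule mult_dvd_mono[OF dvd_refl])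
  qed
  then show "\<theta> \<in> log_derivations A" using d by (simp add: log_derivations_def)
qed

text \<open>All determinants of logarithmic vectors come from those of the basis, so a common factor
  of the latter beyond \<open>forms L\<close> is a unit. In dimension three there is one determinant
  up to sign; in dimension four the relation given by \<open>\<kappa>\<close> ties the four minors
  together.\<close>

lemma exps_of_free:
  assumes "free_arrangement A"
  shows "\<exists>d1 d2. exps L d1 d2"
proof -
  obtain B where B: "B \<subseteq> log_derivations A" "maps.independent B" "maps.span B = log_derivations A"
    using assms unfolding free_arrangement_def by blast
  have der: "log_derivations A \<subseteq> derivations" using log_derivations_iff by blast
  have fL: "finite L" using arr_L by (simp add: arr_def)
  have form_L: "prime_elem (form a)" if "a \<in> L" for a
  proof (rule prime_form)
    show "a \<noteq> 0" using arr_L that unfolding arr_def by metis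
  qed
  have QD: "mscale (forms L) \<theta> \<in> log_derivations A" if d: "\<theta> \<in> derivations" for \<theta>
    unfolding log_derivations_iff map3_mscale logs_def
  proof (intro conjI CollectI ballI)
    show "mscale (forms L) \<theta> \<in> derivations" by (rule maps.subspace_scale[OF derivations_subspace d])
    show "form a dvd dotC a (smul (forms L) (map3 \<theta> y))" if "a \<in> L" for a
      unfolding dotC_smul using fL that by (intro dvd_mult2 dvd_prodI)
  qed
  have fin: "finite B" and card: "card B = CARD('n)"
    using card_derivation_basis[OF B(2,3) der forms_neq_0[OF arr_L] QD] by blast+
  define e where "e b = map3 b y" for b :: "('n, 'k) mpol \<Rightarrow> ('n, 'k) mpol"
  have eL: "e b \<in> logs L" if "b \<in> B" for b using B(1) that log_derivations_iff unfolding e_def by blast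
  have rep: "\<exists>f. \<theta> = (\<Sum>b\<in>B. mscale (f b) b)" if "\<theta> \<in> log_derivations A" for \<theta>
    using that unfolding B(3)[symmetric] maps.span_finite[OF fin] by blast
  have gen: "\<exists>f. v = (\<Sum>b\<in>B. smul (f b) (e b))" if v: "v \<in> logs L" for v
  proof -
    obtain \<theta> where t: "\<theta> \<in> derivations" "map3 \<theta> y = v" using lift by blast
    then have "\<theta> \<in> log_derivations A" using v log_derivations_iff by blast
    then obtain f where "\<theta> = (\<Sum>b\<in>B. mscale (f b) b)" using rep by blast
    then have "v = map3 (\<Sum>b\<in>B. mscale (f b) b) y" using t(2) by blast
    then show ?thesis unfolding map3_sum_mscale[OF fin] e_def by blast
  qed
  have unit: "f dvd 1"
    if f: "\<And>i j k. i \<in> B \<Longrightarrow> j \<in> B \<Longrightarrow> k \<in> B \<Longrightarrow> forms L * f dvd det3 (e i) (e j) (e k)" for f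
  proof (rule dvd_one_of_dvd_det3[OF arr_L L_nonempty])
    fix u v w assume uvw: "u \<in> logs L" "v \<in> logs L" "w \<in> logs L"
    obtain p where p: "u = (\<Sum>b\<in>B. smul (p b) (e b))" using gen[OF uvw(1)] by (rule exE)
    obtain q where q: "v = (\<Sum>b\<in>B. smul (q b) (e b))" using gen[OF uvw(2)] by (rule exE)
    obtain r where r: "w = (\<Sum>b\<in>B. smul (r b) (e b))" using gen[OF uvw(3)] by (rule exE)
    show "forms L * f dvd det3 u v w" unfolding p q r by (rule dvd_det3_sum) (rule f)
  qed
  show ?thesis
    using dim
  proof (elim disjE conjE)
    assume "CARD('n) = 3"
    then obtain p q r where pqr: "B = {p, q, r}" using card card_3_iff by metis
    have m: "e p \<in> logs L" "e q \<in> logs L" "e r \<in> logs L" using eL pqr by auto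
    then obtain f where f: "det3 (e p) (e q) (e r) = forms L * f"
      using forms_dvd_det3[OF arr_L m] by (auto elim!: dvdE)
    have "forms L * f dvd det3 (e p) (e q) (e r)" by (simp add: f)
    note this dvd_det3_perm[OF this]
    then have "f dvd 1" by (intro unit) (auto simp: pqr)
    then show ?thesis using ex_exps_of_det3[OF arr_L L_nonempty m f] lookup_0_of_dvd_one by blast
  next
    assume c4: "CARD('n) = 4" and "\<exists>i. Poly_Mapping.lookup (\<kappa> (Var i)) 0 \<noteq> 0"
    then obtain i where i: "Poly_Mapping.lookup (\<kappa> (Var i)) 0 \<noteq> 0" by blast
    \<comment> \<open>\<open>\<kappa>\<close> has a value with nonzero constant term, so some
      coefficient \<open>w b\<close> does too. This \<open>b\<close> is dropped, and the other three
      vectors will carry the determinant.\<close>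
    have "\<kappa> \<in> log_derivations A" unfolding log_derivations_iff using kappa by (simp add: logs_def)
    then obtain w where w: "\<kappa> = (\<Sum>b\<in>B. mscale (w b) b)" using rep by blast
    have "Poly_Mapping.lookup (\<kappa> (Var i)) 0 = (\<Sum>b\<in>B. Poly_Mapping.lookup (w b) 0 * Poly_Mapping.lookup (b (Var i)) 0)"
      by (subst w) (simp add: sum_mscale_apply[OF fin] lookup_sum lookup_mult_0)
    then obtain b where b: "b \<in> B" "Poly_Mapping.lookup (w b) 0 \<noteq> 0"
      using i by (metis (no_types, lifting) mult_zero_left sum.neutral)
    have "card (B - {b}) = 3" using card c4 b(1) by simp
    then obtain p q r where pqr: "B - {b} = {p, q, r}" "p \<noteq> q" "q \<noteq> r" "p \<noteq> r" using card_3_iff by metis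
    then have Beq: "B = {b, p, q, r}" and dist: "b \<noteq> p" "b \<noteq> q" "b \<noteq> r" using b(1) by auto
    define d1 d2 d3 d4 where d: "d1 = det3 (e p) (e q) (e r)" "d2 = det3 (e b) (e q) (e r)"
      "d3 = det3 (e p) (e b) (e r)" "d4 = det3 (e p) (e q) (e b)"
    \<comment> \<open>Cramer's relation among the four images. The corresponding derivation kills
      \<open>y\<close>, hence is \<open>g\<close> times \<open>\<kappa>\<close>, and by independence
      each signed minor is \<open>g\<close> times a coefficient of \<open>\<kappa>\<close>. So
      \<open>g\<close> divides all minors, and \<open>forms L\<close> divides \<open>g\<close>
      because \<open>w b\<close> is coprime to every form.\<close>
    define h where "h x = (if x = b then d1 else if x = p then - d2 else if x = q then - d3 else - d4)" for x
    have h: "h b = d1" "h p = - d2" "h q = - d3" "h r = - d4" using dist pqr by (simp_all add: h_def)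
    define \<theta> where "\<theta> = (\<Sum>b\<in>B. mscale (h b) b)"
    have "\<theta> \<in> derivations" unfolding \<theta>_def using B(1) der
      by (intro maps.subspace_sum[OF derivations_subspace] maps.subspace_scale[OF derivations_subspace]) blast
    moreover have "map3 \<theta> y = 0"
    proof -
      have "map3 \<theta> y = (\<Sum>x\<in>B. smul (h x) (e x))"
        unfolding \<theta>_def map3_sum_mscale[OF fin] e_def ..
      also have "\<dots> = smul d1 (e b) + (smul (- d2) (e p) + (smul (- d3) (e q) + smul (- d4) (e r)))"
        unfolding Beq using dist pqr(2-4) by (simp add: h)
      also have "\<dots> = 0"
      proof -
        have neg: "smul (- c) u = - smul c u" for c and u :: "('n, 'k) mpol \<times> ('n, 'k) mpol \<times> ('n, 'k) mpol" by (cases u) simp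
        show ?thesis unfolding d(1) det3_Cramer[of "e p" "e q" "e r" "e b"] unfolding d neg by simp
      qed
      finally show ?thesis .
    qed
    ultimately obtain g where g: "\<theta> = mscale g \<kappa>" using kernel by blast
    have "(\<Sum>x\<in>B. mscale (h x - g * w x) x) = 0"
    proof -
      have "(\<Sum>x\<in>B. mscale (h x - g * w x) x) = \<theta> - mscale g \<kappa>"
        unfolding \<theta>_def by (subst w) (simp add: maps.scale_left_diff_distrib sum_subtractf maps.scale_sum_right)
      then show ?thesis using g by simp
    qed
    then have hg: "h x = g * w x" if "x \<in> B" for x
      using maps.independentD[OF B(2) fin subset_refl _ that, of "\<lambda>x. h x - g * w x"] by simp
    have gd: "g dvd d1" "g dvd d2" "g dvd d3" "g dvd d4"
      using hg[of b] hg[of p] hg[of q] hg[of r] h Beq by (metis dvd_triv_left dvd_minus_iff insertCI)+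
    note dv = gd[unfolded d]
    have all: "g dvd det3 (e x) (e y') (e z)" if "x \<in> B" "y' \<in> B" "z \<in> B" for x y' z
      using that dv dv[THEN dvd_det3_perm] unfolding Beq by (elim insertE emptyE) simp_all
    have m: "e b \<in> logs L" "e p \<in> logs L" "e q \<in> logs L" "e r \<in> logs L" using eL Beq by auto
    have "forms L dvd d1" unfolding d by (rule forms_dvd_det3[OF arr_L m(2-4)])
    then have Qd: "forms L dvd w b * g" using hg[OF b(1)] h(1) by (simp add: mult.commute)
    have "forms L dvd g"
    proof (rule prod_dvd_of_rel_prime[OF fL])
      fix a assume a: "a \<in> L"
      have "\<not> form a dvd w b"
      proof
        assume "form a dvd w b"
        then obtain k where "w b = form a * k" by (rule dvdE)
        then show False using b(2) lookup_0_homog[of 0 "form a"] homog_form by (simp add: lookup_mult_0)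
      qed
      then have "rel_prime (form a) (w b)" using form_L[OF a] rel_prime_prime_elem by blast
      moreover have "form a dvd w b * g" using dvd_trans[OF dvd_prodI[OF fL a] Qd] .
      ultimately show "form a dvd g" unfolding rel_prime_def by blast
      fix a' assume "a' \<in> L" "a \<noteq> a'"
      then show "rel_prime (form a) (form a')" using arr_L a by (intro rel_prime_forms) (simp add: arr_def)
    qed
    then obtain f where f: "g = forms L * f" by (rule dvdE)
    have "f dvd 1" by (rule unit) (use all f in blast)
    then have "Poly_Mapping.lookup (f * w b) 0 \<noteq> 0" using b(2) lookup_0_of_dvd_one by (simp add: lookup_mult_0)
    moreover have "det3 (e p) (e q) (e r) = forms L * (f * w b)"
      using hg[OF b(1)] h(1) f by (simp add: d mult.assoc)
    ultimately show ?thesis using ex_exps_of_det3[OF arr_L L_nonempty m(2-4)] by blast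
  qed
qed

lemma free_of_exps:
  assumes "exps L d1 d2"
  shows "free_arrangement A"
proof -
  obtain u v where w: "exps_witness L d1 d2 u v" using assms unfolding exps_def by blast
  then obtain c where c: "u \<in> logs L" "v \<in> logs L" "c \<noteq> 0" "det3 y u v = Const c * forms L"
    unfolding exps_witness_def by blast
  have det: "det3 y u v \<noteq> 0" using c forms_neq_0[OF arr_L] by simp
  obtain \<theta>0 \<theta>1 \<theta>2 where t: "\<theta>0 \<in> derivations" "map3 \<theta>0 y = y" "\<theta>1 \<in> derivations" "map3 \<theta>1 y = u"
    "\<theta>2 \<in> derivations" "map3 \<theta>2 y = v"
    using lift by metis
  have ne: "\<theta>0 \<noteq> \<theta>1" "\<theta>0 \<noteq> \<theta>2" "\<theta>1 \<noteq> \<theta>2" "\<theta>0 \<noteq> \<kappa>" "\<theta>1 \<noteq> \<kappa>" "\<theta>2 \<noteq> \<kappa>"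
    using det t kappa by auto
  have indep: "f = 0 \<and> g = 0 \<and> h = 0" if z: "smul f y + smul g u + smul h v = 0" for f g h
  proof -
    have "det3 (smul f y + smul g u + smul h v) u v = f * det3 y u v"
      "det3 y (smul f y + smul g u + smul h v) v = g * det3 y u v"
      "det3 y u (smul f y + smul g u + smul h v) = h * det3 y u v"
      by (simp_all add: det3_add det3_smul)
    then show ?thesis unfolding z using det by simp
  qed
  \<comment> \<open>A basis cannot contain the zero map, so \<open>\<kappa>\<close> joins the three
    lifts only when it is nonzero; the formula for sums over \<open>B\<close> still covers both
    cases.\<close>
  define K where "K = (if \<kappa> = 0 then {} else {\<kappa>})"
  define B where "B = {\<theta>0, \<theta>1, \<theta>2} \<union> K"
  have finB: "finite B" by (simp add: B_def K_def)
  have sumB: "(\<Sum>x\<in>B. mscale (f x) x) = mscale (f \<theta>0) \<theta>0 + mscale (f \<theta>1) \<theta>1 + mscale (f \<theta>2) \<theta>2 + mscale (f \<kappa>) \<kappa>" for f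
  proof (cases "\<kappa> = 0")
    case True
    have "mscale (f 0) 0 = 0" by (rule maps.scale_zero_right)
    then show ?thesis using True ne by (simp add: B_def K_def add.assoc)
  next
    case False
    then have "B = {\<theta>0, \<theta>1, \<theta>2, \<kappa>}" by (auto simp: B_def K_def)
    then show ?thesis using ne by (simp add: add.assoc)
  qed
  have img: "map3 (mscale f \<theta>0 + mscale g \<theta>1 + mscale h \<theta>2 + mscale k \<kappa>) y = smul f y + smul g u + smul h v" for f g h k
    by (simp only: map3_plus map3_mscale t kappa smul_simps add_0_right)
  have BD: "B \<subseteq> log_derivations A"
    using t c kappa y_in_logs by (auto simp: B_def K_def log_derivations_iff logs_def)
  moreover have "maps.independent B"
  proof
    assume "maps.dependent B"
    then obtain f x where f: "x \<in> B" "f x \<noteq> 0" "(\<Sum>x\<in>B. mscale (f x) x) = 0"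
      using maps.dependent_finite[OF finB] by blast
    have z: "mscale (f \<theta>0) \<theta>0 + mscale (f \<theta>1) \<theta>1 + mscale (f \<theta>2) \<theta>2 + mscale (f \<kappa>) \<kappa> = 0"
      using f(3) sumB by simp
    have "smul (f \<theta>0) y + smul (f \<theta>1) u + smul (f \<theta>2) v = 0"
      unfolding img[of _ _ _ "f \<kappa>", symmetric] z by (rule map3_zero)
    then have f0: "f \<theta>0 = 0" "f \<theta>1 = 0" "f \<theta>2 = 0" using indep by blast+
    then have x: "x = \<kappa>" "\<kappa> \<noteq> 0" using f(1,2) by (auto simp: B_def K_def split: if_splits)
    have "mscale (f \<kappa>) \<kappa> = 0" using z unfolding f0 maps.scale_zero_left by simp
    then have "f \<kappa> * \<kappa> p = 0" for p by (metis mscale_def zero_fun_apply)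
    moreover obtain p where "\<kappa> p \<noteq> 0" using x(2) by (auto simp: fun_eq_iff)
    ultimately show False using f(2) x(1) by (metis mult_eq_0_iff)
  qed
  moreover have "maps.span B = log_derivations A"
  proof
    show "maps.span B \<subseteq> log_derivations A" by (rule maps.span_minimal[OF BD subspace_log_derivations])
    show "log_derivations A \<subseteq> maps.span B"
    proof
      fix \<theta> assume "\<theta> \<in> log_derivations A"
      then have th: "\<theta> \<in> derivations" "map3 \<theta> y \<in> logs L" using log_derivations_iff by auto
      then obtain f g h where fgh: "map3 \<theta> y = smul f y + smul g u + smul h v"
        using exps_generate[OF arr_L w] by blast
      define \<eta> where "\<eta> = mscale f \<theta>0 + mscale g \<theta>1 + mscale h \<theta>2"
      have "\<eta> \<in> derivations" unfolding \<eta>_def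
        by (intro maps.subspace_add[OF derivations_subspace] maps.subspace_scale[OF derivations_subspace] t)
      then have "\<theta> - \<eta> \<in> derivations" by (rule maps.subspace_diff[OF derivations_subspace th(1)])
      moreover have "map3 (\<theta> - \<eta>) y = 0"
      proof -
        have "map3 (\<theta> - \<eta>) y = map3 \<theta> y - map3 \<eta> y" by (cases y) simp
        also have "map3 \<eta> y = map3 \<theta> y" unfolding fgh \<eta>_def by (simp only: map3_plus map3_mscale t)
        finally show ?thesis unfolding diff_self .
      qed
      ultimately obtain k where k: "\<theta> - \<eta> = mscale k \<kappa>" using kernel by blast
      define F where "F x = (if x = \<theta>0 then f else if x = \<theta>1 then g else if x = \<theta>2 then h else k)" for x
      have "F \<theta>0 = f" "F \<theta>1 = g" "F \<theta>2 = h" "F \<kappa> = k" using ne by (auto simp: F_def)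
      then have "(\<Sum>x\<in>B. mscale (F x) x) = \<eta> + mscale k \<kappa>" unfolding sumB by (simp add: \<eta>_def)
      also have "\<dots> = \<theta>" unfolding k[symmetric] by simp
      finally show "\<theta> \<in> maps.span B" unfolding maps.span_finite[OF finB] by blast
    qed
  qed
  ultimately show ?thesis unfolding free_arrangement_def by blast
qed

lemma free_iff_ex_exps: "free_arrangement A \<longleftrightarrow> (\<exists>d1 d2. exps L d1 d2)"
  using exps_of_free free_of_exps by blast

end

section \<open>The two arrangements of a gain graph on three vertices\<close>

definition gains :: "(3 \<times> 3 \<times> int) set set \<Rightarrow> 3 \<Rightarrow> int set" where
  "gains \<Gamma> i = {g. gain_edge i (i + 1) g \<in> \<Gamma>}"

lemma gain_edge_swap: "gain_edge j i (- g) = gain_edge i j g"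
  by (auto simp: gain_edge_def)

lemma finite_gains:
  assumes "simple_gain_graph \<Gamma>"
  shows "finite (gains \<Gamma> i)"
proof -
  have "inj (gain_edge i (i + 1))"
    by (rule injI) (auto simp: gain_edge_def doubleton_eq_iff)
  then have "finite (gain_edge i (i + 1) -` \<Gamma>)"
    using assms by (intro finite_vimageI) (simp_all add: simple_gain_graph_def)
  then show ?thesis by (simp add: gains_def vimage_def)
qed

text \<open>Two distinct vertices among three are consecutive in the cyclic order, so every class
  has a representative from some vertex to the next, possibly after negating the gain.\<close>

lemma gain_edge_cases:
  assumes "simple_gain_graph \<Gamma>" "gain_edge i j g \<in> \<Gamma>"
  shows "j = i + 1 \<and> g \<in> gains \<Gamma> i \<or> i = j + 1 \<and> - g \<in> gains \<Gamma> j"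
proof -
  have ne: "i \<noteq> j"
    using assms by (fastforce simp: simple_gain_graph_def gain_edge_def doubleton_eq_iff)
  have "j \<in> {i, i + 1, i + 2}" using UNIV_three[of i] by blast
  then consider "j = i + 1" | "j = i + 2" using ne by blast
  then show ?thesis
  proof cases
    case 1
    then show ?thesis using assms(2) by (simp add: gains_def)
  next
    case 2
    then have "i = j + 1" using three_add_3(4)[of i] by simp
    then show ?thesis using assms(2) by (simp add: gains_def gain_edge_swap)
  qed
qed

lemma three_cases: obtains "(i::3) = 0" | "i = 1" | "i = 2"
  using UNIV_three[of 0] by (metis UNIV_I add_0 empty_iff insert_iff)

lemma three_arith: "(3::3) = 0" "(0::3) + 1 = 1" "(1::3) + 1 = 2" "(2::3) + 1 = 0" "(0::3) + 2 = 2" "(1::3) + 2 = 0" "(2::3) + 2 = 1"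
  by simp_all

lemma three_numerals: "(0::3) \<noteq> 1" "(0::3) \<noteq> 2" "(1::3) \<noteq> 0" "(1::3) \<noteq> 2" "(2::3) \<noteq> 0" "(2::3) \<noteq> 1"
  by simp_all

lemma derivation_diff:
  assumes "\<theta> \<in> derivations"
  shows "\<theta> (f - g) = \<theta> f - \<theta> g"
  using derivationD(1)[OF assms, of "f - g" g] by simp

text \<open>Derivations with arbitrary values on \<open>y\<close> exist; those with the unit vectors
  as values read off the coefficients of a vanishing combination.\<close>

lemma dotC_y_eq_0_of_lift:
  fixes y :: "('n::finite, 'k::field) mpol \<times> ('n, 'k) mpol \<times> ('n, 'k) mpol"
  assumes lift: "\<And>v. \<exists>\<theta>\<in>derivations. map3 \<theta> y = v" and z: "dotC a y = 0"
  shows "a = 0"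
proof -
  have "dotC a v = 0" for v :: "('n, 'k) mpol \<times> ('n, 'k) mpol \<times> ('n, 'k) mpol"
  proof -
    obtain \<theta> where t: "\<theta> \<in> derivations" "map3 \<theta> y = v" using lift by blast
    have "\<theta> 0 = 0" using derivationD(4)[OF t(1), of 0] by simp
    then show ?thesis using derivation_dotC[OF t(1), of a y] t(2) z by simp
  qed
  from this[of "(1, 0, 0)"] this[of "(0, 1, 0)"] this[of "(0, 0, 1)"] show ?thesis
    by (cases a) (simp add: zero_prod_def)
qed

subsection \<open>The cone\<close>

text \<open>All hyperplanes of the cone contain the vector with equal \<open>x\<close> coordinates
  and \<open>z = 0\<close>. These forms are a basis of the linear forms vanishing on it.\<close>

definition cone_y :: "(3 option, rat) mpol \<times> (3 option, rat) mpol \<times> (3 option, rat) mpol" where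
  "cone_y = (Var (Some 0) - Var (Some 1), Var (Some 1) - Var (Some 2), Var None)"

definition cone_vec :: "3 \<Rightarrow> int \<Rightarrow> rat \<times> rat \<times> rat" where
  "cone_vec i g = (if i = 0 then (1, 0, - of_int g) else if i = 1 then (0, 1, - of_int g) else (- 1, - 1, - of_int g))"

lemma cone_lift: "\<exists>\<theta>\<in>derivations. map3 \<theta> cone_y = v"
proof (cases v)
  case (fields v1 v2 v3)
  define \<theta> where "\<theta> = vector_derivation
    (\<lambda>k. case k of None \<Rightarrow> v3 | Some i \<Rightarrow> if i = 0 then v1 + v2 else if i = (1::3) then v2 else 0)"
  have t: "\<theta> \<in> derivations" unfolding \<theta>_def by (rule vector_derivation)
  have "map3 \<theta> cone_y = v"
    unfolding cone_y_def fields map3.simps derivation_diff[OF t]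
    by (simp add: \<theta>_def vector_derivation_Var)
  then show ?thesis using t by blast
qed

lemma cone_linear_coordinates: "linear_coordinates cone_y"
proof
  show "homog3 1 cone_y" unfolding cone_y_def all3.simps by (intro conjI homog_diff homog_Var)
  show "dotC a cone_y = 0 \<Longrightarrow> a = 0" for a by (rule dotC_y_eq_0_of_lift[OF cone_lift])
qed

lemma cone_form_vec:
  "dotC (cone_vec i g) cone_y = Var (Some i) - Var (Some (i + 1)) - Const (of_int g) * Var None"
  by (cases i rule: three_cases)
     (simp_all add: cone_vec_def cone_y_def three_arith three_numerals Const_simps algebra_simps)

lemma cone_gain_model: "gain_model cone_y cone_vec {(0, 0, 1)} (\<lambda>_. {(0, 0, 1)}) 0"
proof -
  interpret linear_coordinates cone_y by (rule cone_linear_coordinates)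
  show ?thesis
  proof
    show "arr {(0, 0, 1)}" by (simp add: arr_def zero_prod_def)
    have "(1, 0, 0) \<in> logs {(0, 0, 1)}" "(0, 1, 0) \<in> logs {(0, 0, 1)}" by (simp_all add: logs_def)
    moreover have "det3 cone_y (1, 0, 0) (0, 1, 0) = Const 1 * forms {(0, 0, 1)}" by (simp add: cone_y_def)
    ultimately have "exps_witness {(0, 0, 1)} 0 0 (1, 0, 0) (0, 1, 0)"
      unfolding exps_witness_def by (intro conjI exI[of _ 1]) simp_all
    then show "exps {(0, 0, 1)} 0 0" unfolding exps_def by blast
    show "cross s (cone_vec i g) \<noteq> 0" if "s \<in> {(0, 0, 1)}" for s i g
      using that by (simp add: cone_vec_def zero_prod_def)
    show "cross (cone_vec i g) (cone_vec j h) \<noteq> 0" if "(i, g) \<noteq> (j, h)" for i g j h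
      using that by (cases i rule: three_cases; cases j rule: three_cases)
        (auto simp: cone_vec_def zero_prod_def three_numerals)
    show "\<exists>t\<in>{(0, 0, 1)}. det3 (cone_vec i e) (cone_vec i g) t = 0" for i e g
      by (simp add: cone_vec_def)
    show "det3 (cone_vec i e) t (cone_vec j g) \<noteq> 0" if "t \<in> {(0, 0, 1)}" "j \<noteq> i" for i e t j g
      using that by (cases i rule: three_cases; cases j rule: three_cases) (auto simp: cone_vec_def three_numerals)
    show "det3 (cone_vec i e) (cone_vec j g) (cone_vec j h) \<noteq> 0" if "j \<noteq> i" "g \<noteq> h" for i e j g h
      using that by (cases i rule: three_cases; cases j rule: three_cases) (auto simp: cone_vec_def three_numerals)
    show "det3 (cone_vec i e) (cone_vec (i + 1) g) (cone_vec (i + 2) h) = 0 \<longleftrightarrow> e + g + h = 0" for i e g h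
    proof -
      have "det3 (cone_vec i e) (cone_vec (i + 1) g) (cone_vec (i + 2) h) = - of_int (e + g + h)"
        by (cases i rule: three_cases) (simp_all add: cone_vec_def three_numerals three_arith)
      then show ?thesis by (metis neg_equal_0_iff_equal of_int_eq_0_iff)
    qed
  qed simp_all
qed

lemma cone_defining_form:
  assumes "i \<noteq> j"
  shows "defining_form (Var (Some i) - Var (Some j) - Const (of_int g) * Var None)
    {x::rat^'v::finite option. x $ Some i - x $ Some j = of_int g * x $ None}"
proof -
  let ?a = "(\<chi> k. (if k = Some i then 1 else 0) + (if k = Some j then -1 else 0)
      + (if k = None then - of_int g else 0)) :: rat^'v option"
  have "?a $ Some i = 1" using assms by simp
  then have "?a \<noteq> 0" by (metis zero_index zero_neq_one)
  moreover have "(\<Sum>k\<in>UNIV. ?a $ k * x $ k) = x $ Some i - x $ Some j - of_int g * x $ None" for x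
    by (simp add: distrib_right sum.distrib if_distrib[of "\<lambda>c. c * _"] cong: if_cong)
  moreover have "linear_form ?a = Var (Some i) - Var (Some j) - Const (of_int g) * Var None"
    by (simp add: linear_form_def Const_simps distrib_right sum.distrib if_distrib[of Const] if_distrib[of "\<lambda>c. c * _"] cong: if_cong)
  ultimately show ?thesis unfolding defining_form_def by (intro exI[of _ ?a]) auto
qed

lemma defining_form_Var: "defining_form (Var i) {x::'k::field^'n::finite. x $ i = 0}"
proof -
  have "linear_form (axis i 1 :: 'k ^ 'n) = Var i"
    by (simp add: linear_form_def axis_def if_distrib[of Const] if_distrib[of "\<lambda>c. c * _"] cong: if_cong)
  then show ?thesis
    unfolding defining_form_def
    by (intro exI[of _ "axis i 1"]) (simp add: axis_def if_distrib[of "\<lambda>c. c * _"] vec_eq_iff cong: if_cong)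
qed

lemma free_cone_arrangement_iff:
  assumes \<Gamma>: "simple_gain_graph \<Gamma>"
  shows "free_arrangement (cone_arrangement \<Gamma>) \<longleftrightarrow> (\<exists>d1 d2. inductively_free (gains \<Gamma>) d1 d2)"
proof -
  interpret gain_model cone_y cone_vec "{(0, 0, 1)}" "\<lambda>_. {(0, 0, 1)}" 0 by (rule cone_gain_model)
  have fin: "\<forall>i. finite (gains \<Gamma> i)" using finite_gains[OF \<Gamma>] by blast
  \<comment> \<open>The sum of the partial derivatives in the \<open>x\<close> directions kills all
    differences and \<open>z\<close>; its values 1 provide the nonzero constant term.\<close>
  define \<kappa> where "\<kappa> = vector_derivation (\<lambda>k. case k of None \<Rightarrow> 0 | Some (i::3) \<Rightarrow> (1 :: (3 option, rat) mpol))"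
  have kd: "\<kappa> \<in> derivations" unfolding \<kappa>_def by (rule vector_derivation)
  have kv: "\<kappa> (Var None) = 0" "\<kappa> (Var (Some i)) = 1" for i by (simp_all add: \<kappa>_def vector_derivation_Var)
  have plane: "H \<in> cone_arrangement \<Gamma> \<longleftrightarrow> H = {x. x $ None = 0} \<or>
      (\<exists>i g. g \<in> gains \<Gamma> i \<and> H = {x. x $ Some i - x $ Some (i + 1) = of_int g * x $ None})" (is "_ \<longleftrightarrow> ?R H") for H
  proof
    assume "H \<in> cone_arrangement \<Gamma>"
    then consider "H = {x. x $ None = 0}" | i j g where "gain_edge i j g \<in> \<Gamma>"
      "H = {x. x $ Some i - x $ Some j = of_int g * x $ None}"
      by (auto simp: cone_arrangement_def)
    then show "?R H"
    proof cases
      case (2 i j g)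
      from gain_edge_cases[OF \<Gamma> 2(1)] show ?thesis
      proof
        assume "j = i + 1 \<and> g \<in> gains \<Gamma> i"
        then show ?thesis using 2(2) by blast
      next
        assume j: "i = j + 1 \<and> - g \<in> gains \<Gamma> j"
        moreover have "H = {x. x $ Some j - x $ Some (j + 1) = of_int (- g) * x $ None}"
          unfolding 2(2) using j by (auto simp: algebra_simps)
        ultimately show ?thesis by blast
      qed
    qed simp
  next
    assume "?R H"
    then show "H \<in> cone_arrangement \<Gamma>" unfolding cone_arrangement_def gains_def by blast
  qed
  have dN: "defining_form (form (0, 0, 1)) {x. x $ None = 0}"
    using defining_form_Var[of "None :: 3 option"] by (simp add: cone_y_def)
  have dV: "defining_form (form (cone_vec i g)) {x. x $ Some i - x $ Some (i + 1) = of_int g * x $ None}" for i g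
    unfolding cone_form_vec by (rule cone_defining_form) simp
  interpret arrangement_coordinates cone_y "cone_arrangement \<Gamma>" "lines (gains \<Gamma>)" \<kappa>
  proof
    show "arr (lines (gains \<Gamma>))" by (rule arr_lines[OF fin])
    show "lines (gains \<Gamma>) \<noteq> {}" by (simp add: lines_def)
    show "\<exists>a\<in>lines (gains \<Gamma>). defining_form (form a) H" if "H \<in> cone_arrangement \<Gamma>" for H
      using that dN dV unfolding plane Bex_def in_lines by blast
    show "\<exists>H\<in>cone_arrangement \<Gamma>. defining_form (form a) H" if "a \<in> lines (gains \<Gamma>)" for a
      using that dN dV unfolding plane Bex_def in_lines by blast
    show "map3 \<kappa> cone_y = 0" by (simp add: cone_y_def derivation_diff[OF kd] kv zero_prod_def)
    show "\<exists>g. \<theta> = mscale g \<kappa>" if t: "\<theta> \<in> derivations" and z: "map3 \<theta> cone_y = 0" for \<theta>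
    proof -
      have e: "\<theta> (Var (Some 1)) = \<theta> (Var (Some 0))" "\<theta> (Var (Some 2)) = \<theta> (Var (Some 0))" "\<theta> (Var None) = 0"
        using z by (simp_all add: cone_y_def derivation_diff[OF t] zero_prod_def)
      have "\<theta> = mscale (\<theta> (Var (Some 0))) \<kappa>"
      proof (rule derivation_eqI[OF t maps.subspace_scale[OF derivations_subspace kd]])
        fix k :: "3 option"
        show "\<theta> (Var k) = mscale (\<theta> (Var (Some 0))) \<kappa> (Var k)"
        proof (cases k)
          case None
          then show ?thesis using e by (simp add: mscale_def kv)
        next
          case (Some i)
          then show ?thesis using e by (cases i rule: three_cases) (simp_all add: mscale_def kv)
        qed
      qed
      then show ?thesis by blast
    qed
    have "Poly_Mapping.lookup (\<kappa> (Var (Some 0))) 0 \<noteq> 0" by (simp add: kv)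
    then show "\<kappa> = 0 \<and> CARD(3 option) = 3 \<or> CARD(3 option) = 4 \<and> (\<exists>i. Poly_Mapping.lookup (\<kappa> (Var i)) 0 \<noteq> 0)"
      by (intro disjI2 conjI exI) simp_all
  qed (rule cone_lift kd)+
  show ?thesis unfolding free_iff_ex_exps by (rule ex_exps_iff[OF fin])
qed

subsection \<open>The multiplicative arrangement\<close>

definition q_y :: "(3, complex) mpol \<times> (3, complex) mpol \<times> (3, complex) mpol" where
  "q_y = (Var 0, Var 1, Var 2)"

definition q_vec :: "complex \<Rightarrow> 3 \<Rightarrow> int \<Rightarrow> complex \<times> complex \<times> complex" where
  "q_vec q i g = (if i = 0 then (1, - (q powi g), 0) else if i = 1 then (0, 1, - (q powi g)) else (- (q powi g), 0, 1))"

definition unit3 :: "3 \<Rightarrow> complex \<times> complex \<times> complex" where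
  "unit3 i = (if i = 0 then (1, 0, 0) else if i = 1 then (0, 1, 0) else (0, 0, 1))"

text \<open>The condition on \<open>q\<close> enters here: zero and roots of unity are algebraic,
  and a positive real other than 1 has no nontrivial power equal to 1.\<close>

lemma powi_eq_1_iff:
  assumes "\<not> algebraic q \<or> (\<exists>r::real. q = complex_of_real r \<and> r > 0 \<and> r \<noteq> 1)"
  shows "q \<noteq> 0" "q powi n = 1 \<longleftrightarrow> n = 0"
proof -
  show q0: "q \<noteq> 0" using assms by auto
  have *: "n = 0" if "q ^ n = 1" for n
  proof (rule ccontr)
    assume n: "n \<noteq> 0"
    from assms show False
    proof
      assume "\<not> algebraic q"
      let ?p = "monom 1 n - 1 :: complex poly"
      have "coeff ?p n \<noteq> 0" using n by (simp add: coeff_1)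
      then have "?p \<noteq> 0" by (metis coeff_0)
      moreover have "coeff ?p i \<in> \<int>" for i by (simp add: coeff_1)
      moreover have "poly ?p q = 0" using that by (simp add: poly_monom)
      ultimately have "algebraic q" by (intro algebraicI[of ?p])
      then show False using \<open>\<not> algebraic q\<close> by blast
    next
      assume "\<exists>r::real. q = complex_of_real r \<and> r > 0 \<and> r \<noteq> 1"
      then obtain r where r: "q = complex_of_real r" "r > 0" "r \<noteq> 1" by blast
      have "r ^ n = 1" using that unfolding r(1) by (metis of_real_eq_1_iff of_real_power)
      then show False using r n by (metis power_eq_1_iff less_imp_le not_gr_zero zero_le_one power_eq_iff_eq_base power_one zero_less_one)
    qed
  qed
  show "q powi n = 1 \<longleftrightarrow> n = 0"
  proof
    assume h: "q powi n = 1"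
    show "n = 0"
    proof (cases "n \<ge> 0")
      case True
      then have "q ^ nat n = 1" using h by (simp add: power_int_def)
      then show ?thesis using *[of "nat n"] True by simp
    next
      case False
      then have "q ^ nat (- n) = 1" using h by (simp add: power_int_def power_inverse inverse_eq_1_iff)
      then show ?thesis using *[of "nat (- n)"] False by simp
    qed
  qed simp
qed

lemma q_lift: "\<exists>\<theta>\<in>derivations. map3 \<theta> q_y = v"
proof (cases v)
  case (fields v1 v2 v3)
  define \<theta> where "\<theta> = vector_derivation (\<lambda>i::3. if i = 0 then v1 else if i = 1 then v2 else v3)"
  have "map3 \<theta> q_y = v"
    unfolding q_y_def fields map3.simps by (simp add: \<theta>_def vector_derivation_Var)
  moreover have "\<theta> \<in> derivations" unfolding \<theta>_def by (rule vector_derivation)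
  ultimately show ?thesis by blast
qed

lemma q_linear_coordinates: "linear_coordinates q_y"
proof
  show "homog3 1 q_y" unfolding q_y_def all3.simps by (intro conjI homog_Var)
  show "dotC a q_y = 0 \<Longrightarrow> a = 0" for a by (rule dotC_y_eq_0_of_lift[OF q_lift])
qed

lemma q_form_vec: "dotC (q_vec q i g) q_y = Var i - Const (q powi g) * Var (i + 1)"
  by (cases i rule: three_cases)
     (simp_all add: q_vec_def q_y_def three_arith three_numerals Const_simps algebra_simps)

lemma q_form_unit: "dotC (unit3 i) q_y = Var i"
  by (cases i rule: three_cases) (simp_all add: unit3_def q_y_def three_numerals)

lemma range_unit3: "range unit3 = {(1, 0, 0), (0, 1, 0), (0, 0, 1)}"
proof -
  have "(UNIV :: 3 set) = {0, 1, 2}" using UNIV_three[of 0] by simp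
  then have *: "range unit3 = unit3 ` {0, 1, 2}" by simp
  show ?thesis unfolding * by (auto simp: unit3_def three_numerals)
qed

lemma q_gain_model:
  assumes q: "q \<noteq> 0" "\<And>n. q powi n = 1 \<longleftrightarrow> n = 0"
  shows "gain_model q_y (q_vec q) (range unit3) (\<lambda>i. {unit3 i, unit3 (i + 2)}) 1"
proof -
  interpret linear_coordinates q_y by (rule q_linear_coordinates)
  have inj: "q powi g = q powi h \<longleftrightarrow> g = h" for g h
  proof
    assume "q powi g = q powi h"
    then have "q powi (g - h) = 1" using q(1) by (simp add: power_int_diff)
    then show "g = h" using q(2) by simp
  qed simp
  have pnz: "q powi g \<noteq> 0" for g using q(1) by (simp add: power_int_eq_0_iff)
  have one: "1 = q powi g \<longleftrightarrow> g = 0" for g using q(2)[of g] by metis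
  note s = q_vec_def unit3_def three_numerals three_arith pnz inj q one
  show ?thesis
  proof
    show "arr (range unit3)" unfolding range_unit3 by (simp add: arr_def zero_prod_def)
    \<comment> \<open>Together with the Euler vector these generate the logarithmic vectors of the
      coordinate lines; the determinant is the product of the three variables.\<close>
    have m: "(Var 0, 0, 0) \<in> logs (range unit3)" "(0, Var 1, 0) \<in> logs (range unit3)"
      unfolding range_unit3 logs_def by (simp_all add: q_y_def)
    have "det3 q_y (Var 0, 0, 0) (0, Var 1, 0) = Const 1 * forms (range unit3)"
      unfolding range_unit3 by (simp add: q_y_def)
    then have "exps_witness (range unit3) 1 1 (Var 0, 0, 0) (0, Var 1, 0)"
      unfolding exps_witness_def all3.simps using m by (intro conjI exI[of _ 1] homog_Var homog_0) simp_all
    then show "exps (range unit3) 1 1" unfolding exps_def by blast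
    show "{unit3 i, unit3 (i + 2)} \<subseteq> range unit3" for i by simp
    show "card {unit3 i, unit3 (i + 2)} = Suc 1" for i
      by (cases i rule: three_cases) (simp_all add: s)
    show "cross s (q_vec q i g) \<noteq> 0" if "s \<in> range unit3" for s i g
      using that unfolding range_unit3 by (cases i rule: three_cases) (auto simp: s zero_prod_def)
    show "cross (q_vec q i g) (q_vec q j h) \<noteq> 0" if "(i, g) \<noteq> (j, h)" for i g j h
      using that by (cases i rule: three_cases; cases j rule: three_cases) (auto simp: s zero_prod_def)
    show "det3 (q_vec q i e) a b \<noteq> 0" if "a \<in> {unit3 i, unit3 (i + 2)}" "b \<in> {unit3 i, unit3 (i + 2)}" "a \<noteq> b" for i e a b
      using that by (cases i rule: three_cases) (auto simp: s)
    show "\<exists>t\<in>{unit3 i, unit3 (i + 2)}. det3 (q_vec q i e) a t = 0" if "a \<in> range unit3" for i e a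
      using that unfolding range_unit3 by (cases i rule: three_cases) (auto simp: s)
    show "\<exists>t\<in>{unit3 i, unit3 (i + 2)}. det3 (q_vec q i e) (q_vec q i g) t = 0" for i e g
      by (cases i rule: three_cases) (simp_all add: s)
    show "det3 (q_vec q i e) t (q_vec q j g) \<noteq> 0" if "t \<in> {unit3 i, unit3 (i + 2)}" "j \<noteq> i" for i e t j g
      using that by (cases i rule: three_cases; cases j rule: three_cases) (auto simp: s)
    show "det3 (q_vec q i e) (q_vec q j g) (q_vec q j h) \<noteq> 0" if "j \<noteq> i" "g \<noteq> h" for i e j g h
      using that by (cases i rule: three_cases; cases j rule: three_cases) (auto simp: s)
    show "det3 (q_vec q i e) (q_vec q (i + 1) g) (q_vec q (i + 2) h) = 0 \<longleftrightarrow> e + g + h = 0" for i e g h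
    proof -
      \<comment> \<open>The multiplicative counterpart of the sum of gains in the cone: three edge
        lines concur exactly when the product of the powers of \<open>q\<close> around the triangle
        is 1.\<close>
      have "det3 (q_vec q i e) (q_vec q (i + 1) g) (q_vec q (i + 2) h) = 1 - q powi (e + g + h)"
        by (cases i rule: three_cases) (simp_all add: q_vec_def three_numerals three_arith power_int_add q(1) algebra_simps)
      then show ?thesis using q(2)[of "e + g + h"] by (metis eq_iff_diff_eq_0)
    qed
  qed
qed

lemma q_defining_form:
  assumes "i \<noteq> j"
  shows "defining_form (Var i - Const (q powi g) * Var j) {x::complex^'v::finite. x $ i - q powi g * x $ j = 0}"
proof -
  let ?a = "(\<chi> k. (if k = i then 1 else 0) + (if k = j then - (q powi g) else 0)) :: complex^'v"
  have "?a $ i = 1" using assms by simp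
  then have "?a \<noteq> 0" by (metis zero_index zero_neq_one)
  moreover have "(\<Sum>k\<in>UNIV. ?a $ k * x $ k) = x $ i - q powi g * x $ j" for x
    by (simp add: distrib_right sum.distrib if_distrib[of "\<lambda>c. c * _"] cong: if_cong)
  moreover have "linear_form ?a = Var i - Const (q powi g) * Var j"
    by (simp add: linear_form_def Const_simps distrib_right sum.distrib if_distrib[of Const] if_distrib[of "\<lambda>c. c * _"] cong: if_cong)
  ultimately show ?thesis unfolding defining_form_def by (intro exI[of _ ?a]) auto
qed

lemma free_q_arrangement_iff:
  assumes \<Gamma>: "simple_gain_graph \<Gamma>" and q: "q \<noteq> 0" "\<And>n. q powi n = 1 \<longleftrightarrow> n = 0"
  shows "free_arrangement (q_arrangement q \<Gamma>) \<longleftrightarrow> (\<exists>d1 d2. inductively_free (gains \<Gamma>) d1 d2)"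
proof -
  interpret gain_model q_y "q_vec q" "range unit3" "\<lambda>i. {unit3 i, unit3 (i + 2)}" 1 by (rule q_gain_model[OF q])
  have fin: "\<forall>i. finite (gains \<Gamma> i)" using finite_gains[OF \<Gamma>] by blast
  have plane: "H \<in> q_arrangement q \<Gamma> \<longleftrightarrow> (\<exists>i. H = {x. x $ i = 0}) \<or>
      (\<exists>i g. g \<in> gains \<Gamma> i \<and> H = {x. x $ i - q powi g * x $ (i + 1) = 0})" (is "_ \<longleftrightarrow> ?R H") for H
  proof
    assume "H \<in> q_arrangement q \<Gamma>"
    then consider i where "H = {x. x $ i = 0}" | i j g where "gain_edge i j g \<in> \<Gamma>"
      "H = {x. x $ i - q powi g * x $ j = 0}"
      by (auto simp: q_arrangement_def)
    then show "?R H"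
    proof cases
      case (2 i j g)
      from gain_edge_cases[OF \<Gamma> 2(1)] show ?thesis
      proof
        assume "j = i + 1 \<and> g \<in> gains \<Gamma> i"
        then show ?thesis using 2(2) by blast
      next
        assume j: "i = j + 1 \<and> - g \<in> gains \<Gamma> j"
        have "x $ i - q powi g * x $ j = - (q powi g) * (x $ j - q powi (- g) * x $ i)" for x :: "complex ^ 3"
          using q(1) by (simp add: power_int_minus algebra_simps power_int_eq_0_iff)
        then have "x $ i - q powi g * x $ j = 0 \<longleftrightarrow> x $ j - q powi (- g) * x $ i = 0" for x :: "complex ^ 3"
          using q(1) by (simp only: mult_eq_0_iff neg_equal_0_iff_equal power_int_eq_0_iff) simp
        then have "H = {x. x $ j - q powi (- g) * x $ (j + 1) = 0}" unfolding 2(2) using j by simp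
        then show ?thesis using j by blast
      qed
    qed blast
  next
    assume "?R H"
    then show "H \<in> q_arrangement q \<Gamma>" unfolding q_arrangement_def gains_def by blast
  qed
  have dU: "defining_form (form (unit3 i)) {x. x $ i = 0}" for i
    unfolding q_form_unit by (rule defining_form_Var)
  have dV: "defining_form (form (q_vec q i g)) {x. x $ i - q powi g * x $ (i + 1) = 0}" for i g
    unfolding q_form_vec by (rule q_defining_form) simp
  interpret arrangement_coordinates q_y "q_arrangement q \<Gamma>" "lines (gains \<Gamma>)" 0
  proof
    show "arr (lines (gains \<Gamma>))" by (rule arr_lines[OF fin])
    show "lines (gains \<Gamma>) \<noteq> {}" by (simp add: lines_def)
    show "\<exists>a\<in>lines (gains \<Gamma>). defining_form (form a) H" if "H \<in> q_arrangement q \<Gamma>" for H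
      using that dU dV unfolding plane Bex_def in_lines by blast
    show "\<exists>H\<in>q_arrangement q \<Gamma>. defining_form (form a) H" if "a \<in> lines (gains \<Gamma>)" for a
      using that dU dV unfolding plane Bex_def in_lines by blast
    show "\<exists>\<theta>\<in>derivations. map3 \<theta> q_y = v" for v by (rule q_lift)
    show "0 \<in> derivations" by (rule maps.subspace_0[OF derivations_subspace])
    show "map3 0 q_y = 0" by (rule map3_zero)
    show "\<exists>g. \<theta> = mscale g 0" if t: "\<theta> \<in> derivations" and z: "map3 \<theta> q_y = 0" for \<theta>
    proof -
      have e: "\<theta> (Var 0) = 0" "\<theta> (Var 1) = 0" "\<theta> (Var 2) = 0"
        using z by (simp_all add: q_y_def zero_prod_def)
      have "\<theta> (Var i) = 0" for i using e by (cases i rule: three_cases) simp_all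
      then have "\<theta> = 0"
        by (intro derivation_eqI[OF t maps.subspace_0[OF derivations_subspace]]) simp
      then show ?thesis by (metis maps.scale_zero_right)
    qed
  qed simp
  show ?thesis unfolding free_iff_ex_exps by (rule ex_exps_iff[OF fin])
qed

theorem theorem1p19:
  fixes \<Gamma> :: "(3 \<times> 3 \<times> int) set set" and q :: complex
  assumes "simple_gain_graph \<Gamma>"
    and "\<not> algebraic q \<or> (\<exists>r::real. q = complex_of_real r \<and> r > 0 \<and> r \<noteq> 1)"
  shows "free_arrangement (cone_arrangement \<Gamma>) \<longleftrightarrow> free_arrangement (q_arrangement q \<Gamma>)"
  unfolding free_cone_arrangement_iff[OF assms(1)]
    free_q_arrangement_iff[OF assms(1) powi_eq_1_iff[OF assms(2)]] ..

end
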